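(* Let $p$ be a prime and let $\mathcal{F}$ be a saturated fusion system on a finite $p$-group $P$. Then $\mathcal{F}$ has no proper, non-trivial normal subsystems if and only if $\mathcal{F}$ has no proper, non-trivial weakly normal subsystems.
   Context: Maps are written on the right and composed from left to right. A fusion system $\mathcal{F}$ on a finite $p$-group $P$ is a category whose objects are the subgroups of $P$ and whose morphism sets $\mathrm{Hom}_{\mathcal{F}}(Q,R)$ consist of injective group homomorphisms $Q\to R$, composed as maps, containing every conjugation map $c_g:x\mapsto g^{-1}xg$ with $g\in P$, $Q^g\le R$, and such that for each morphism $\phi:Q\to R$ in $\mathcal F$ the isomorphism $Q\to Q\phi$ and its inverse lie in $\mathcal{F}$. A subgroup $Q$ is fully $\mathcal F$-automized if $\mathrm{Aut}_P(Q)$ (the automorphisms of $Q$ induced by conjugation by elements of $N_P(Q)$) is a Sylow $p$-subgroup of $\mathrm{Aut}_{\mathcal{F}}(Q)$; $R$ is receptive if every isomorphism $\phi:S\to R$ in $\mathcal F$ extends to a morphism $N_\phi\to P$ in $\mathcal F$, where $N_\phi$ is the preimage in $N_P(S)$ of $\mathrm{Aut}_P(S)\cap \mathrm{Aut}_P(R)^{\phi^{-1}}$. $\mathcal{F}$ is saturated if every $\mathcal{F}$-conjugacy class of subgroups contains a fully automized, receptive member. A subsystem of $\mathcal F$ on $T\le P$ is a fusion system on $T$ all of whose morphisms lie in $\mathcal F$; it is proper if it is not equal to $\mathcal{F}$, and trivial if it is the fusion system on the trivial subgroup. A subgroup $T\le P$ is strongly $\mathcal{F}$-closed if $Q\phi\le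 T$ for every $Q\le T$ and every morphism $\phi:Q\to P$ in $\mathcal{F}$. A subsystem $\mathcal{E}$ of $\mathcal{F}$ on a strongly $\mathcal{F}$-closed subgroup $T$ is $\mathcal{F}$-invariant if, whenever $Q\le R\le T$, $\phi:Q\to R$ is a morphism in $\mathcal{E}$ and $\psi:R\to T$ is a morphism in $\mathcal{F}$, the map $\psi^{-1}\phi\psi:Q\psi\to R\psi$ is in $\mathcal{E}$. $\mathcal{E}$ is weakly normal in $\mathcal{F}$ if it is saturated and $\mathcal{F}$-invariant. $\mathcal{E}$ is normal in $\mathcal{F}$ if it is weakly normal and, in addition, every $\phi\in\mathrm{Aut}_{\mathcal{E}}(T)$ extends to some $\bar\phi\in\mathrm{Aut}_{\mathcal{F}}(TC_P(T))$ with $[\bar\phi,C_P(T)]\le Z(T)$, where $[\bar\phi,C_P(T)]$ is generated by the elements $x^{-1}(x\bar\phi)$, $x\in C_P(T)$. *)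

theory Defs
  imports "HOL-Algebra.Algebra"
begin

text \<open>
  Morphism sets are given as \<open>F Q R\<close>, with functions on \<open>Q\<close> represented extensionally as in
  \<^const>\<open>BijGroup\<close>. With this convention, and since \<open>F Q R\<close> is empty
  unless \<open>Q\<close> and \<open>R\<close> are subgroups of the underlying group, two fusion systems (possibly on
  different subgroups of a common group) are equal as categories iff they are equal as functions.
  Maps are written on the right in the mathematics, so ``first \<open>\<phi>\<close>, then \<open>\<psi>\<close>'' is
  \<open>compose Q \<psi> \<phi>\<close>.
\<close>

type_synonym 'a fusion = "'a set \<Rightarrow> 'a set \<Rightarrow> ('a \<Rightarrow> 'a) set"

definition conj_map :: "('a, 'b) monoid_scheme \<Rightarrow> 'a set \<Rightarrow> 'a \<Rightarrow> 'a \<Rightarrow> 'a" where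
  "conj_map G Q g = (\<lambda>x\<in>Q. inv\<^bsub>G\<^esub> g \<otimes>\<^bsub>G\<^esub> x \<otimes>\<^bsub>G\<^esub> g)"

locale finite_p_group = group G for G (structure) +
  fixes p :: nat
  assumes prime_p: "Factorial_Ring.prime p"
    and finite_carrier: "finite (carrier G)"
    and order_p_power: "\<exists>n. order G = p ^ n"

locale fusion_system = finite_p_group +
  fixes F :: "'a fusion"
  assumes objects: "\<phi> \<in> F Q R \<Longrightarrow> subgroup Q G \<and> subgroup R G"
    and morphism_hom: "\<phi> \<in> F Q R \<Longrightarrow> \<phi> \<in> hom (G\<lparr>carrier := Q\<rparr>) (G\<lparr>carrier := R\<rparr>)"
    and morphism_extensional: "\<phi> \<in> F Q R \<Longrightarrow> \<phi> \<in> extensional Q"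
    and morphism_inj: "\<phi> \<in> F Q R \<Longrightarrow> inj_on \<phi> Q"
    and conj_morphism:
      "\<lbrakk>subgroup Q G; subgroup R G; g \<in> carrier G; conj_map G Q g ` Q \<subseteq> R\<rbrakk>
        \<Longrightarrow> conj_map G Q g \<in> F Q R"
    and comp_morphism: "\<lbrakk>\<phi> \<in> F Q R; \<psi> \<in> F R S\<rbrakk> \<Longrightarrow> compose Q \<psi> \<phi> \<in> F Q S"
    and iso_onto_image: "\<phi> \<in> F Q R \<Longrightarrow> \<phi> \<in> F Q (\<phi> ` Q)"
    and inverse_morphism: "\<phi> \<in> F Q R \<Longrightarrow> restrict (inv_into Q \<phi>) (\<phi> ` Q) \<in> F (\<phi> ` Q) Q"

text \<open>
  A morphism of a fusion system has an inverse in the system iff it is bijective, by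
  \<open>inverse_morphism\<close>.
\<close>

definition fusion_isos :: "'a fusion \<Rightarrow> 'a set \<Rightarrow> 'a set \<Rightarrow> ('a \<Rightarrow> 'a) set" where
  "fusion_isos F Q R = {\<phi> \<in> F Q R. bij_betw \<phi> Q R}"

definition Aut_P :: "('a, 'b) monoid_scheme \<Rightarrow> 'a set \<Rightarrow> ('a \<Rightarrow> 'a) set" where
  "Aut_P G Q = conj_map G Q ` normalizer G Q"

text \<open>
  The multiplication inherited from \<^const>\<open>BijGroup\<close> is right-to-left composition, giving the
  opposite of the automorphism group with maps on the right; its subgroups, and hence its Sylow
  subgroups, are the same.
\<close>

definition Aut_F :: "'a fusion \<Rightarrow> 'a set \<Rightarrow> ('a \<Rightarrow> 'a) monoid" where
  "Aut_F F Q = (BijGroup Q)\<lparr>carrier := F Q Q\<rparr>"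

definition sylow_subgroup :: "nat \<Rightarrow> 'a set \<Rightarrow> ('a, 'b) monoid_scheme \<Rightarrow> bool" where
  "sylow_subgroup p H A \<longleftrightarrow> subgroup H A \<and> card H = p ^ multiplicity p (order A)"

definition fully_automized ::
    "('a, 'b) monoid_scheme \<Rightarrow> nat \<Rightarrow> 'a fusion \<Rightarrow> 'a set \<Rightarrow> bool" where
  "fully_automized G p F Q \<longleftrightarrow> sylow_subgroup p (Aut_P G Q) (Aut_F F Q)"

definition N_phi ::
    "('a, 'b) monoid_scheme \<Rightarrow> 'a set \<Rightarrow> 'a set \<Rightarrow> ('a \<Rightarrow> 'a) \<Rightarrow> 'a set" where
  "N_phi G S R \<phi> =
    {g \<in> normalizer G S.
      conj_map G S g \<in> Aut_P G S \<inter> {\<lambda>x\<in>S. inv_into S \<phi> (\<alpha> (\<phi> x)) |\<alpha>. \<alpha> \<in> Aut_P G R}}"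

definition receptive :: "('a, 'b) monoid_scheme \<Rightarrow> 'a fusion \<Rightarrow> 'a set \<Rightarrow> bool" where
  "receptive G F R \<longleftrightarrow>
    (\<forall>S. \<forall>\<phi> \<in> fusion_isos F S R.
      \<exists>\<psi> \<in> F (N_phi G S R \<phi>) (carrier G). \<forall>x\<in>S. \<psi> x = \<phi> x)"

definition saturated_fusion_system ::
    "('a, 'b) monoid_scheme \<Rightarrow> nat \<Rightarrow> 'a fusion \<Rightarrow> bool" where
  "saturated_fusion_system G p F \<longleftrightarrow>
    fusion_system G p F \<and>
    (\<forall>Q. subgroup Q G \<longrightarrow>
      (\<exists>R. fusion_isos F Q R \<noteq> {} \<and> fully_automized G p F R \<and> receptive G F R))"

definition subsystem ::
    "('a, 'b) monoid_scheme \<Rightarrow> nat \<Rightarrow> 'a fusion \<Rightarrow> 'a set \<Rightarrow> 'a fusion \<Rightarrow> bool" where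
  "subsystem G p F T E \<longleftrightarrow>
    subgroup T G \<and> fusion_system (G\<lparr>carrier := T\<rparr>) p E \<and> (\<forall>Q R. E Q R \<subseteq> F Q R)"

definition strongly_closed ::
    "('a, 'b) monoid_scheme \<Rightarrow> 'a fusion \<Rightarrow> 'a set \<Rightarrow> bool" where
  "strongly_closed G F T \<longleftrightarrow>
    subgroup T G \<and>
    (\<forall>Q \<phi>. subgroup Q G \<and> Q \<subseteq> T \<and> \<phi> \<in> F Q (carrier G) \<longrightarrow> \<phi> ` Q \<subseteq> T)"

definition invariant_subsystem ::
    "('a, 'b) monoid_scheme \<Rightarrow> nat \<Rightarrow> 'a fusion \<Rightarrow> 'a set \<Rightarrow> 'a fusion \<Rightarrow> bool" where
  "invariant_subsystem G p F T E \<longleftrightarrow>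
    subsystem G p F T E \<and> strongly_closed G F T \<and>
    (\<forall>Q R \<phi> \<psi>.
      subgroup Q G \<and> subgroup R G \<and> Q \<subseteq> R \<and> R \<subseteq> T \<and> \<phi> \<in> E Q R \<and> \<psi> \<in> F R T \<longrightarrow>
      (\<lambda>y \<in> \<psi> ` Q. \<psi> (\<phi> (inv_into R \<psi> y))) \<in> E (\<psi> ` Q) (\<psi> ` R))"

definition weakly_normal_subsystem ::
    "('a, 'b) monoid_scheme \<Rightarrow> nat \<Rightarrow> 'a fusion \<Rightarrow> 'a set \<Rightarrow> 'a fusion \<Rightarrow> bool" where
  "weakly_normal_subsystem G p F T E \<longleftrightarrow>
    saturated_fusion_system (G\<lparr>carrier := T\<rparr>) p E \<and> invariant_subsystem G p F T E"

definition centralizer :: "('a, 'b) monoid_scheme \<Rightarrow> 'a set \<Rightarrow> 'a set" where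
  "centralizer G T = {g \<in> carrier G. \<forall>t\<in>T. g \<otimes>\<^bsub>G\<^esub> t = t \<otimes>\<^bsub>G\<^esub> g}"

definition center :: "('a, 'b) monoid_scheme \<Rightarrow> 'a set" where
  "center G = centralizer G (carrier G)"

definition normal_subsystem ::
    "('a, 'b) monoid_scheme \<Rightarrow> nat \<Rightarrow> 'a fusion \<Rightarrow> 'a set \<Rightarrow> 'a fusion \<Rightarrow> bool" where
  "normal_subsystem G p F T E \<longleftrightarrow>
    weakly_normal_subsystem G p F T E \<and>
    (\<forall>\<phi> \<in> E T T.
      \<exists>\<chi> \<in> F (T <#>\<^bsub>G\<^esub> centralizer G T) (T <#>\<^bsub>G\<^esub> centralizer G T).
        (\<forall>x\<in>T. \<chi> x = \<phi> x) \<and>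
        generate G {inv\<^bsub>G\<^esub> x \<otimes>\<^bsub>G\<^esub> \<chi> x |x. x \<in> centralizer G T} \<subseteq> center (G\<lparr>carrier := T\<rparr>))"

end

theory Submission
  imports Defs
begin

text \<open>
  Let \<open>E\<close> be weakly normal in \<open>F\<close> on \<open>T\<close>, and let \<open>C = C\<^sub>P(T)\<close>. Call a morphism \<open>f : U \<rightarrow> T\<close> of \<open>E\<close> on an
  \<open>F\<close>-centric subgroup \<open>U\<close> of \<open>T\<close> good if it extends in \<open>F\<close> to \<open>U C\<close>, acting trivially modulo \<open>T\<close>, and let
  \<open>E\<^sub>0\<close> be generated by the restrictions of good morphisms. Good automorphisms of \<open>T\<close> satisfy the extension
  condition in the definition of normality, so it suffices that \<open>E\<^sub>0\<close> is \<open>F\<close>-invariant and saturated.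
  For a fully automized receptive \<open>R\<close>, the elements of \<open>Aut\<^sub>E(R)\<close> that extend to \<open>R C\<^sub>P(R)\<close> trivially modulo \<open>T\<close>
  form a normal subgroup of \<open>Aut\<^sub>F(R)\<close> containing the Sylow subgroup \<open>Aut\<^sub>T(R)\<close> of \<open>Aut\<^sub>E(R)\<close>. By the Frattini argument
  and downward induction, every \<open>F\<close>-morphism (\<open>E\<close>-morphism) between subgroups of \<open>T\<close> is an \<open>E\<^sub>0\<close>-morphism
  followed by an element of \<open>Aut\<^sub>F(T)\<close> (of \<open>Aut\<^sub>E(T)\<close>). This gives invariance, and transfers the fully
  automized members of a conjugacy class from \<open>E\<close> to \<open>E\<^sub>0\<close>.
  Receptivity of centric subgroups needs that an \<open>\<alpha> \<in> Aut\<^sub>E(T)\<close> which is good on some centric subgroup is good: as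
  \<open>Inn(T)\<close> is good and Sylow in \<open>Aut\<^sub>E(T)\<close>, one may replace \<open>\<alpha>\<close> by a \<open>p'\<close>-element, and the failure of
  goodness is a \<open>p'\<close>-automorphism of \<open>U C\<close> trivial on \<open>U\<close>, which extends to \<open>T C\<close> trivially on \<open>T\<close> by climbing normalizers.
  Receptivity of the other subgroups follows by downward induction from the centric ones.
\<close>

section \<open>Sylow arguments for groups of permutations\<close>

text \<open>An extension of f to U C is not obviously defined so that it can be followed by an
  extension of the next map. Centricity repairs this: if c lies in C and h extends f, then the
  inverse of c times h(c) lies in T and centralizes f(U), hence lies in f(U), and h maps U C onto
  f(U) C. This is why goodness is confined to centric subgroups. The price is that on other
  subgroups the generated system is known only through composites of restrictions, and saturation
  must be recovered there. C itself does not suit the Frattini argument: an F-automorphism of R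
  extends to R C_P(R), but the extension has no reason to preserve C. Testing against all of C_P(R),
  which contains C, gives a subgroup that Aut_F(R) normalizes. Extensions supplied by the saturation
  of E may leave the subsystem. Writing such an extension as a subsystem morphism followed by some
  \<alpha> in Aut_E(T) confines the problem to \<alpha>, and \<alpha> is then already good on a
  centric subgroup. The new system lives on the same T and inside E, so it is again proper and
  non-trivial.\<close>

lemma pgroup_fixed_points:
  fixes D :: "('d, 'e) monoid_scheme" and act :: "'d \<Rightarrow> 'w \<Rightarrow> 'w"
  assumes p: "Factorial_Ring.prime (p::nat)" and D: "group D" "order D = p ^ n" and fin: "finite \<Omega>"
    and cl: "\<And>d w. \<lbrakk>d \<in> carrier D; w \<in> \<Omega>\<rbrakk> \<Longrightarrow> act d w \<in> \<Omega>"
    and one: "\<And>w. w \<in> \<Omega> \<Longrightarrow> act \<one>\<^bsub>D\<^esub> w = w"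
    and mul: "\<And>d e w. \<lbrakk>d \<in> carrier D; e \<in> carrier D; w \<in> \<Omega>\<rbrakk> \<Longrightarrow> act (d \<otimes>\<^bsub>D\<^esub> e) w = act d (act e w)"
  shows "card {w \<in> \<Omega>. \<forall>d\<in>carrier D. act d w = w} mod p = card \<Omega> mod p"
proof -
  interpret D: group D by fact
  define \<phi> where "\<phi> d = restrict (act d) \<Omega>" for d
  have inv1: "act (inv\<^bsub>D\<^esub> d) (act d w) = w" "act d (act (inv\<^bsub>D\<^esub> d) w) = w"
    if "d \<in> carrier D" "w \<in> \<Omega>" for d w
    using mul[of "inv\<^bsub>D\<^esub> d" d w] mul[of d "inv\<^bsub>D\<^esub> d" w] that one by simp_all
  have bij: "\<phi> d \<in> Bij \<Omega>" if "d \<in> carrier D" for d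
  proof -
    have "bij_betw (\<phi> d) \<Omega> \<Omega>"
      by (rule bij_betw_byWitness[where f' = "act (inv\<^bsub>D\<^esub> d)"])
        (use that cl inv1 in \<open>auto simp: \<phi>_def\<close>)
    then show ?thesis by (simp add: Bij_def \<phi>_def)
  qed
  have gh: "group_hom D (BijGroup \<Omega>) \<phi>"
  proof (rule group_hom.intro[OF D.group_axioms group_BijGroup], rule group_hom_axioms.intro, rule homI)
      fix d assume "d \<in> carrier D" then show "\<phi> d \<in> carrier (BijGroup \<Omega>)"
        using bij by (simp add: BijGroup_def)
    next
      fix d e assume de: "d \<in> carrier D" "e \<in> carrier D"
      show "\<phi> (d \<otimes>\<^bsub>D\<^esub> e) = \<phi> d \<otimes>\<^bsub>BijGroup \<Omega>\<^esub> \<phi> e"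
        using de bij cl mul by (auto simp: BijGroup_def compose_def \<phi>_def restrict_def fun_eq_iff)
  qed
  interpret A: group_action D \<Omega> \<phi> by (rule group_action.intro[OF gh])
  define Fx where "Fx = {w \<in> \<Omega>. \<forall>d\<in>carrier D. act d w = w}"
  define Ob where "Ob = orbits D \<Omega> \<phi>"
  have finO: "finite Ob" and sub: "\<And>O'. O' \<in> Ob \<Longrightarrow> O' \<subseteq> \<Omega>"
    using A.orbits_coverture fin unfolding Ob_def by (metis finite_UnionD, blast)
  have "card \<Omega> = (\<Sum>O'\<in>Ob. card O')"
  proof -
    have "card (\<Union>Ob) = (\<Sum>O'\<in>Ob. card O')"
      by (rule card_Union_disjoint)
        (use A.disjoint_union finite_subset[OF sub fin] in \<open>auto simp: pairwise_def disjnt_def Ob_def\<close>)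
    then show ?thesis using A.orbits_coverture unfolding Ob_def by simp
  qed
  also have "\<dots> = (\<Sum>O'\<in>{O'\<in>Ob. card O' = 1}. card O') + (\<Sum>O'\<in>{O'\<in>Ob. card O' \<noteq> 1}. card O')"
    using finO by (subst sum.union_disjoint[symmetric]) (auto intro: sum.cong)
  finally have eq: "card \<Omega> = card {O'\<in>Ob. card O' = 1} + (\<Sum>O'\<in>{O'\<in>Ob. card O' \<noteq> 1}. card O')"
    by simp
  have dv: "p dvd card O'" if "O' \<in> Ob" "card O' \<noteq> 1" for O'
  proof -
    obtain w where w: "w \<in> \<Omega>" "O' = orbit D \<phi> w" using \<open>O' \<in> Ob\<close> by (auto simp: Ob_def orbits_def)
    have "card O' dvd p ^ n" using A.orbit_stabilizer_theorem[OF w(1)] D(2) w(2)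
      by (metis dvd_triv_left)
    then show ?thesis using p \<open>card O' \<noteq> 1\<close>
      by (auto simp: divides_primepow_nat intro!: dvd_power)
  qed
  have "bij_betw (\<lambda>w. {w}) Fx {O'\<in>Ob. card O' = 1}"
  proof (rule bij_betwI')
    fix w assume w: "w \<in> Fx"
    then have "orbit D \<phi> w = {w}"
      using one by (auto simp: orbit_def Fx_def \<phi>_def intro!: exI[of _ "\<one>\<^bsub>D\<^esub>"])
    then show "{w} \<in> {O' \<in> Ob. card O' = 1}" using w by (auto simp: Ob_def orbits_def Fx_def)
  next
    fix O' assume O': "O' \<in> {O' \<in> Ob. card O' = 1}"
    then obtain w where w: "w \<in> \<Omega>" "O' = orbit D \<phi> w" by (auto simp: Ob_def orbits_def)
    then have "O' = {w}" using A.orbit_refl[OF w(1)] O' by (auto simp: card_1_singleton_iff)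
    moreover have "act d w = w" if "d \<in> carrier D" for d
      using w that \<open>O' = {w}\<close> by (auto simp: orbit_def \<phi>_def)
    ultimately show "\<exists>w\<in>Fx. O' = {w}" using w by (auto simp: Fx_def)
  qed auto
  then have "card Fx = card {O'\<in>Ob. card O' = 1}" by (rule bij_betw_same_card)
  moreover have "p dvd (\<Sum>O'\<in>{O'\<in>Ob. card O' \<noteq> 1}. card O')"
    using dv by (intro dvd_sum) auto
  then obtain k where "(\<Sum>O'\<in>{O'\<in>Ob. card O' \<noteq> 1}. card O') = p * k" by blast
  ultimately have "card \<Omega> = card Fx + p * k" using eq by simp
  then show ?thesis unfolding Fx_def[symmetric] by simp
qed

text \<open>Right multiplication is a right action on cosets, hence the inverse of d in the action
  passed to \<open>pgroup_fixed_points\<close>. A coset fixed by all inverses is fixed by all of D,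
  so the inverse disappears from the statement.\<close>

lemma fixed_rcosets:
  fixes A :: "('c, 'x) monoid_scheme" and D :: "('d, 'e) monoid_scheme"
  assumes p: "Factorial_Ring.prime (p::nat)" and D: "group D" "order D = p ^ n"
    and A: "group A" "finite (carrier A)" "subgroup S A" and \<rho>: "\<rho> \<in> hom D A"
  shows "card {w \<in> rcosets\<^bsub>A\<^esub> S. \<forall>d\<in>carrier D. w #>\<^bsub>A\<^esub> \<rho> d = w} mod p = card (rcosets\<^bsub>A\<^esub> S) mod p"
proof -
  interpret A: group A by fact
  interpret D: group D by fact
  interpret h: group_hom D A \<rho> by unfold_locales (rule \<rho>)
  have sub: "w \<subseteq> carrier A" if "w \<in> rcosets\<^bsub>A\<^esub> S" for w
    using that A.rcosets_part_G[OF A(3)] by blast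
  have "card {w \<in> rcosets\<^bsub>A\<^esub> S. \<forall>d\<in>carrier D. w #>\<^bsub>A\<^esub> \<rho> (inv\<^bsub>D\<^esub> d) = w} mod p = card (rcosets\<^bsub>A\<^esub> S) mod p"
  proof (rule pgroup_fixed_points[OF p D])
    show "finite (rcosets\<^bsub>A\<^esub> S)" using A by (simp add: RCOSETS_def)
  next
    fix d w assume d: "d \<in> carrier D" and w: "w \<in> rcosets\<^bsub>A\<^esub> S"
    obtain a where a: "a \<in> carrier A" "w = S #>\<^bsub>A\<^esub> a" using w by (auto simp: RCOSETS_def)
    have "w #>\<^bsub>A\<^esub> \<rho> (inv\<^bsub>D\<^esub> d) = S #>\<^bsub>A\<^esub> (a \<otimes>\<^bsub>A\<^esub> \<rho> (inv\<^bsub>D\<^esub> d))"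
      using a d A.coset_mult_assoc[OF subgroup.subset[OF A(3)] a(1)] by simp
    then show "w #>\<^bsub>A\<^esub> \<rho> (inv\<^bsub>D\<^esub> d) \<in> rcosets\<^bsub>A\<^esub> S" using a d by (auto simp: RCOSETS_def)
  next
    fix w assume w: "w \<in> rcosets\<^bsub>A\<^esub> S"
    show "w #>\<^bsub>A\<^esub> \<rho> (inv\<^bsub>D\<^esub> \<one>\<^bsub>D\<^esub>) = w" using sub[OF w] by (simp add: A.coset_mult_one)
  next
    fix d e w assume d: "d \<in> carrier D" and e: "e \<in> carrier D" and w: "w \<in> rcosets\<^bsub>A\<^esub> S"
    show "w #>\<^bsub>A\<^esub> \<rho> (inv\<^bsub>D\<^esub> (d \<otimes>\<^bsub>D\<^esub> e)) = w #>\<^bsub>A\<^esub> \<rho> (inv\<^bsub>D\<^esub> e) #>\<^bsub>A\<^esub> \<rho> (inv\<^bsub>D\<^esub> d)"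
      using d e by (simp add: D.inv_mult_group A.coset_mult_assoc[OF sub[OF w]])
  qed
  moreover have "(\<forall>d\<in>carrier D. w #>\<^bsub>A\<^esub> \<rho> (inv\<^bsub>D\<^esub> d) = w) \<longleftrightarrow> (\<forall>d\<in>carrier D. w #>\<^bsub>A\<^esub> \<rho> d = w)" for w
    by (metis D.inv_closed D.inv_inv)
  ultimately show ?thesis by simp
qed

text \<open>The index of S is prime to p, so D fixes some coset S a, and this says that a conjugates
  the image of D into S. A homomorphism \<rho> takes the place of a subgroup because normalizers act
  on their subgroups with a kernel.\<close>

lemma sylow_conj:
  fixes A :: "('c, 'x) monoid_scheme" and D :: "('d, 'e) monoid_scheme"
  assumes p: "Factorial_Ring.prime (p::nat)" and D: "group D" "order D = p ^ n"
    and A: "group A" "finite (carrier A)" "subgroup S A" and \<rho>: "\<rho> \<in> hom D A"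
    and cS: "card S = p ^ multiplicity p (order A)"
  shows "\<exists>a\<in>carrier A. \<forall>d\<in>carrier D. a \<otimes>\<^bsub>A\<^esub> \<rho> d \<otimes>\<^bsub>A\<^esub> inv\<^bsub>A\<^esub> a \<in> S"
proof -
  interpret A: group A by fact
  interpret h: group_hom D A \<rho> using D A \<rho> by (simp add: group_hom_def group_hom_axioms_def)
  have o: "card (rcosets\<^bsub>A\<^esub> S) * card S = order A" by (rule A.lagrange[OF A(3)])
  have pos: "order A > 0" using A by (simp add: A.order_gt_0_iff_finite)
  have "\<not> p dvd card (rcosets\<^bsub>A\<^esub> S)"
  proof
    assume "p dvd card (rcosets\<^bsub>A\<^esub> S)"
    then have "p ^ Suc (multiplicity p (order A)) dvd order A"
      using cS o by (metis mult_dvd_mono dvd_refl power_Suc)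
    then show False using pos p
      by (metis Suc_n_not_le_n multiplicity_geI not_prime_unit less_not_refl)
  qed
  then have "card {w \<in> rcosets\<^bsub>A\<^esub> S. \<forall>d\<in>carrier D. w #>\<^bsub>A\<^esub> \<rho> d = w} \<noteq> 0"
    using fixed_rcosets[OF p D A \<rho>] by (metis dvd_eq_mod_eq_0 mod_0)
  then obtain w where w: "w \<in> rcosets\<^bsub>A\<^esub> S" "\<And>d. d\<in>carrier D \<Longrightarrow> w #>\<^bsub>A\<^esub> \<rho> d = w"
    by (metis (mono_tags, lifting) card.empty empty_Collect_eq)
  obtain a where a: "a \<in> carrier A" "w = S #>\<^bsub>A\<^esub> a" using w by (auto simp: RCOSETS_def)
  have "a \<otimes>\<^bsub>A\<^esub> \<rho> d \<otimes>\<^bsub>A\<^esub> inv\<^bsub>A\<^esub> a \<in> S" if d: "d \<in> carrier D" for d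
  proof -
    have "a \<otimes>\<^bsub>A\<^esub> \<rho> d \<in> S #>\<^bsub>A\<^esub> a \<otimes>\<^bsub>A\<^esub> \<rho> d"
      using A.rcos_self[OF _ A(3)] a d by simp
    also have "\<dots> = S #>\<^bsub>A\<^esub> a" using w(2)[OF d] a d A.coset_mult_assoc[OF subgroup.subset[OF A(3)] a(1)] by simp
    finally obtain s where s: "s \<in> S" "a \<otimes>\<^bsub>A\<^esub> \<rho> d = s \<otimes>\<^bsub>A\<^esub> a" by (auto simp: r_coset_def)
    then have "a \<otimes>\<^bsub>A\<^esub> \<rho> d \<otimes>\<^bsub>A\<^esub> inv\<^bsub>A\<^esub> a = s" using a d subgroup.mem_carrier[OF A(3)] 
      by (simp add: A.m_assoc)
    then show ?thesis using s by simp
  qed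
  then show ?thesis using a by blast
qed

lemma sylow_exists:
  fixes A :: "('c, 'x) monoid_scheme"
  assumes p: "Factorial_Ring.prime (p::nat)" and A: "group A" "finite (carrier A)"
  shows "\<exists>S. subgroup S A \<and> card S = p ^ multiplicity p (order A)"
proof -
  obtain m where "order A = p ^ multiplicity p (order A) * m"
    using multiplicity_dvd by (meson dvdE)
  then show ?thesis using sylow_thm[OF p A(1) _ A(2)] by blast
qed

text \<open>The subgroups of \<open>BijGroup U\<close>, described pointwise so that closure can be
  checked on elements of U; inverses enter only through left cancellation on U.\<close>

definition permset :: "'a set \<Rightarrow> ('a \<Rightarrow> 'a) set \<Rightarrow> bool" where
  "permset U \<A> \<longleftrightarrow> (\<forall>f\<in>\<A>. f \<in> extensional U \<and> f ` U = U \<and> inj_on f U) \<and> (\<lambda>x\<in>U. x) \<in> \<A> \<and>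
     (\<forall>f\<in>\<A>. \<forall>g\<in>\<A>. compose U f g \<in> \<A>) \<and> (\<forall>f\<in>\<A>. \<exists>g\<in>\<A>. \<forall>x\<in>U. g (f x) = x)"

lemma permset_sub: "permset U \<A> \<Longrightarrow> subgroup \<A> (BijGroup U)"
proof -
  assume A: "permset U \<A>"
  interpret B: group "BijGroup U" by (rule group_BijGroup)
  have sub: "\<A> \<subseteq> Bij U" using A by (auto simp: permset_def Bij_def bij_betw_def)
  show "subgroup \<A> (BijGroup U)"
  proof (rule B.subgroupI)
    show "\<A> \<subseteq> carrier (BijGroup U)" using sub by (simp add: BijGroup_def)
    show "\<A> \<noteq> {}" using A by (auto simp: permset_def)
  next
    fix f assume f: "f \<in> \<A>"
    then obtain g where g: "g \<in> \<A>" "\<forall>x\<in>U. g (f x) = x" using A by (auto simp: permset_def)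
    have "g \<otimes>\<^bsub>BijGroup U\<^esub> f = \<one>\<^bsub>BijGroup U\<^esub>"
      using f g sub by (auto simp: BijGroup_def compose_def restrict_def subset_iff)
    then have "inv\<^bsub>BijGroup U\<^esub> f = g"
      using f g sub by (intro B.inv_equality) (auto simp: BijGroup_def)
    then show "inv\<^bsub>BijGroup U\<^esub> f \<in> \<A>" using g by simp
  next
    fix f g assume "f \<in> \<A>" "g \<in> \<A>"
    then show "f \<otimes>\<^bsub>BijGroup U\<^esub> g \<in> \<A>" using A sub by (auto simp: permset_def BijGroup_def)
  qed
qed

lemma permset_mono_sub:
  assumes "permset U \<A>" "permset U \<S>" "\<S> \<subseteq> \<A>"
  shows "subgroup \<S> (BijGroup U\<lparr>carrier := \<A>\<rparr>)"
  by (rule group.subgroup_incl[OF group_BijGroup permset_sub permset_sub]) (use assms in auto)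

lemma permset_dvd:
  assumes "finite U" "permset U \<A>" "permset U \<S>" "\<S> \<subseteq> \<A>"
  shows "card \<S> dvd card \<A>"
  using group.lagrange[OF subgroup.subgroup_is_group[OF permset_sub[OF assms(2)] group_BijGroup] permset_mono_sub[OF assms(2-4)]]
  by (simp add: order_def) (metis dvd_triv_right)

lemma permset_finite: "finite U \<Longrightarrow> permset U \<A> \<Longrightarrow> finite \<A>"
proof (rule finite_subset)
  assume "permset U \<A>" then show "\<A> \<subseteq> (\<Pi>\<^sub>E x\<in>U. U)"
    by (auto simp: permset_def PiE_def)
qed (auto intro: finite_PiE)

text \<open>Conjugation by a is written as an equation between functions on U, without an inverse.
  In this form it says that a map followed by a turns the action of D into that of elements of
  \<S>.\<close>

lemma permset_sylow_conj:
  fixes D :: "('d, 'e) monoid_scheme"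
  assumes p: "Factorial_Ring.prime (p::nat)" and D: "group D" "order D = p ^ n"
    and U: "finite U" and A: "permset U \<A>" and S: "permset U \<S>" "\<S> \<subseteq> \<A>"
    and cS: "card \<S> = p ^ multiplicity p (card \<A>)"
    and \<rho>: "\<And>d. d \<in> carrier D \<Longrightarrow> \<rho> d \<in> \<A>"
      "\<And>d e. \<lbrakk>d \<in> carrier D; e \<in> carrier D\<rbrakk> \<Longrightarrow> \<rho> (d \<otimes>\<^bsub>D\<^esub> e) = compose U (\<rho> d) (\<rho> e)"
  shows "\<exists>a\<in>\<A>. \<forall>d\<in>carrier D. \<exists>s\<in>\<S>. \<forall>x\<in>U. a (\<rho> d x) = s (a x)"
proof -
  let ?A = "BijGroup U\<lparr>carrier := \<A>\<rparr>"
  interpret A: group ?A using subgroup.subgroup_is_group[OF permset_sub[OF A] group_BijGroup] .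
  have sub: "\<A> \<subseteq> Bij U" using A by (auto simp: permset_def Bij_def bij_betw_def)
  have mul: "f \<otimes>\<^bsub>?A\<^esub> g = compose U f g" if "f \<in> \<A>" "g \<in> \<A>" for f g
    using that sub by (auto simp: BijGroup_def)
  have "\<rho> \<in> hom D ?A" unfolding hom_def using \<rho> mul by simp
  then have "\<exists>a\<in>carrier ?A. \<forall>d\<in>carrier D. a \<otimes>\<^bsub>?A\<^esub> \<rho> d \<otimes>\<^bsub>?A\<^esub> inv\<^bsub>?A\<^esub> a \<in> \<S>"
    by (intro sylow_conj[OF p D A.group_axioms _ permset_mono_sub[OF A S]])
      (use cS permset_finite[OF U A] in \<open>auto simp: order_def\<close>)
  then obtain a where a: "a \<in> carrier ?A" "\<And>d. d\<in>carrier D \<Longrightarrow> a \<otimes>\<^bsub>?A\<^esub> \<rho> d \<otimes>\<^bsub>?A\<^esub> inv\<^bsub>?A\<^esub> a \<in> \<S>"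
    by blast
  then have aA: "a \<in> \<A>" by simp
  show ?thesis
  proof (intro bexI[OF _ aA] ballI)
    fix d assume d: "d \<in> carrier D"
    let ?s = "a \<otimes>\<^bsub>?A\<^esub> \<rho> d \<otimes>\<^bsub>?A\<^esub> inv\<^bsub>?A\<^esub> a"
    have s: "?s \<in> \<S>" by (rule a(2)[OF d])
    have c1: "\<rho> d \<in> carrier ?A" using \<rho>(1)[OF d] by simp
    note c = c1 A.m_closed[OF a(1) c1]
    have "?s \<otimes>\<^bsub>?A\<^esub> a = a \<otimes>\<^bsub>?A\<^esub> \<rho> d \<otimes>\<^bsub>?A\<^esub> (inv\<^bsub>?A\<^esub> a \<otimes>\<^bsub>?A\<^esub> a)"
      by (rule A.m_assoc[OF c(2) A.inv_closed[OF a(1)] a(1)])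
    also have "\<dots> = a \<otimes>\<^bsub>?A\<^esub> \<rho> d" unfolding A.l_inv[OF a(1)] by (rule A.r_one[OF c(2)])
    finally have "?s \<otimes>\<^bsub>?A\<^esub> a = a \<otimes>\<^bsub>?A\<^esub> \<rho> d" .
    then obtain t where t: "t \<in> \<S>" "t \<otimes>\<^bsub>?A\<^esub> a = a \<otimes>\<^bsub>?A\<^esub> \<rho> d" using s by blast
    then have "compose U t a = compose U a (\<rho> d)"
      using mul[OF subsetD[OF S(2) t(1)] aA] mul[OF aA \<rho>(1)[OF d]] by simp
    then have "a (\<rho> d x) = t (a x)" if "x \<in> U" for x using that by (metis compose_eq)
    then show "\<exists>s\<in>\<S>. \<forall>x\<in>U. a (\<rho> d x) = s (a x)" using t(1) by blast
  qed
qed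

lemma permset_sylow_conj_sub:
  assumes p: "Factorial_Ring.prime (p::nat)" and U: "finite U" and A: "permset U \<A>" and S: "permset U \<S>" "\<S> \<subseteq> \<A>"
    and cS: "card \<S> = p ^ multiplicity p (card \<A>)" and K: "permset U K" "K \<subseteq> \<A>" "card K = p ^ n"
  shows "\<exists>a\<in>\<A>. \<forall>k\<in>K. \<exists>s\<in>\<S>. \<forall>x\<in>U. a (k x) = s (a x)"
proof -
  let ?K = "BijGroup U\<lparr>carrier := K\<rparr>"
  have KB: "K \<subseteq> Bij U" using K by (auto simp: permset_def Bij_def bij_betw_def)
  have "\<exists>a\<in>\<A>. \<forall>d\<in>carrier ?K. \<exists>s\<in>\<S>. \<forall>x\<in>U. a (id d x) = s (a x)"
  proof (rule permset_sylow_conj[OF p _ _ U A S cS])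
    show "group ?K" by (rule subgroup.subgroup_is_group[OF permset_sub[OF K(1)] group_BijGroup])
    show "order ?K = p ^ n" using K by (simp add: order_def)
    show "id d \<in> \<A>" if "d \<in> carrier ?K" for d using that K(2) by auto
    show "id (d \<otimes>\<^bsub>?K\<^esub> d') = compose U (id d) (id d')" if "d \<in> carrier ?K" "d' \<in> carrier ?K" for d d'
      using that KB by (auto simp: BijGroup_def)
  qed
  then show ?thesis by simp
qed

lemma permset_sylow_exists:
  assumes p: "Factorial_Ring.prime (p::nat)" and U: "finite U" and A: "permset U \<A>"
  shows "\<exists>\<S>. permset U \<S> \<and> \<S> \<subseteq> \<A> \<and> card \<S> = p ^ multiplicity p (card \<A>)"
proof -
  let ?A = "BijGroup U\<lparr>carrier := \<A>\<rparr>"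
  interpret A: group ?A using subgroup.subgroup_is_group[OF permset_sub[OF A] group_BijGroup] .
  have sub: "\<A> \<subseteq> Bij U" using A by (auto simp: permset_def Bij_def bij_betw_def)
  have mul: "f \<otimes>\<^bsub>?A\<^esub> g = compose U f g" if "f \<in> \<A>" "g \<in> \<A>" for f g
    using that sub by (auto simp: BijGroup_def)
  obtain S where S: "subgroup S ?A" "card S = p ^ multiplicity p (card \<A>)"
    using sylow_exists[OF p A.group_axioms] permset_finite[OF U A] by (auto simp: order_def)
  have SA: "S \<subseteq> \<A>" using subgroup.subset[OF S(1)] by simp
  have "permset U S"
    unfolding permset_def
  proof (intro conjI ballI)
    show "(\<lambda>x\<in>U. x) \<in> S" using subgroup.one_closed[OF S(1)] by (simp add: BijGroup_def)
  next
    fix f g assume "f \<in> S" "g \<in> S" then show "compose U f g \<in> S"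
      using subgroup.m_closed[OF S(1)] SA mul by (metis subset_iff)
  next
    fix f assume f: "f \<in> S"
    let ?g = "inv\<^bsub>?A\<^esub> f"
    have g: "?g \<in> S" using f subgroup.m_inv_closed[OF S(1)] by blast
    have "compose U ?g f = ?g \<otimes>\<^bsub>?A\<^esub> f" by (rule mul[symmetric]) (use g f SA in blast)+
    also have "\<dots> = \<one>\<^bsub>?A\<^esub>" using f SA by (intro A.l_inv) auto
    finally have "compose U ?g f = (\<lambda>x\<in>U. x)" by (simp add: BijGroup_def)
    then have "\<forall>x\<in>U. ?g (f x) = x" by (metis (no_types, lifting) compose_eq restrict_apply')
    then show "\<exists>g\<in>S. \<forall>x\<in>U. g (f x) = x" using g by blast
  qed (use A SA in \<open>auto simp: permset_def\<close>)
  then show ?thesis using S SA by auto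
qed

section \<open>Conjugation, normalizers and centralizers in a finite p-group\<close>

context finite_p_group
begin

text \<open>
  In the notation of the paper, \<open>cj g\<close> is \<open>c\<^sub>g\<close>, \<open>nrm T U\<close> is \<open>N\<^sub>T(U)\<close>, \<open>cen T U\<close> is \<open>C\<^sub>T(U)\<close> and \<open>indu D U\<close> is
  \<open>Aut\<^sub>D(U)\<close>.
\<close>

definition cj :: "'a \<Rightarrow> 'a \<Rightarrow> 'a" where "cj g x = inv g \<otimes> x \<otimes> g"
definition nrm :: "'a set \<Rightarrow> 'a set \<Rightarrow> 'a set" where "nrm T U = {g\<in>T. cj g ` U = U}"
definition cen :: "'a set \<Rightarrow> 'a set \<Rightarrow> 'a set" where "cen T U = {g\<in>T. \<forall>x\<in>U. cj g x = x}"
definition indu :: "'a set \<Rightarrow> 'a set \<Rightarrow> ('a \<Rightarrow> 'a) set" where "indu D U = (\<lambda>g. restrict (cj g) U) ` D"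

lemma fin_sub: "subgroup U G \<Longrightarrow> finite U"
  using finite_carrier subgroup.subset finite_subset by metis

lemma sub_mem: "subgroup U G \<Longrightarrow> x \<in> U \<Longrightarrow> x \<in> carrier G"
  using subgroup.mem_carrier by metis

lemma cj_closed [simp]: "g \<in> carrier G \<Longrightarrow> x \<in> carrier G \<Longrightarrow> cj g x \<in> carrier G"
  by (simp add: cj_def)

lemma inv_cancel [simp]:
  "g \<in> carrier G \<Longrightarrow> z \<in> carrier G \<Longrightarrow> g \<otimes> (inv g \<otimes> z) = z"
  "g \<in> carrier G \<Longrightarrow> z \<in> carrier G \<Longrightarrow> inv g \<otimes> (g \<otimes> z) = z"
  by (simp_all add: m_assoc[symmetric])

lemma cj_sub: "subgroup U G \<Longrightarrow> g \<in> U \<Longrightarrow> x \<in> U \<Longrightarrow> cj g x \<in> U"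
  by (simp add: cj_def subgroup.m_closed subgroup.m_inv_closed)

lemma cj_mult: "g \<in> carrier G \<Longrightarrow> x \<in> carrier G \<Longrightarrow> y \<in> carrier G \<Longrightarrow> cj g (x \<otimes> y) = cj g x \<otimes> cj g y"
  by (simp add: cj_def m_assoc)

lemma cj_comp: "g \<in> carrier G \<Longrightarrow> h \<in> carrier G \<Longrightarrow> x \<in> carrier G \<Longrightarrow> cj (g \<otimes> h) x = cj h (cj g x)"
  by (simp add: cj_def m_assoc inv_mult_group)

lemma cj_one [simp]: "x \<in> carrier G \<Longrightarrow> cj \<one> x = x"
  by (simp add: cj_def)

lemma cj_inv1 [simp]: "g \<in> carrier G \<Longrightarrow> x \<in> carrier G \<Longrightarrow> cj (inv g) (cj g x) = x"
  using cj_comp[of g "inv g" x] by simp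

lemma cj_inv2 [simp]: "g \<in> carrier G \<Longrightarrow> x \<in> carrier G \<Longrightarrow> cj g (cj (inv g) x) = x"
  using cj_comp[of "inv g" g x] by simp

lemma cj_inj: "g \<in> carrier G \<Longrightarrow> U \<subseteq> carrier G \<Longrightarrow> inj_on (cj g) U"
  by (rule inj_on_inverseI[where g = "cj (inv g)"]) auto

lemma cj_commute: "g \<in> carrier G \<Longrightarrow> x \<in> carrier G \<Longrightarrow> cj g x = x \<longleftrightarrow> g \<otimes> x = x \<otimes> g"
  by (auto simp: cj_def m_assoc) (metis inv_cancel(1) m_closed, metis inv_cancel(2))

lemma cj_swap: "g \<in> carrier G \<Longrightarrow> x \<in> carrier G \<Longrightarrow> cj g x = x \<longleftrightarrow> cj x g = g"
  by (metis cj_commute)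

lemma nrm_sub: "nrm T U \<subseteq> T" by (auto simp: nrm_def)
lemma cen_sub: "cen T U \<subseteq> T" by (auto simp: cen_def)

lemma nrmI: "g \<in> T \<Longrightarrow> subgroup T G \<Longrightarrow> subgroup U G \<Longrightarrow> (\<And>x. x \<in> U \<Longrightarrow> cj g x \<in> U) \<Longrightarrow> g \<in> nrm T U"
proof -
  assume *: "g \<in> T" "subgroup T G" "subgroup U G" "\<And>x. x \<in> U \<Longrightarrow> cj g x \<in> U"
  have "cj g ` U = U"
    using * cj_inj[of g U] by (intro endo_inj_surj fin_sub) (auto intro: sub_mem subgroup.subset)
  then show ?thesis using * by (simp add: nrm_def)
qed

lemma nrmD: "g \<in> nrm T U \<Longrightarrow> x \<in> U \<Longrightarrow> cj g x \<in> U" by (auto simp: nrm_def)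

lemma subgroup_nrm: assumes "subgroup T G" "subgroup U G" shows "subgroup (nrm T U) G"
proof (rule subgroupI)
  show "nrm T U \<subseteq> carrier G" using assms nrm_sub subgroup.subset by fastforce
  have "\<one> \<in> nrm T U" using assms by (intro nrmI) (auto simp: subgroup.one_closed sub_mem)
  then show "nrm T U \<noteq> {}" by auto
next
  fix g assume g: "g \<in> nrm T U"
  then have gc: "g \<in> T" "g \<in> carrier G" "cj g ` U = U" using assms nrm_sub sub_mem by (auto simp: nrm_def)
  show "inv g \<in> nrm T U"
  proof (rule nrmI)
    fix x assume "x \<in> U"
    then obtain y where "y \<in> U" "x = cj g y" using gc by auto
    then show "cj (inv g) x \<in> U" using gc assms sub_mem by simp
  qed (use assms gc subgroup.m_inv_closed in auto)
next
  fix g h assume "g \<in> nrm T U" "h \<in> nrm T U"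
  then show "g \<otimes> h \<in> nrm T U" using assms
    by (intro nrmI) (auto simp: nrm_def cj_comp sub_mem subgroup.m_closed)
qed

lemma subgroup_cen: assumes "subgroup T G" "U \<subseteq> carrier G" shows "subgroup (cen T U) G"
proof (rule subgroupI)
  show "cen T U \<subseteq> carrier G" using assms cen_sub subgroup.subset by fastforce
  have "\<one> \<in> cen T U" using assms by (auto simp: cen_def subgroup.one_closed)
  then show "cen T U \<noteq> {}" by auto
next
  fix g assume g: "g \<in> cen T U"
  then have gc: "g \<in> T" "g \<in> carrier G" "\<And>x. x \<in> U \<Longrightarrow> cj g x = x" using assms cen_sub sub_mem by (auto simp: cen_def)
  have "cj (inv g) x = x" if "x \<in> U" for x
    using cj_inv1[of g x] gc(2) gc(3)[OF that] that assms(2) by auto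
  then show "inv g \<in> cen T U" using gc assms by (auto simp: cen_def subgroup.m_inv_closed)
next
  fix g h assume "g \<in> cen T U" "h \<in> cen T U"
  then show "g \<otimes> h \<in> cen T U" using assms
    by (auto simp: cen_def subgroup.m_closed cj_comp sub_mem subset_iff)
qed

lemma self_nrm: "subgroup T G \<Longrightarrow> subgroup U G \<Longrightarrow> U \<subseteq> T \<Longrightarrow> U \<subseteq> nrm T U"
  by (auto intro!: nrmI cj_sub)

lemma cen_nrm: "cen T U \<subseteq> nrm T U" by (auto simp: nrm_def cen_def)

lemma prod_mem: "x \<in> U <#> K \<longleftrightarrow> (\<exists>u\<in>U. \<exists>k\<in>K. x = u \<otimes> k)" by (auto simp: set_mult_def)

lemma prod_left: "subgroup U G \<Longrightarrow> subgroup K G \<Longrightarrow> U \<subseteq> U <#> K"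
  unfolding subset_iff prod_mem by (metis r_one sub_mem subgroup.one_closed)

lemma prod_right: "subgroup U G \<Longrightarrow> subgroup K G \<Longrightarrow> K \<subseteq> U <#> K"
  unfolding subset_iff prod_mem by (metis l_one sub_mem subgroup.one_closed)

lemma prod_least: "subgroup V G \<Longrightarrow> U \<subseteq> V \<Longrightarrow> K \<subseteq> V \<Longrightarrow> U <#> K \<subseteq> V"
  unfolding subset_iff prod_mem by (metis subgroup.m_closed)

lemma subgroup_prod:
  assumes U: "subgroup U G" and K: "subgroup K G" and n: "K \<subseteq> nrm (carrier G) U"
  shows "subgroup (U <#> K) G"
proof (rule subgroupI)
  show "U <#> K \<subseteq> carrier G" by (rule prod_least[OF subgroup_self]) (use assms in \<open>auto intro: sub_mem\<close>)
  show "U <#> K \<noteq> {}" using prod_left[OF U K] subgroup.one_closed[OF U] by auto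
  have sw: "k \<otimes> u = cj (inv k) u \<otimes> k" "cj (inv k) u \<in> U" if "u \<in> U" "k \<in> K" for u k
  proof -
    have c: "u \<in> carrier G" "k \<in> carrier G" using that U K sub_mem by auto
    show "k \<otimes> u = cj (inv k) u \<otimes> k" using c by (simp add: cj_def m_assoc)
    show "cj (inv k) u \<in> U" using that n subgroup.m_inv_closed[OF K] by (meson nrmD subsetD)
  qed
  {
    fix x assume "x \<in> U <#> K"
    then obtain u k where uk: "u \<in> U" "k \<in> K" "x = u \<otimes> k" by (auto simp: prod_mem)
    have "inv x = inv k \<otimes> inv u" using uk U K by (simp add: inv_mult_group sub_mem)
    also have "\<dots> = cj k (inv u) \<otimes> inv k" using sw(1)[of "inv u" "inv k"] uk U K
      by (simp add: subgroup.m_inv_closed sub_mem)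
    finally show "inv x \<in> U <#> K" using sw(2)[of "inv u" "inv k"] uk U K unfolding prod_mem
      by (metis inv_inv sub_mem subgroup.m_inv_closed)
  next
    fix x y assume "x \<in> U <#> K" "y \<in> U <#> K"
    then obtain u k v l where uk: "u \<in> U" "k \<in> K" "x = u \<otimes> k" "v \<in> U" "l \<in> K" "y = v \<otimes> l"
      by (auto simp: prod_mem)
    have c: "u \<in> carrier G" "k \<in> carrier G" "v \<in> carrier G" "l \<in> carrier G" using uk U K sub_mem by auto
    have "x \<otimes> y = u \<otimes> (k \<otimes> v) \<otimes> l" using uk c by (simp add: m_assoc)
    also have "\<dots> = (u \<otimes> cj (inv k) v) \<otimes> (k \<otimes> l)" using sw(1)[of v k] uk c by (simp add: m_assoc)
    finally show "x \<otimes> y \<in> U <#> K" using sw(2)[of v k] uk U K unfolding prod_mem by (metis subgroup.m_closed)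
  }
qed

lemma subgroup_prod_cen: "subgroup U G \<Longrightarrow> subgroup T G \<Longrightarrow> subgroup (U <#> cen T U) G"
  by (rule subgroup_prod[OF _ subgroup_cen]) (auto simp: subgroup.subset cen_def nrm_def dest: sub_mem)

lemma order_subgroup: "subgroup D G \<Longrightarrow> \<exists>n. card D = p ^ n"
  by (metis lagrange dvd_triv_right divides_primepow_nat order_p_power prime_p)

text \<open>U acts by right multiplication on its own cosets in T. Their number is divisible by p
  and U itself is a fixed coset, so there is a second fixed coset U a; being fixed means that the
  inverse of a normalizes U.\<close>

lemma normalizer_grows:
  assumes T: "subgroup T G" and U: "subgroup U G" "U \<subseteq> T" "U \<noteq> T"
  shows "\<exists>g\<in>nrm T U. g \<notin> U"
proof -
  let ?A = "G\<lparr>carrier := T\<rparr>" and ?D = "G\<lparr>carrier := U\<rparr>"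
  interpret A: group ?A by (rule subgroup.subgroup_is_group[OF T group_axioms])
  interpret D: group ?D by (rule subgroup.subgroup_is_group[OF U(1) group_axioms])
  have S: "subgroup U ?A" by (rule subgroup_incl[OF U(1) T U(2)])
  obtain n where n: "card U = p ^ n" using order_subgroup U by blast
  obtain m where m: "card T = p ^ m" using order_subgroup T by blast
  have l: "card (rcosets\<^bsub>?A\<^esub> U) * card U = card T" using A.lagrange[OF S] by (simp add: order_def)
  have ne: "card (rcosets\<^bsub>?A\<^esub> U) \<noteq> 1" using l U fin_sub[OF T] by (metis card_subset_eq mult_1)
  have pd: "p dvd card (rcosets\<^bsub>?A\<^esub> U)"
    using ne l m prime_p by (metis divides_primepow_nat dvd_power dvd_triv_left gr0I power_0)
  have hom: "id \<in> hom ?D ?A" by (rule homI) (use U in auto)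
  define F where "F = {w \<in> rcosets\<^bsub>?A\<^esub> U. \<forall>d\<in>carrier ?D. w #>\<^bsub>?A\<^esub> id d = w}"
  have "card F mod p = 0"
    unfolding F_def using fixed_rcosets[OF prime_p D.group_axioms _ A.group_axioms _ S hom, of n] n fin_sub[OF T] pd
    by (simp add: order_def)
  moreover have UF: "U \<in> F"
  proof -
    have "U = U #>\<^bsub>?A\<^esub> \<one>\<^bsub>?A\<^esub>" using A.coset_mult_one[of U] U by simp
    then have "U \<in> rcosets\<^bsub>?A\<^esub> U" unfolding RCOSETS_def using T subgroup.one_closed by fastforce
    moreover have "U #>\<^bsub>?A\<^esub> d = U" if "d \<in> U" for d
      using A.coset_join2[OF _ S that] that U by auto
    ultimately show ?thesis by (simp add: F_def)
  qed
  moreover have finF: "finite F" unfolding F_def RCOSETS_def using fin_sub[OF T] by simp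
  ultimately have "card F \<noteq> 1" using prime_p by (metis mod_less not_prime_1 one_neq_zero prime_gt_1_nat)
  then obtain w where w: "w \<in> F" "w \<noteq> U" using UF finF
    by (metis card_1_singleton_iff empty_iff insertI1 is_singletonI' is_singleton_altdef)
  then obtain a where a: "a \<in> T" "w = U #>\<^bsub>?A\<^esub> a" by (auto simp: F_def RCOSETS_def)
  have aU: "a \<notin> U" using A.coset_join2[OF _ S, of a] a w by auto
  have ac: "a \<in> carrier G" using a T sub_mem by blast
  have "cj (inv a) d \<in> U" if d: "d \<in> U" for d
  proof -
    have dc: "d \<in> carrier G" using d U sub_mem by blast
    have "a \<in> w" unfolding a using A.rcos_self[OF _ S, of a] a by simp
    then have "a \<otimes> d \<in> w #>\<^bsub>?A\<^esub> d" by (auto simp: r_coset_def)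
    also have "\<dots> = U #>\<^bsub>?A\<^esub> a" using w d a by (simp add: F_def)
    finally obtain u where u: "u \<in> U" "a \<otimes> d = u \<otimes> a" by (auto simp: r_coset_def)
    then have "cj (inv a) d = u" using ac dc U sub_mem by (simp add: cj_def m_assoc)
    then show ?thesis using u by simp
  qed
  then have "inv a \<in> nrm T U" using a T U by (intro nrmI) (auto simp: subgroup.m_inv_closed)
  moreover have "inv a \<notin> U" using aU U ac by (metis inv_inv subgroup.m_inv_closed)
  ultimately show ?thesis by blast
qed

lemma permset_indu:
  assumes D: "subgroup D G" and U: "subgroup U G" and n: "D \<subseteq> nrm T U"
  shows "permset U (indu D U)"
  unfolding permset_def indu_def
proof (intro conjI ballI)
  fix f assume "f \<in> (\<lambda>g. restrict (cj g) U) ` D"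
  then obtain d where d: "d \<in> D" "f = restrict (cj d) U" by auto
  have dc: "d \<in> carrier G" using d D sub_mem by blast
  show "f \<in> extensional U" using d by simp
  show "f ` U = U" using d n by (auto simp: nrm_def)
  show "inj_on f U" using d cj_inj[OF dc subgroup.subset[OF U]] by (simp add: inj_on_def)
  show "\<exists>g\<in>(\<lambda>g. restrict (cj g) U) ` D. \<forall>x\<in>U. g (f x) = x"
  proof (intro bexI ballI)
    show "restrict (cj (inv d)) U \<in> (\<lambda>g. restrict (cj g) U) ` D" using d D subgroup.m_inv_closed by fast
    fix x assume "x \<in> U" then show "restrict (cj (inv d)) U (f x) = x"
      using d dc n U by (simp add: nrmD[OF subsetD] sub_mem)
  qed
next
  show "(\<lambda>x\<in>U. x) \<in> (\<lambda>g. restrict (cj g) U) ` D"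
    by (rule image_eqI[of _ _ \<one>]) (use U D in \<open>auto simp: subgroup.one_closed sub_mem restrict_def fun_eq_iff\<close>)
next
  fix f g assume "f \<in> (\<lambda>g. restrict (cj g) U) ` D" "g \<in> (\<lambda>g. restrict (cj g) U) ` D"
  then obtain d e where d: "d \<in> D" "f = restrict (cj d) U" "e \<in> D" "g = restrict (cj e) U" by auto
  have "compose U f g = restrict (cj (e \<otimes> d)) U"
    using d D U nrmD[OF subsetD[OF n]] by (auto simp: compose_def restrict_def fun_eq_iff cj_comp sub_mem)
  then show "compose U f g \<in> (\<lambda>g. restrict (cj g) U) ` D" using d D subgroup.m_closed by fast
qed

text \<open>Here \<rho> reverses products, as \<open>cj\<close> does for functions composed on the
  left. Inserting the inverse of d gives a homomorphism; since d runs over a group, the inverse can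
  be removed again at the end.\<close>

lemma sylow_conj_indu:
  assumes D: "subgroup D G" and U: "finite U" and A: "permset U \<A>" and S: "permset U \<S>" "\<S> \<subseteq> \<A>"
    and cS: "card \<S> = p ^ multiplicity p (card \<A>)"
    and \<rho>: "\<And>d. d \<in> D \<Longrightarrow> restrict (\<rho> d) U \<in> \<A>"
      "\<And>d e x. \<lbrakk>d \<in> D; e \<in> D; x \<in> U\<rbrakk> \<Longrightarrow> \<rho> (d \<otimes> e) x = \<rho> e (\<rho> d x)"
  shows "\<exists>a\<in>\<A>. \<forall>d\<in>D. \<exists>s\<in>\<S>. \<forall>x\<in>U. a (\<rho> d x) = s (a x)"
proof -
  let ?D = "G\<lparr>carrier := D\<rparr>"
  obtain n where n: "card D = p ^ n" using order_subgroup D by blast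
  have cl: "\<rho> d x \<in> U" if "d \<in> D" "x \<in> U" for d x
    using A \<rho>(1)[OF that(1)] that(2) unfolding permset_def by (metis imageI restrict_apply')
  have "\<exists>a\<in>\<A>. \<forall>d\<in>carrier ?D. \<exists>s\<in>\<S>. \<forall>x\<in>U. a (restrict (\<rho> (inv d)) U x) = s (a x)"
  proof (rule permset_sylow_conj[OF prime_p _ _ U A S cS, where n = n])
    show "group ?D" by (rule subgroup.subgroup_is_group[OF D group_axioms])
    show "order ?D = p ^ n" using n by (simp add: order_def)
  next
    fix d assume "d \<in> carrier ?D"
    then show "restrict (\<rho> (inv d)) U \<in> \<A>" using \<rho>(1) D subgroup.m_inv_closed by fastforce
  next
    fix d e assume "d \<in> carrier ?D" "e \<in> carrier ?D"
    then have de: "d \<in> D" "e \<in> D" "inv d \<in> D" "inv e \<in> D" "d \<in> carrier G" "e \<in> carrier G"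
      using D subgroup.m_inv_closed sub_mem by auto
    show "restrict (\<rho> (inv (d \<otimes>\<^bsub>?D\<^esub> e))) U = compose U (restrict (\<rho> (inv d)) U) (restrict (\<rho> (inv e)) U)"
      using de \<rho>(2)[of "inv e" "inv d"] cl by (auto simp: inv_mult_group compose_def restrict_def fun_eq_iff)
  qed
  then obtain a where a: "a \<in> \<A>" "\<And>d. d \<in> D \<Longrightarrow> \<exists>s\<in>\<S>. \<forall>x\<in>U. a (\<rho> (inv d) x) = s (a x)"
    by auto
  have "\<exists>s\<in>\<S>. \<forall>x\<in>U. a (\<rho> d x) = s (a x)" if "d \<in> D" for d
    using a(2)[of "inv d"] that D subgroup.m_inv_closed sub_mem by (metis inv_inv)
  then show ?thesis using a by blast
qed

text \<open>The p-group induced by D is conjugate to a subgroup of a Sylow subgroup of \<A>. Only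
  its order is recorded, which is what \<open>fa\<close> compares.\<close>

lemma card_indu_le:
  assumes D: "subgroup D G" and U: "finite U" and A: "permset U \<A>"
    and \<rho>: "\<And>d. d \<in> D \<Longrightarrow> restrict (\<rho> d) U \<in> \<A>"
      "\<And>d e x. \<lbrakk>d \<in> D; e \<in> D; x \<in> U\<rbrakk> \<Longrightarrow> \<rho> (d \<otimes> e) x = \<rho> e (\<rho> d x)"
  shows "card ((\<lambda>d. restrict (\<rho> d) U) ` D) \<le> p ^ multiplicity p (card \<A>)"
proof -
  obtain \<S> where S: "permset U \<S>" "\<S> \<subseteq> \<A>" "card \<S> = p ^ multiplicity p (card \<A>)"
    using permset_sylow_exists[OF prime_p U A] by blast
  obtain a where a: "a \<in> \<A>" "\<And>d. d\<in>D \<Longrightarrow> \<exists>s\<in>\<S>. \<forall>x\<in>U. a (\<rho> d x) = s (a x)"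
    using sylow_conj_indu[OF D U A S \<rho>] by blast
  obtain s where s: "\<And>d. d \<in> D \<Longrightarrow> s d \<in> \<S> \<and> (\<forall>x\<in>U. a (\<rho> d x) = s d (a x))"
    using a(2) by metis
  have cl: "\<rho> d x \<in> U" if "d \<in> D" "x \<in> U" for d x
    using A \<rho>(1)[OF that(1)] that(2) unfolding permset_def by (metis imageI restrict_apply')
  have inj: "inj_on a U" using a(1) A by (auto simp: permset_def)
  let ?k = "\<lambda>t. (\<lambda>y\<in>U. inv_into U a (t (a y)))"
  have "(\<lambda>d. restrict (\<rho> d) U) ` D \<subseteq> ?k ` \<S>"
  proof
    fix r assume "r \<in> (\<lambda>d. restrict (\<rho> d) U) ` D"
    then obtain d where d: "d \<in> D" "r = restrict (\<rho> d) U" by auto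
    have "r = ?k (s d)"
      unfolding d(2) using s[OF d(1)] inj cl[OF d(1)]
      by (auto simp: restrict_def fun_eq_iff inv_into_f_f dest!: bspec) (metis inv_into_f_f)
    then show "r \<in> ?k ` \<S>" using s[OF d(1)] by blast
  qed
  then have "card ((\<lambda>d. restrict (\<rho> d) U) ` D) \<le> card (?k ` \<S>)"
    using permset_finite[OF U S(1)] by (intro card_mono) auto
  also have "\<dots> \<le> card \<S>" by (rule card_image_le[OF permset_finite[OF U S(1)]])
  finally show ?thesis using S by simp
qed

end

section \<open>Fusion systems as families of total functions\<close>

text \<open>
  \<open>M U f\<close> says that the restriction of the total function \<open>f\<close> to \<open>U\<close> is a morphism from \<open>U\<close> to \<open>T\<close>. Extensions and
  restrictions of a morphism are then the same function, with another domain. Accordingly \<open>auts\<close>, \<open>fa\<close>,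
  \<open>Nf\<close> and \<open>rec\<close> below are \<open>Aut\<^sub>F(U)\<close>, ``fully automized'', \<open>N\<^sub>\<phi>\<close> and ``receptive''.
\<close>

locale fsys = finite_p_group G p for G (structure) and p +
  fixes T :: "'a set" and M :: "'a set \<Rightarrow> ('a \<Rightarrow> 'a) \<Rightarrow> bool"
  assumes T_sub: "subgroup T G"
    and M_dom: "M U f \<Longrightarrow> subgroup U G \<and> U \<subseteq> T"
    and M_ran: "M U f \<Longrightarrow> x \<in> U \<Longrightarrow> f x \<in> T"
    and M_mult: "M U f \<Longrightarrow> x \<in> U \<Longrightarrow> y \<in> U \<Longrightarrow> f (x \<otimes> y) = f x \<otimes> f y"
    and M_inj: "M U f \<Longrightarrow> inj_on f U"
    and M_cong: "M U f \<Longrightarrow> (\<And>x. x \<in> U \<Longrightarrow> f x = g x) \<Longrightarrow> M U g"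
    and M_restrict: "M U f \<Longrightarrow> subgroup V G \<Longrightarrow> V \<subseteq> U \<Longrightarrow> M V f"
    and M_conj: "subgroup U G \<Longrightarrow> U \<subseteq> T \<Longrightarrow> t \<in> T \<Longrightarrow> M U (cj t)"
    and M_comp: "M U f \<Longrightarrow> M (f ` U) g \<Longrightarrow> M U (\<lambda>x. g (f x))"
    and M_inv: "M U f \<Longrightarrow> (\<And>x. x \<in> U \<Longrightarrow> g (f x) = x) \<Longrightarrow> M (f ` U) g"
begin

lemma M_car: "M U f \<Longrightarrow> x \<in> U \<Longrightarrow> x \<in> carrier G" using M_dom sub_mem by blast
lemma T_car: "x \<in> T \<Longrightarrow> x \<in> carrier G" using T_sub sub_mem by blast
lemma M_fcar: "M U f \<Longrightarrow> x \<in> U \<Longrightarrow> f x \<in> carrier G" using M_ran T_car by blast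

lemma M_id: "subgroup U G \<Longrightarrow> U \<subseteq> T \<Longrightarrow> M U (\<lambda>x. x)"
  by (rule M_cong[OF M_conj[of U \<one>]]) (auto simp: T_car subgroup.one_closed[OF T_sub])

lemma M_one: "M U f \<Longrightarrow> f \<one> = \<one>"
  using M_mult[of U f \<one> \<one>] M_fcar[of U f \<one>] M_dom[of U f]
  by (metis l_cancel_one' one_closed r_one subgroup.one_closed)

lemma M_minv: assumes "M U f" "x \<in> U" shows "f (inv x) = inv (f x)"
proof -
  have x: "inv x \<in> U" "x \<in> carrier G"
    using subgroup.m_inv_closed[OF conjunct1[OF M_dom[OF assms(1)]] assms(2)] M_car[OF assms] by auto
  have "f (inv x) \<otimes> f x = \<one>" using M_mult[OF assms(1) x(1) assms(2)] M_one[OF assms(1)] x by simp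
  then show ?thesis using M_fcar[OF assms] M_fcar[OF assms(1) x(1)] by (simp add: inv_equality)
qed

lemma M_cj_eq: assumes "M U f" "x \<in> U" "g \<in> U" shows "f (cj g x) = cj (f g) (f x)"
proof -
  have U: "subgroup U G" using assms M_dom by blast
  show ?thesis unfolding cj_def
    using assms U by (simp add: M_mult M_minv subgroup.m_inv_closed subgroup.m_closed)
qed

lemma M_img: "M U f \<Longrightarrow> subgroup (f ` U) G"
proof (rule subgroupI)
  assume f: "M U f"
  then have U: "subgroup U G" using M_dom by blast
  show "f ` U \<subseteq> carrier G" using f M_fcar by auto
  show "f ` U \<noteq> {}" using subgroup.one_closed[OF U] by auto
  {
    fix a assume "a \<in> f ` U"
    then obtain x where x: "x \<in> U" "a = f x" by auto
    then have "inv a = f (inv x)" using M_minv[OF f] by simp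
    then show "inv a \<in> f ` U" using subgroup.m_inv_closed[OF U x(1)] by auto
  next
    fix a b assume "a \<in> f ` U" "b \<in> f ` U"
    then obtain x y where x: "x \<in> U" "a = f x" "y \<in> U" "b = f y" by auto
    then have "a \<otimes> b = f (x \<otimes> y)" using M_mult[OF f] by simp
    then show "a \<otimes> b \<in> f ` U" using subgroup.m_closed[OF U x(1,3)] by auto
  }
qed

lemma M_imgT: "M U f \<Longrightarrow> f ` U \<subseteq> T" using M_ran by auto

lemma M_img_sub: "M W f \<Longrightarrow> subgroup U G \<Longrightarrow> U \<subseteq> W \<Longrightarrow> subgroup (f ` U) G"
  by (rule M_img[OF M_restrict])

lemma M_comp_sub: "M U f \<Longrightarrow> M W g \<Longrightarrow> f ` U \<subseteq> W \<Longrightarrow> M U (\<lambda>x. g (f x))"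
  by (rule M_comp, assumption, rule M_restrict[OF _ M_img], assumption+)

lemma M_card: "M W f \<Longrightarrow> U \<subseteq> W \<Longrightarrow> card (f ` U) = card U"
  using M_inj card_image inj_on_subset by blast

lemma M_inj_eq: "M U f \<Longrightarrow> x \<in> U \<Longrightarrow> y \<in> U \<Longrightarrow> f x = f y \<longleftrightarrow> x = y"
  using M_inj inj_on_eq_iff by metis

lemma M_inv_into: "M U f \<Longrightarrow> M (f ` U) (inv_into U f)"
  by (rule M_inv) (auto simp: M_inj)

text \<open>The morphism is l after f after the inverse of k. It is given as any g with the right
  values, so that a convenient formula can be chosen each time.\<close>

lemma M_transport:
  assumes k: "M Q k" and f: "M Q f" "M (f ` Q) l" and e: "\<And>x. x \<in> Q \<Longrightarrow> g (k x) = l (f x)"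
  shows "M (k ` Q) g"
proof -
  have "M (k ` Q) (\<lambda>y. l (f (inv_into Q k y)))"
    by (rule M_comp[OF M_inv_into[OF k]]) (use M_comp[OF f] M_inj[OF k] in \<open>simp add: image_inv_into_cancel\<close>)
  then show ?thesis by (rule M_cong) (use e M_inj[OF k] in auto)
qed

lemma M_nrm:
  assumes f: "M W f" "subgroup U G" "U \<subseteq> W" "g \<in> W" "g \<in> nrm S U"
  shows "f g \<in> nrm T (f ` U)"
proof (rule nrmI[OF _ T_sub])
  show "f g \<in> T" using M_ran f by blast
  show "subgroup (f ` U) G" using M_img_sub f by blast
  fix y assume "y \<in> f ` U"
  then obtain x where x: "x \<in> U" "y = f x" by auto
  have "cj (f g) y = f (cj g x)" using M_cj_eq[OF f(1)] x f by auto
  then show "cj (f g) y \<in> f ` U" using nrmD[OF f(5) x(1)] by auto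
qed

lemma M_cen:
  assumes f: "M W f" "U \<subseteq> W" "g \<in> W" "g \<in> cen S U"
  shows "f g \<in> cen T (f ` U)"
  using assms M_ran[OF f(1)] M_cj_eq[OF f(1), symmetric] by (auto simp: cen_def subset_iff)

lemma nrmT_sub: "subgroup U G \<Longrightarrow> subgroup (nrm T U) G" by (rule subgroup_nrm[OF T_sub])
lemma cenT_sub: "subgroup U G \<Longrightarrow> subgroup (cen T U) G" by (rule subgroup_cen[OF T_sub subgroup.subset])
lemma UC_sub: "subgroup U G \<Longrightarrow> subgroup (U <#> cen T U) G" by (rule subgroup_prod_cen[OF _ T_sub])
lemma UC_T: "U \<subseteq> T \<Longrightarrow> U <#> cen T U \<subseteq> T" by (rule prod_least[OF T_sub _ cen_sub])
lemma UC_nrm: "subgroup U G \<Longrightarrow> U \<subseteq> T \<Longrightarrow> U <#> cen T U \<subseteq> nrm T U"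
  by (rule prod_least[OF nrmT_sub self_nrm[OF T_sub] cen_nrm])
lemma UC_left: "subgroup U G \<Longrightarrow> U \<subseteq> U <#> cen T U" by (rule prod_left[OF _ cenT_sub])
lemma UC_right: "subgroup U G \<Longrightarrow> cen T U \<subseteq> U <#> cen T U" by (rule prod_right[OF _ cenT_sub])

section \<open>Automorphism groups and extension properties\<close>

definition auts :: "'a set \<Rightarrow> ('a \<Rightarrow> 'a) set" where
  "auts U = {f \<in> extensional U. M U f \<and> f ` U = U}"

definition fa :: "'a set \<Rightarrow> bool" where
  "fa U \<longleftrightarrow> card (indu (nrm T U) U) = p ^ multiplicity p (card (auts U))"

definition Nf :: "'a set \<Rightarrow> ('a \<Rightarrow> 'a) \<Rightarrow> 'a set" where
  "Nf S f = {g \<in> nrm T S. \<exists>r\<in>nrm T (f ` S). \<forall>x\<in>S. f (cj g x) = cj r (f x)}"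

definition rec :: "'a set \<Rightarrow> bool" where
  "rec R \<longleftrightarrow> (\<forall>S f. M S f \<and> f ` S = R \<longrightarrow> (\<exists>h. M (Nf S f) h \<and> (\<forall>x\<in>S. h x = f x)))"

text \<open>The assumptions on D say that D lies in \<open>Nf S f\<close>, so the receptive
  extension restricts to D.\<close>

lemma recD:
  assumes "rec R" "M S f" "f ` S = R" "subgroup D G" "D \<subseteq> T"
    and "\<And>g. g \<in> D \<Longrightarrow> \<exists>r\<in>nrm T R. \<forall>x\<in>S. f (cj g x) = cj r (f x)"
    and "\<And>g x. g \<in> D \<Longrightarrow> x \<in> S \<Longrightarrow> cj g x \<in> S"
  shows "\<exists>h. M D h \<and> (\<forall>x\<in>S. h x = f x)"
proof -
  obtain h where h: "M (Nf S f) h" "\<forall>x\<in>S. h x = f x" using assms(1-3) unfolding rec_def by blast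
  have S: "subgroup S G" using assms(2) M_dom by blast
  have "D \<subseteq> Nf S f" using assms S nrmI[OF _ T_sub S] by (auto simp: Nf_def subset_iff)
  then show ?thesis using h M_restrict[OF h(1) assms(4)] by blast
qed

lemma permset_sel:
  assumes U: "subgroup U G" "U \<subseteq> T"
    and Q: "\<And>f g. Q f \<Longrightarrow> (\<And>x. x \<in> U \<Longrightarrow> f x = g x) \<Longrightarrow> Q g"
      "\<And>f. Q f \<Longrightarrow> M U f \<and> f ` U = U"
      "Q (\<lambda>x. x)" "\<And>f g. Q f \<Longrightarrow> Q g \<Longrightarrow> Q (\<lambda>x. f (g x))" "\<And>f. Q f \<Longrightarrow> Q (inv_into U f)"
  shows "permset U {f \<in> extensional U. Q f}"
  unfolding permset_def
proof (intro conjI ballI)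
  fix f assume f: "f \<in> {f \<in> extensional U. Q f}"
  then show "f \<in> extensional U" "f ` U = U" "inj_on f U" using Q(2) M_inj by auto
  show "\<exists>g\<in>{f \<in> extensional U. Q f}. \<forall>x\<in>U. g (f x) = x"
    using f Q(2) M_inj Q(1)[OF Q(5)[of f], of "restrict (inv_into U f) U"]
    by (intro bexI[of _ "restrict (inv_into U f) U"]) auto
  fix g assume g: "g \<in> {f \<in> extensional U. Q f}"
  then have "Q (\<lambda>x. f (g x))" using f Q(4) by blast
  then have "Q (compose U f g)" by (rule Q(1)) (simp add: compose_eq)
  then show "compose U f g \<in> {f \<in> extensional U. Q f}" by (simp add: compose_def)
next
  have "Q (\<lambda>x\<in>U. x)" by (rule Q(1)[OF Q(3)]) auto
  then show "(\<lambda>x\<in>U. x) \<in> {f \<in> extensional U. Q f}" by simp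
qed

lemma M_aut_comp: "M U f \<Longrightarrow> f ` U = U \<Longrightarrow> M U g \<Longrightarrow> g ` U = U \<Longrightarrow> M U (\<lambda>x. f (g x)) \<and> (\<lambda>x. f (g x)) ` U = U"
  using M_comp[of U g f] by (simp add: image_image[symmetric])

lemma M_aut_inv: "M U f \<Longrightarrow> f ` U = U \<Longrightarrow> M U (inv_into U f) \<and> inv_into U f ` U = U"
  using M_inv_into[of U f] M_inj[of U f] by (metis bij_betw_def bij_betw_inv_into)

lemma permset_auts: "subgroup U G \<Longrightarrow> U \<subseteq> T \<Longrightarrow> permset U (auts U)"
  unfolding auts_def
proof (rule permset_sel, assumption, assumption)
  fix f g assume "M U f \<and> f ` U = U" "\<And>x. x \<in> U \<Longrightarrow> f x = g x"
  then show "M U g \<and> g ` U = U" using M_cong[of U f g] by (metis image_cong)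
qed (use M_id M_aut_comp M_aut_inv in auto)

text \<open>The centralizer of R in Aut(U). Composing with such a map does not change what a
  morphism does on R, which leaves room to make the morphism extendable.\<close>

definition cauts :: "'a set \<Rightarrow> 'a set \<Rightarrow> ('a \<Rightarrow> 'a) set" where
  "cauts U R = {f \<in> extensional U. M U f \<and> f ` U = U \<and> (\<forall>x\<in>R. f x = x)}"

lemma permset_cauts: "subgroup U G \<Longrightarrow> U \<subseteq> T \<Longrightarrow> R \<subseteq> U \<Longrightarrow> permset U (cauts U R)"
  unfolding cauts_def
proof (rule permset_sel, assumption, assumption)
  fix f g assume "M U f \<and> f ` U = U \<and> (\<forall>x\<in>R. f x = x)" "\<And>x. x \<in> U \<Longrightarrow> f x = g x" "R \<subseteq> U"
  then show "M U g \<and> g ` U = U \<and> (\<forall>x\<in>R. g x = x)" using M_cong[of U f g] by (metis image_cong subsetD)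
next
  fix f assume "M U f \<and> f ` U = U \<and> (\<forall>x\<in>R. f x = x)" "R \<subseteq> U"
  then show "M U (inv_into U f) \<and> inv_into U f ` U = U \<and> (\<forall>x\<in>R. inv_into U f x = x)"
    using M_aut_inv[of U f] M_inj[of U f] by (metis inv_into_f_f subsetD)
qed (use M_id M_aut_comp in auto)

lemma indu_auts: "subgroup U G \<Longrightarrow> U \<subseteq> T \<Longrightarrow> D \<subseteq> nrm T U \<Longrightarrow> indu D U \<subseteq> auts U"
proof
  fix f assume *: "subgroup U G" "U \<subseteq> T" "D \<subseteq> nrm T U" "f \<in> indu D U"
  then obtain d where d: "d \<in> nrm T U" "f = restrict (cj d) U" by (auto simp: indu_def)
  have "M U (cj d)" using M_conj * d nrm_sub by blast
  then have "M U f" unfolding d(2) by (rule M_cong) auto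
  then show "f \<in> auts U" using d by (auto simp: auts_def nrm_def)
qed

lemma indu_bound: "subgroup U G \<Longrightarrow> U \<subseteq> T \<Longrightarrow> card (indu (nrm T U) U) \<le> p ^ multiplicity p (card (auts U))"
  unfolding indu_def
  by (rule card_indu_le[OF nrmT_sub fin_sub permset_auts])
    (use indu_auts[OF _ _ subset_refl] nrm_sub in \<open>auto simp: indu_def T_car sub_mem cj_comp subset_iff\<close>)

lemma auts_sylow_conj:
  assumes U: "subgroup U G" "U \<subseteq> T" and f: "fa U" and K: "permset U K" "K \<subseteq> auts U" "card K = p ^ n"
  shows "\<exists>a\<in>auts U. \<forall>k\<in>K. \<exists>s\<in>indu (nrm T U) U. \<forall>x\<in>U. a (k x) = s (a x)"
  by (rule permset_sylow_conj_sub[OF prime_p fin_sub[OF U(1)] permset_auts[OF U]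
        permset_indu[OF nrmT_sub[OF U(1)] U(1) subset_refl] indu_auts[OF U subset_refl] _ K])
    (use f in \<open>simp add: fa_def\<close>)

definition nice :: "'a set \<Rightarrow> bool" where
  "nice R \<longleftrightarrow> subgroup R G \<and> R \<subseteq> T \<and> fa R \<and> rec R"

text \<open>Conjugation by f, carrying automorphisms of U to automorphisms of f(U).\<close>

definition tr :: "'a set \<Rightarrow> ('a \<Rightarrow> 'a) \<Rightarrow> ('a \<Rightarrow> 'a) \<Rightarrow> 'a \<Rightarrow> 'a" where
  "tr U f a = (\<lambda>y\<in>f ` U. f (a (inv_into U f y)))"

lemma tr_apply: "inj_on f U \<Longrightarrow> x \<in> U \<Longrightarrow> tr U f a (f x) = f (a x)"
  by (simp add: tr_def)

lemma tr_inj: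
  assumes f: "inj_on f U" and A: "\<And>a. a \<in> A \<Longrightarrow> a \<in> extensional U \<and> a ` U \<subseteq> U"
  shows "inj_on (tr U f) A"
proof (rule inj_onI)
  fix a b assume ab: "a \<in> A" "b \<in> A" "tr U f a = tr U f b"
  show "a = b"
  proof (rule extensionalityI[of _ U])
    fix x assume x: "x \<in> U"
    have "f (a x) = f (b x)" using tr_apply[OF f x] ab(3) by metis
    moreover have "a x \<in> U" "b x \<in> U" using A ab x by auto
    ultimately show "a x = b x" using f by (simp add: inj_on_eq_iff)
  qed (use A ab in auto)
qed

lemma tr_M:
  assumes f: "M U f" and a: "M U a" "a ` U = U"
  shows "M (f ` U) (tr U f a)" "tr U f a ` f ` U = f ` U"
proof -
  have inj: "inj_on f U" using M_inj[OF f] .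
  show "M (f ` U) (tr U f a)" by (rule M_transport[OF f a(1)]) (use f a tr_apply[OF inj] in auto)
  have "tr U f a ` f ` U = f ` a ` U" using tr_apply[OF inj] by (auto simp: image_image)
  then show "tr U f a ` f ` U = f ` U" using a by simp
qed

lemma tr_cj:
  assumes f: "M U f" and d: "d \<in> nrm T U"
  shows "M (f ` U) (tr U f (cj d))" "tr U f (cj d) ` f ` U = f ` U" "tr U f (cj d) \<in> extensional (f ` U)"
proof -
  have "M U (cj d)" "cj d ` U = U" using d M_conj M_dom[OF f] nrm_sub by (auto simp: nrm_def)
  from tr_M[OF f this] show "M (f ` U) (tr U f (cj d))" "tr U f (cj d) ` f ` U = f ` U" by auto
qed (simp add: tr_def)

text \<open>The device for enlarging domains: D induces a p-group on V, which f carries into \<A>;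
  following f by some a in \<A> moves it into \<S>. When \<S> is induced by elements of T, this is
  what receptivity of W asks for.\<close>

lemma sylow_move:
  assumes f: "M V f" "f ` V = W" and D: "subgroup D G" "D \<subseteq> nrm T V"
    and A: "permset W \<A>" "permset W \<S>" "\<S> \<subseteq> \<A>" "card \<S> = p ^ multiplicity p (card \<A>)"
    and t: "\<And>d. d \<in> D \<Longrightarrow> tr V f (cj d) \<in> \<A>"
  shows "\<exists>a\<in>\<A>. \<forall>d\<in>D. \<exists>s\<in>\<S>. \<forall>x\<in>V. a (f (cj d x)) = s (a (f x))"
proof -
  have V: "subgroup V G" "V \<subseteq> T" using M_dom[OF f(1)] by auto
  have W: "finite W" using fin_sub[OF V(1)] f(2) by blast
  have inj: "inj_on f V" using M_inj[OF f(1)] .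
  have iv: "inv_into V f y \<in> V" if "y \<in> W" for y using that f(2) by (auto intro: inv_into_into)
  let ?\<rho> = "\<lambda>d y. f (cj d (inv_into V f y))"
  have "\<exists>a\<in>\<A>. \<forall>d\<in>D. \<exists>s\<in>\<S>. \<forall>z\<in>W. a (?\<rho> d z) = s (a z)"
  proof (rule sylow_conj_indu[OF D(1) W A])
    show "restrict (?\<rho> d) W \<in> \<A>" if "d \<in> D" for d using t[OF that] f(2) by (simp add: tr_def)
    fix d d' x assume *: "d \<in> D" "d' \<in> D" "x \<in> W"
    then show "?\<rho> (d \<otimes> d') x = ?\<rho> d' (?\<rho> d x)"
      using iv[OF *(3)] nrmD[OF subsetD[OF D(2) *(1)]] inj V D(1) by (simp add: cj_comp sub_mem)
  qed
  then obtain a where a: "a \<in> \<A>" "\<And>d. d \<in> D \<Longrightarrow> \<exists>s\<in>\<S>. \<forall>z\<in>W. a (?\<rho> d z) = s (a z)" by blast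
  have "\<exists>s\<in>\<S>. \<forall>x\<in>V. a (f (cj d x)) = s (a (f x))" if d: "d \<in> D" for d
  proof -
    obtain s where s: "s\<in>\<S>" "\<forall>z\<in>W. a (?\<rho> d z) = s (a z)" using a(2)[OF d] by blast
    have "a (f (cj d x)) = s (a (f x))" if "x \<in> V" for x
      using s(2) that f(2) inj by (metis imageI inv_into_f_f)
    then show ?thesis using s(1) by blast
  qed
  then show ?thesis using a(1) by blast
qed

text \<open>Conjugation by u in V corresponds to conjugation by f(u), so elements r have to be
  supplied only for D.\<close>

lemma rec_ext_prod:
  assumes W: "rec W" and f: "M V f" "f ` V = W" and D: "subgroup D G" "D \<subseteq> nrm T V"
    and r: "\<And>d. d \<in> D \<Longrightarrow> \<exists>r\<in>nrm T W. \<forall>x\<in>V. f (cj d x) = cj r (f x)"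
  shows "\<exists>h. M (V <#> D) h \<and> (\<forall>x\<in>V. h x = f x)"
proof (rule recD[OF W f])
  have V: "subgroup V G" "V \<subseteq> T" using M_dom[OF f(1)] by auto
  have Ws: "subgroup W G" "W \<subseteq> T" using M_img[OF f(1)] M_imgT[OF f(1)] f(2) by auto
  have DT: "D \<subseteq> T" using D nrm_sub by blast
  show "subgroup (V <#> D) G"
    by (rule subgroup_prod[OF V(1) D(1)]) (use D T_car in \<open>auto simp: nrm_def\<close>)
  show "V <#> D \<subseteq> T" by (rule prod_least[OF T_sub V(2) DT])
  fix g assume "g \<in> V <#> D"
  then obtain u d where g: "u \<in> V" "d \<in> D" "g = u \<otimes> d" by (auto simp: prod_mem)
  have gc: "u \<in> carrier G" "d \<in> carrier G" using g V D sub_mem by auto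
  obtain r where r: "r \<in> nrm T W" "\<forall>x\<in>V. f (cj d x) = cj r (f x)" using r[OF g(2)] by blast
  have fu: "f u \<in> W" using f g by auto
  have "f u \<otimes> r \<in> nrm T W"
    using subgroup.m_closed[OF nrmT_sub[OF Ws(1)]] self_nrm[OF T_sub Ws] fu r by blast
  moreover have "f (cj g x) = cj (f u \<otimes> r) (f x)" if x: "x \<in> V" for x
  proof -
    have xc: "x \<in> carrier G" "cj u x \<in> V" using x V g sub_mem cj_sub by auto
    have "f (cj g x) = cj r (f (cj u x))" using r(2) g gc xc by (simp add: cj_comp)
    also have "\<dots> = cj r (cj (f u) (f x))" using M_cj_eq[OF f(1) x g(1)] by simp
    finally show ?thesis using M_fcar[OF f(1)] g x r nrm_sub T_car by (simp add: cj_comp subset_iff)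
  qed
  ultimately show "\<exists>r\<in>nrm T W. \<forall>x\<in>V. f (cj g x) = cj r (f x)" by blast
  show "cj g x \<in> V" if "x \<in> V" for x
    using that g gc V nrmD[OF subsetD[OF D(2) g(2)]] cj_sub by (simp add: cj_comp sub_mem)
qed

text \<open>The Sylow argument behind extensions to normalizers: a \<open>p\<close>-group of automorphisms induced
  on \<open>U\<close> is moved into the Sylow subgroup \<open>Aut\<^sub>T(R)\<close> by an automorphism of \<open>R\<close>.\<close>

lemma nice_ext:
  assumes R: "nice R" and f: "M U f" "f ` U = R"
  shows "\<exists>h. M (nrm T U) h \<and> h ` U = R"
proof -
  have U: "subgroup U G" "U \<subseteq> T" using f M_dom by auto
  have R': "subgroup R G" "R \<subseteq> T" "fa R" "rec R" using R by (auto simp: nice_def)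
  have n: "subgroup (nrm T U) G" by (rule nrmT_sub[OF U(1)])
  have "\<exists>a\<in>auts R. \<forall>d\<in>nrm T U. \<exists>s\<in>indu (nrm T R) R. \<forall>x\<in>U. a (f (cj d x)) = s (a (f x))"
  proof (rule sylow_move[OF f n subset_refl permset_auts[OF R'(1,2)]
        permset_indu[OF nrmT_sub[OF R'(1)] R'(1) subset_refl] indu_auts[OF R'(1,2) subset_refl]])
    show "card (indu (nrm T R) R) = p ^ multiplicity p (card (auts R))" using R' by (simp add: fa_def)
    show "tr U f (cj d) \<in> auts R" if "d \<in> nrm T U" for d using tr_cj[OF f(1) that] f(2) by (simp add: auts_def)
  qed
  then obtain a where a: "a \<in> auts R" "\<And>d. d\<in>nrm T U \<Longrightarrow> \<exists>s\<in>indu (nrm T R) R. \<forall>x\<in>U. a (f (cj d x)) = s (a (f x))"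
    by blast
  have aR: "M R a" "a ` R = R" using a by (auto simp: auts_def)
  have h0: "M U (\<lambda>x. a (f x))" "(\<lambda>x. a (f x)) ` U = R"
    using M_comp[OF f(1), of a] image_image[of a f U] f(2) aR by simp_all
  have "\<exists>h. M (nrm T U) h \<and> (\<forall>x\<in>U. h x = a (f x))"
  proof (rule recD[OF R'(4) h0 n nrm_sub])
    fix d assume d: "d \<in> nrm T U"
    obtain s where s: "s\<in>indu (nrm T R) R" "\<forall>x\<in>U. a (f (cj d x)) = s (a (f x))" using a(2)[OF d] by blast
    then obtain r where r: "r \<in> nrm T R" "s = restrict (cj r) R" by (auto simp: indu_def)
    have "a (f (cj d x)) = cj r (a (f x))" if "x \<in> U" for x using s(2) r(2) that h0(2) by auto
    then show "\<exists>r\<in>nrm T R. \<forall>x\<in>U. a (f (cj d x)) = cj r (a (f x))" using r by blast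
  qed (rule nrmD)
  then obtain h where h: "M (nrm T U) h" "\<forall>x\<in>U. h x = a (f x)" by blast
  moreover have "h ` U = R" using h h0(2) by (metis (no_types, lifting) image_cong)
  ultimately show ?thesis by blast
qed

lemma tr_auts: "M U f \<Longrightarrow> a \<in> auts U \<Longrightarrow> tr U f a \<in> auts (f ` U)"
  using tr_M[of U f a] by (auto simp: auts_def) (auto simp: tr_def)

lemma finite_auts: "subgroup U G \<Longrightarrow> U \<subseteq> T \<Longrightarrow> finite (auts U)"
  using permset_finite[OF fin_sub permset_auts] by blast

lemma finite_cauts: "subgroup U G \<Longrightarrow> U \<subseteq> T \<Longrightarrow> R \<subseteq> U \<Longrightarrow> finite (cauts U R)"
  using permset_finite[OF fin_sub permset_cauts] by blast

lemma inv_img: "M U f \<Longrightarrow> V \<subseteq> U \<Longrightarrow> inv_into U f ` f ` V = V"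
  using M_inj by (metis inv_into_image_cancel)

lemma card_auts_le: "M U f \<Longrightarrow> card (auts U) \<le> card (auts (f ` U))"
proof (rule card_inj_on_le[of "tr U f"])
  assume f: "M U f"
  show "inj_on (tr U f) (auts U)" by (rule tr_inj[OF M_inj[OF f]]) (auto simp: auts_def)
  show "tr U f ` auts U \<subseteq> auts (f ` U)" using tr_auts[OF f] by auto
  show "finite (auts (f ` U))" by (rule finite_auts[OF M_img[OF f] M_imgT[OF f]])
qed

lemma card_auts: assumes f: "M U f" shows "card (auts (f ` U)) = card (auts U)"
  using card_auts_le[OF f] card_auts_le[OF M_inv_into[OF f]] inv_img[OF f subset_refl] by simp

lemma card_cauts_le:
  assumes f: "M U f" and R: "R \<subseteq> U"
  shows "card (cauts U R) \<le> card (cauts (f ` U) (f ` R))"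
proof (rule card_inj_on_le[of "tr U f"])
  have inj: "inj_on f U" using M_inj[OF f] .
  show "inj_on (tr U f) (cauts U R)" by (rule tr_inj[OF inj]) (auto simp: cauts_def)
  show "tr U f ` cauts U R \<subseteq> cauts (f ` U) (f ` R)"
  proof clarify
    fix a assume a: "a \<in> cauts U R"
    then have "M (f ` U) (tr U f a)" "tr U f a ` f ` U = f ` U" using tr_M[OF f] by (auto simp: cauts_def)
    moreover have "tr U f a \<in> extensional (f ` U)" by (simp add: tr_def)
    moreover have "tr U f a y = y" if y: "y \<in> f ` R" for y
    proof -
      obtain x where x: "x \<in> R" "y = f x" using y by auto
      then show ?thesis using tr_apply[OF inj, of x a] a R by (auto simp: cauts_def)
    qed
    ultimately show "tr U f a \<in> cauts (f ` U) (f ` R)" unfolding cauts_def by blast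
  qed
  show "finite (cauts (f ` U) (f ` R))" by (rule finite_cauts[OF M_img[OF f] M_imgT[OF f] image_mono[OF R]])
qed

lemma card_cauts: assumes f: "M U f" and R: "R \<subseteq> U" shows "card (cauts (f ` U) (f ` R)) = card (cauts U R)"
proof -
  have "card (cauts (f ` U) (f ` R)) \<le> card (cauts (inv_into U f ` f ` U) (inv_into U f ` f ` R))"
    by (rule card_cauts_le[OF M_inv_into[OF f]]) (use R in blast)
  then show ?thesis using card_cauts_le[OF f R] inv_img[OF f subset_refl] inv_img[OF f R] by simp
qed

lemma tr_indu:
  assumes f: "M W f" and U: "subgroup U G" "U \<subseteq> W" and D: "D \<subseteq> W" "D \<subseteq> nrm S U"
  shows "tr U f ` indu D U = indu (f ` D) (f ` U)"
proof -
  have inj: "inj_on f U" by (rule inj_on_subset[OF M_inj[OF f] U(2)])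
  have "tr U f (restrict (cj d) U) = restrict (cj (f d)) (f ` U)" if d: "d \<in> D" for d
  proof (rule extensionalityI[of _ "f ` U"])
    fix y assume "y \<in> f ` U"
    then obtain x where x: "x \<in> U" "y = f x" by auto
    have "tr U f (restrict (cj d) U) y = f (cj d x)" using x tr_apply[OF inj x(1)] by simp
    also have "\<dots> = cj (f d) y" using M_cj_eq[OF f] x U d D by auto
    finally show "tr U f (restrict (cj d) U) y = restrict (cj (f d)) (f ` U) y" using x by simp
  qed (auto simp: tr_def)
  then show ?thesis unfolding indu_def image_image by (intro image_cong refl) auto
qed

lemma card_indu_img:
  assumes f: "M W f" and U: "subgroup U G" "U \<subseteq> W" and D: "D \<subseteq> W" "D \<subseteq> nrm S U"
  shows "card (indu (f ` D) (f ` U)) = card (indu D U)"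
  unfolding tr_indu[OF assms, symmetric]
proof (rule card_image[OF tr_inj])
  show "inj_on f U" by (rule inj_on_subset[OF M_inj[OF f] U(2)])
  show "\<And>a. a \<in> indu D U \<Longrightarrow> a \<in> extensional U \<and> a ` U \<subseteq> U"
    using D nrmD by (auto simp: indu_def)
qed

lemma finite_indu: "finite D \<Longrightarrow> finite (indu D U)" by (simp add: indu_def)

lemma indu_mono: "D \<subseteq> E \<Longrightarrow> indu D U \<subseteq> indu E U" by (auto simp: indu_def)

lemma M_nrm_img:
  assumes f: "M W f" "subgroup U G" "U \<subseteq> W" "D \<subseteq> W" "D \<subseteq> nrm S U"
  shows "f ` D \<subseteq> nrm T (f ` U)"
  using M_nrm[OF f(1-3)] f(4,5) by blast

text \<open>Put f0 for f followed by the inverse of h. Then f and f0 have the same group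
  \<open>Nf\<close>, and the extension of f0 takes values in \<open>nrm T R\<close>, precisely where
  h is defined, so it can be followed by h.\<close>

lemma nice_transfer:
  assumes R: "nice R" and h: "M (nrm T R) h"
  shows "nice (h ` R)"
proof -
  have R': "subgroup R G" "R \<subseteq> T" "fa R" "rec R" using R by (auto simp: nice_def)
  note RN = self_nrm[OF T_sub R'(1,2)]
  have hR: "M R h" by (rule M_restrict[OF h R'(1) RN])
  have S: "subgroup (h ` R) G" "h ` R \<subseteq> T" using M_img[OF hR] M_imgT[OF hR] by auto
  have sub: "h ` nrm T R \<subseteq> nrm T (h ` R)" by (rule M_nrm_img[OF h R'(1) RN subset_refl subset_refl])
  have c1: "card (indu (h ` nrm T R) (h ` R)) = p ^ multiplicity p (card (auts (h ` R)))"
    using card_indu_img[OF h R'(1) RN subset_refl subset_refl] R'(3) card_auts[OF hR] by (simp add: fa_def)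
  have fN: "finite (indu (nrm T (h ` R)) (h ` R))" using fin_sub[OF nrmT_sub[OF S(1)]] by (simp add: finite_indu)
  \<comment> \<open>The image has the largest order allowed by \<open>indu_bound\<close>, so it is
    all of Aut_T(h(R)). Hence the action of any r in the normalizer of h(R) is that of some
    h(q).\<close>
  have c2: "indu (h ` nrm T R) (h ` R) = indu (nrm T (h ` R)) (h ` R)"
    by (rule card_seteq[OF fN indu_mono[OF sub]]) (use c1 indu_bound[OF S] in simp)
  have fa: "fa (h ` R)" using c1 c2 by (simp add: fa_def)
  have "rec (h ` R)"
    unfolding rec_def
  proof (intro allI impI, elim conjE)
    fix S' f assume f: "M S' f" "f ` S' = h ` R"
    define f0 where "f0 x = inv_into R h (f x)" for x
    have f0: "M S' f0" unfolding f0_def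
      by (rule M_comp[OF f(1)]) (use M_inv_into[OF hR] f in simp)
    have f0R: "f0 ` S' = R" using f inv_img[OF hR subset_refl] unfolding f0_def by (simp add: image_image[symmetric])
    have hf0: "h (f0 x) = f x" if "x \<in> S'" for x using that f unfolding f0_def by (metis f_inv_into_f imageI)
    have eq: "f (cj g x) = cj (h r) (f x) \<longleftrightarrow> f0 (cj g x) = cj r (f0 x)"
      if "x \<in> S'" "cj g x \<in> S'" "r \<in> nrm T R" for x g r
    proof -
      have x: "f0 x \<in> R" "f0 (cj g x) \<in> R" using that f0R by auto
      then have "cj (h r) (f x) = h (cj r (f0 x))" using M_cj_eq[OF h, of "f0 x" r] that hf0 RN by auto
      then show ?thesis using hf0[OF that(2)] M_inj_eq[OF hR x(2) nrmD[OF that(3) x(1)]] by auto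
    qed
    have "Nf S' f0 = Nf S' f"
    proof (intro equalityI subsetI)
      fix g assume g: "g \<in> Nf S' f0"
      then obtain r where r: "r \<in> nrm T R" "\<forall>x\<in>S'. f0 (cj g x) = cj r (f0 x)" "g \<in> nrm T S'"
        using f0R by (auto simp: Nf_def)
      then have "\<forall>x\<in>S'. f (cj g x) = cj (h r) (f x)" using eq nrmD by blast
      moreover have "h r \<in> nrm T (h ` R)" using r sub by blast
      ultimately show "g \<in> Nf S' f" using r f by (auto simp: Nf_def)
    next
      fix g assume g: "g \<in> Nf S' f"
      then obtain r where r: "r \<in> nrm T (h ` R)" "\<forall>x\<in>S'. f (cj g x) = cj r (f x)" "g \<in> nrm T S'"
        using f by (auto simp: Nf_def)
      have "restrict (cj r) (h ` R) \<in> indu (h ` nrm T R) (h ` R)" unfolding c2 using r by (auto simp: indu_def)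
      then obtain q where q: "q \<in> nrm T R" "restrict (cj r) (h ` R) = restrict (cj (h q)) (h ` R)" by (auto simp: indu_def)
      have "cj r y = cj (h q) y" if "y \<in> h ` R" for y using q(2) that by (metis restrict_apply')
      then have "cj r (f x) = cj (h q) (f x)" if "x \<in> S'" for x using that f(2) by blast
      then have "\<forall>x\<in>S'. f (cj g x) = cj (h q) (f x)" using r(2) by auto
      then have "\<forall>x\<in>S'. f0 (cj g x) = cj q (f0 x)" using eq q r nrmD by blast
      then show "g \<in> Nf S' f0" using r q f0R by (auto simp: Nf_def)
    qed
    then obtain k where k: "M (Nf S' f) k" "\<forall>x\<in>S'. k x = f0 x"
      using R'(4) f0 f0R unfolding rec_def by metis
    have S': "subgroup S' G" "S' \<subseteq> T" using M_dom[OF f(1)] by auto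
    have SN: "S' \<subseteq> Nf S' f"
      using self_nrm[OF T_sub S'] M_cj_eq[OF f(1)] self_nrm[OF T_sub S] f by (fastforce simp: Nf_def)
    have "k ` S' = R" using k f0R by (metis (no_types, lifting) image_cong)
    then have "k ` Nf S' f \<subseteq> nrm T R"
      using M_nrm_img[OF k(1) S'(1) SN subset_refl, of T] by (auto simp: Nf_def)
    then have "M (Nf S' f) (\<lambda>x. h (k x))" by (rule M_comp_sub[OF k(1) h])
    then show "\<exists>h. M (Nf S' f) h \<and> (\<forall>x\<in>S'. h x = f x)" using k hf0 by auto
  qed
  then show ?thesis using S fa by (simp add: nice_def)
qed

text \<open>Fully automized receptive subgroups are fully normalized and fully centralized: by
  \<open>nice_ext\<close> the normalizer of a conjugate embeds into that of R, and the centralizer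
  goes along.\<close>

lemma nice_max:
  assumes R: "nice R" and f: "M S f" "f ` S = R"
  shows "card (nrm T S) \<le> card (nrm T R)" "card (cen T S) \<le> card (cen T R)"
proof -
  obtain h where h: "M (nrm T S) h" "h ` S = R" using nice_ext[OF assms] by blast
  have S: "subgroup S G" "S \<subseteq> T" and R': "subgroup R G" using f M_dom R by (auto simp: nice_def)
  note SN = self_nrm[OF T_sub S]
  have "h ` nrm T S \<subseteq> nrm T R" using M_nrm_img[OF h(1) S(1) SN subset_refl subset_refl] h by simp
  then show "card (nrm T S) \<le> card (nrm T R)"
    using M_card[OF h(1) subset_refl] fin_sub[OF nrmT_sub[OF R']] by (metis card_mono)
  have "h ` cen T S \<subseteq> cen T R" using M_cen[OF h(1) SN] cen_nrm h(2) by blast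
  then show "card (cen T S) \<le> card (cen T R)"
    using M_card[OF h(1) cen_nrm] fin_sub[OF cenT_sub[OF R']] by (metis card_mono)
qed

lemma M_UC:
  assumes h: "M (U <#> cen T U) h" and U: "subgroup U G"
  shows "h ` (U <#> cen T U) \<subseteq> h ` U <#> cen T (h ` U)"
proof clarify
  fix x assume "x \<in> U <#> cen T U"
  then obtain u c where uc: "u \<in> U" "c \<in> cen T U" "x = u \<otimes> c" by (auto simp: prod_mem)
  then have "h x = h u \<otimes> h c" using M_mult[OF h] UC_left[OF U] UC_right[OF U] by auto
  moreover have "h c \<in> cen T (h ` U)" using M_cen[OF h UC_left[OF U] _ uc(2)] uc UC_right[OF U] by auto
  ultimately show "h x \<in> h ` U <#> cen T (h ` U)" using uc by (auto simp: prod_mem)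
qed

lemma nrm_nrm_UC:
  assumes U: "subgroup U G" "U \<subseteq> T"
  shows "nrm T U \<subseteq> nrm T (U <#> cen T U)"
proof
  fix g assume g: "g \<in> nrm T U"
  have gT: "g \<in> T" using g nrm_sub by blast
  have gc: "M (U <#> cen T U) (cj g)" by (rule M_conj[OF UC_sub[OF U(1)] UC_T[OF U(2)] gT])
  show "g \<in> nrm T (U <#> cen T U)"
    by (rule nrmI[OF gT T_sub UC_sub[OF U(1)]]) (use M_UC[OF gc U(1)] g in \<open>auto simp: nrm_def\<close>)
qed

definition saturated :: bool where
  "saturated \<longleftrightarrow> (\<forall>U. subgroup U G \<and> U \<subseteq> T \<longrightarrow> (\<exists>f. M U f \<and> nice (f ` U)))"

lemma nice_rep:
  assumes sat: saturated and U: "subgroup U G" "U \<subseteq> T"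
  shows "\<exists>h. M (nrm T U) h \<and> nice (h ` U)"
  using sat U nice_ext unfolding saturated_def by metis

text \<open>Moving R C_T(R) after R has been chosen does not spoil R: the normalizer of R lies in
  that of the product, so \<open>nice_transfer\<close> applies. Maximality of C_T(R) ensures that
  the image of the product is again the product of the new subgroup with its centralizer.\<close>

lemma nice2_rep:
  assumes sat: saturated and U: "subgroup U G" "U \<subseteq> T"
  shows "\<exists>h. M (nrm T U) h \<and> nice (h ` U) \<and> nice (h ` U <#> cen T (h ` U))"
proof -
  obtain e where e: "M (nrm T U) e" "nice (e ` U)" using nice_rep[OF assms] by blast
  let ?R = "e ` U"
  have R: "subgroup ?R G" "?R \<subseteq> T" using e by (auto simp: nice_def)
  obtain h where h: "M (nrm T (?R <#> cen T ?R)) h" "nice (h ` (?R <#> cen T ?R))"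
    using nice_rep[OF sat UC_sub[OF R(1)] UC_T[OF R(2)]] by blast
  have sub: "nrm T ?R \<subseteq> nrm T (?R <#> cen T ?R)" by (rule nrm_nrm_UC[OF R])
  have h1: "M (nrm T ?R) h" by (rule M_restrict[OF h(1) nrmT_sub[OF R(1)] sub])
  have h2: "M (?R <#> cen T ?R) h" by (rule M_restrict[OF h1 UC_sub[OF R(1)] UC_nrm[OF R]])
  have n: "nice (h ` ?R)" by (rule nice_transfer[OF e(2) h1])
  have hR: "M ?R h" by (rule M_restrict[OF h1 R(1) self_nrm[OF T_sub R]])
  have S: "subgroup (h ` ?R) G" "h ` ?R \<subseteq> T" using n by (auto simp: nice_def)
  have cs: "h ` cen T ?R \<subseteq> cen T (h ` ?R)" using M_cen[OF h1 self_nrm[OF T_sub R]] cen_nrm by blast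
  have "card (cen T (h ` ?R)) \<le> card (cen T ?R)"
    by (rule nice_max(2)[OF e(2) M_inv_into[OF hR] inv_img[OF hR subset_refl]])
  also have "\<dots> = card (h ` cen T ?R)" using M_card[OF h1 cen_nrm] by simp
  finally have ceq: "h ` cen T ?R = cen T (h ` ?R)"
    by (intro card_seteq[OF fin_sub[OF cenT_sub[OF S(1)]] cs])
  have "h ` (?R <#> cen T ?R) = h ` ?R <#> cen T (h ` ?R)"
  proof
    show "h ` (?R <#> cen T ?R) \<subseteq> h ` ?R <#> cen T (h ` ?R)" by (rule M_UC[OF h2 R(1)])
    show "h ` ?R <#> cen T (h ` ?R) \<subseteq> h ` (?R <#> cen T ?R)"
      by (rule prod_least[OF M_img[OF h2]]) (use UC_left[OF R(1)] UC_right[OF R(1)] ceq in blast)+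
  qed
  then have "nice (h ` ?R <#> cen T (h ` ?R))" using h by simp
  moreover have "M (nrm T U) (\<lambda>x. h (e x))"
    by (rule M_comp_sub[OF e(1) h1]) (rule M_nrm_img[OF e(1) U(1) self_nrm[OF T_sub U] subset_refl subset_refl])
  moreover have "(\<lambda>x. h (e x)) ` U = h ` ?R" by (simp add: image_image)
  ultimately show ?thesis using n by (metis (no_types, lifting))
qed

text \<open>A relative version of \<open>nice_ext\<close>. Although V is fully automized, T need not
  induce a Sylow subgroup of the automorphisms fixing a given subgroup of V pointwise. Moving such a
  Sylow subgroup into Aut_T(V) replaces the image of R by an Aut(V)-conjugate for which T does;
  hence the conclusion speaks of the image under \<tau>.\<close>

lemma cauts_sylow_ext:
  assumes V: "nice V" and e: "M U e" "e ` U = V" and R: "subgroup R G" "R \<subseteq> U"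
  shows "\<exists>\<tau>. M (U <#> nrm (cen T R) U) \<tau> \<and> \<tau> ` U = V \<and>
    card (indu (nrm (cen T (\<tau> ` R)) V) V) = p ^ multiplicity p (card (cauts V (\<tau> ` R)))"
proof -
  have U: "subgroup U G" "U \<subseteq> T" using e M_dom by auto
  have V': "subgroup V G" "V \<subseteq> T" "fa V" "rec V" using V by (auto simp: nice_def)
  let ?R1 = "e ` R" and ?D = "nrm (cen T R) U"
  have R1: "?R1 \<subseteq> V" using R e by auto
  have D: "subgroup ?D G" by (rule subgroup_nrm[OF cenT_sub[OF R(1)] U(1)])
  have DT: "?D \<subseteq> T" using nrm_sub cen_sub by blast
  have Dn: "?D \<subseteq> nrm T U" using cen_sub by (auto simp: nrm_def)
  have Dc: "cj d x = x" if "d \<in> ?D" "x \<in> R" for d x using that nrm_sub by (auto simp: cen_def nrm_def)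
  obtain Q where Q: "permset V Q" "Q \<subseteq> cauts V ?R1" "card Q = p ^ multiplicity p (card (cauts V ?R1))"
    using permset_sylow_exists[OF prime_p fin_sub[OF V'(1)] permset_cauts[OF V'(1,2) R1]] by blast
  \<comment> \<open>Here y fixes the image of R pointwise and brings the action of \<open>?D\<close>
    into Q; the automorphism a found next realizes Q inside T, at the price of moving the image of
    R.\<close>
  have "\<exists>y\<in>cauts V ?R1. \<forall>d\<in>?D. \<exists>s\<in>Q. \<forall>x\<in>U. y (e (cj d x)) = s (y (e x))"
  proof (rule sylow_move[OF e D Dn permset_cauts[OF V'(1,2) R1] Q])
    fix d assume d: "d \<in> ?D"
    have "tr U e (cj d) y = y" if y: "y \<in> ?R1" for y
    proof -
      obtain x where x: "x \<in> R" "y = e x" using y by auto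
      then show ?thesis using tr_apply[OF M_inj[OF e(1)], of x "cj d"] R(2) Dc[OF d x(1)] by auto
    qed
    then show "tr U e (cj d) \<in> cauts V ?R1" using tr_cj[OF e(1) subsetD[OF Dn d]] e(2) by (simp add: cauts_def)
  qed
  then obtain y where y: "y\<in>cauts V ?R1" "\<And>d. d\<in>?D \<Longrightarrow> \<exists>s\<in>Q. \<forall>x\<in>U. y (e (cj d x)) = s (y (e x))" by blast
  have QA: "Q \<subseteq> auts V" using Q(2) by (auto simp: cauts_def auts_def)
  obtain a where a: "a\<in>auts V" "\<And>d. d\<in>Q \<Longrightarrow> \<exists>s\<in>indu (nrm T V) V. \<forall>x\<in>V. a (d x) = s (a x)"
    using auts_sylow_conj[OF V'(1-3) Q(1) QA Q(3)] by blast
  have aV: "M V a" "a ` V = V" using a by (auto simp: auts_def)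
  have yV: "M V y" "y ` V = V" "\<And>x. x \<in> ?R1 \<Longrightarrow> y x = x" using y by (auto simp: cauts_def)
  define f where "f x = a (y (e x))" for x
  have ye: "M U (\<lambda>x. y (e x))" "(\<lambda>x. y (e x)) ` U = V"
    using M_comp[OF e(1), of y] image_image[of y e U] yV(1,2) e(2) by simp_all
  have f: "M U f" "f ` U = V" unfolding f_def
    using M_comp[OF ye(1), of a] image_image[of a "\<lambda>x. y (e x)" U] ye(2) aV by simp_all
  let ?R' = "f ` R"
  have fR: "?R' = a ` ?R1" unfolding f_def image_image using yV(3) by (auto intro!: image_cong)
  let ?D' = "nrm (cen T ?R') V"
  have R'V: "?R' \<subseteq> V" using R f by auto
  have R'sub: "subgroup ?R' G" by (rule M_img_sub[OF f(1) R])
  have D': "subgroup ?D' G" by (rule subgroup_nrm[OF cenT_sub[OF R'sub] V'(1)])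
  have D'n: "?D' \<subseteq> nrm T V" using cen_sub by (auto simp: nrm_def)
  \<comment> \<open>As d fixes \<open>?R1\<close> pointwise, an r realizing its conjugate fixes the
    image of \<open>?R1\<close> under a, so r centralizes \<open>?R'\<close>.\<close>
  have key: "\<exists>r\<in>?D'. \<forall>x\<in>V. a (d x) = cj r (a x)" if d: "d \<in> Q" for d
  proof -
    obtain s where s: "s\<in>indu (nrm T V) V" "\<forall>x\<in>V. a (d x) = s (a x)" using a(2)[OF d] by blast
    then obtain r where r: "r \<in> nrm T V" "s = restrict (cj r) V" by (auto simp: indu_def)
    have eq: "a (d x) = cj r (a x)" if "x \<in> V" for x using s r that aV by auto
    have "cj r z = z" if z: "z \<in> ?R'" for z
    proof -
      obtain w where w: "w \<in> ?R1" "z = a w" using z fR by auto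
      have "d w = w" using d Q(2) w by (auto simp: cauts_def)
      then show ?thesis using eq[of w] w R1 by auto
    qed
    then have "r \<in> ?D'" using r nrm_sub by (auto simp: nrm_def cen_def)
    then show ?thesis using eq by blast
  qed
  have card: "card (indu ?D' V) = p ^ multiplicity p (card (cauts V ?R'))"
  proof (rule antisym)
    show "card (indu ?D' V) \<le> p ^ multiplicity p (card (cauts V ?R'))" unfolding indu_def
    proof (rule card_indu_le[OF D' fin_sub[OF V'(1)] permset_cauts[OF V'(1,2) R'V]])
      fix d assume d: "d \<in> ?D'"
      have "restrict (cj d) V \<in> auts V" using indu_auts[OF V'(1,2) D'n] d by (auto simp: indu_def)
      then show "restrict (cj d) V \<in> cauts V ?R'" using d R'V by (auto simp: auts_def cauts_def nrm_def cen_def subset_iff)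
    qed (use V' D' in \<open>auto simp: cj_comp sub_mem\<close>)
    have "card (cauts V ?R') = card (cauts V ?R1)" using card_cauts[OF aV(1) R1] aV fR by simp
    then have "p ^ multiplicity p (card (cauts V ?R')) = card Q" using Q by simp
    also have "\<dots> \<le> card (indu ?D' V)"
    proof (rule card_inj_on_le[of "tr V a"])
      have XU: "\<And>x. x \<in> Q \<Longrightarrow> x \<in> extensional V \<and> x ` V \<subseteq> V" using Q(1) by (auto simp: permset_def)
      show "inj_on (tr V a) Q" by (rule tr_inj[OF M_inj[OF aV(1)] XU])
      show "finite (indu ?D' V)" by (rule finite_indu[OF fin_sub[OF D']])
      show "tr V a ` Q \<subseteq> indu ?D' V"
      proof clarify
        fix x assume x: "x \<in> Q"
        obtain r where r: "r\<in>?D'" "\<forall>z\<in>V. a (x z) = cj r (a z)" using key[OF x] by blast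
        have "tr V a x = restrict (cj r) V"
        proof (rule extensionalityI[of _ V])
          fix z assume "z \<in> V"
          then obtain w where w: "w \<in> V" "z = a w" using aV by auto
          then show "tr V a x z = restrict (cj r) V z" using tr_apply[OF M_inj[OF aV(1)] w(1)] r aV by auto
        qed (use aV in \<open>auto simp: tr_def\<close>)
        then show "tr V a x \<in> indu ?D' V" using r by (auto simp: indu_def)
      qed
    qed
    finally show "p ^ multiplicity p (card (cauts V ?R')) \<le> card (indu ?D' V)" .
  qed
  have "\<exists>\<tau>. M (U <#> ?D) \<tau> \<and> (\<forall>x\<in>U. \<tau> x = f x)"
  proof (rule rec_ext_prod[OF V'(4) f D Dn])
    fix d assume d: "d \<in> ?D"
    obtain s where s: "s \<in> Q" "\<forall>x\<in>U. y (e (cj d x)) = s (y (e x))" using y(2)[OF d] by blast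
    obtain r where r: "r \<in> ?D'" "\<forall>x\<in>V. a (s x) = cj r (a x)" using key[OF s(1)] by blast
    have "f (cj d x) = cj r (f x)" if x: "x \<in> U" for x
    proof -
      have "y (e x) \<in> V" using x ye by auto
      then show ?thesis using s(2) r(2) x by (simp add: f_def)
    qed
    then show "\<exists>r\<in>nrm T V. \<forall>x\<in>U. f (cj d x) = cj r (f x)" using r(1) D'n by blast
  qed
  then obtain \<tau> where \<tau>: "M (U <#> ?D) \<tau>" "\<forall>x\<in>U. \<tau> x = f x" by blast
  have "\<tau> ` U = V" "\<tau> ` R = ?R'" using \<tau> f R by (auto simp: subset_iff image_iff)
  then show ?thesis using \<tau> card by auto
qed

lemma subgroup_Nf:
  assumes f: "M S f"
  shows "subgroup (Nf S f) G" "S \<subseteq> Nf S f" "Nf S f \<subseteq> nrm T S"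
proof -
  have S: "subgroup S G" "S \<subseteq> T" using M_dom[OF f] by auto
  have R: "subgroup (f ` S) G" "f ` S \<subseteq> T" using M_img[OF f] M_imgT[OF f] by auto
  show sub: "Nf S f \<subseteq> nrm T S" by (auto simp: Nf_def)
  have car: "g \<in> carrier G" if "g \<in> nrm T U" for g U using that nrm_sub T_car by blast
  show "S \<subseteq> Nf S f"
    using self_nrm[OF T_sub S] M_cj_eq[OF f] self_nrm[OF T_sub R] by (fastforce simp: Nf_def)
  then have ne: "Nf S f \<noteq> {}" using subgroup.one_closed[OF S(1)] by auto
  show "subgroup (Nf S f) G"
  proof (rule subgroupI[OF _ ne])
    show "Nf S f \<subseteq> carrier G" using sub car by blast
  next
    fix g assume "g \<in> Nf S f"
    then obtain r where g: "g \<in> nrm T S" "r \<in> nrm T (f ` S)" "\<forall>x\<in>S. f (cj g x) = cj r (f x)" by (auto simp: Nf_def)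
    have gi: "inv g \<in> nrm T S" "inv r \<in> nrm T (f ` S)" using g subgroup.m_inv_closed nrmT_sub S R by metis+
    have "f (cj (inv g) x) = cj (inv r) (f x)" if x: "x \<in> S" for x
    proof -
      let ?y = "cj (inv g) x"
      have y: "?y \<in> S" using nrmD[OF gi(1) x] .
      have "cj g ?y = x" using x S car[OF g(1)] sub_mem by simp
      then have "f x = cj r (f ?y)" using g(3) y by auto
      then show ?thesis using car[OF g(2)] M_fcar[OF f y] by simp
    qed
    then show "inv g \<in> Nf S f" using gi by (auto simp: Nf_def)
  next
    fix g h assume "g \<in> Nf S f" "h \<in> Nf S f"
    then obtain r s where g: "g \<in> nrm T S" "r \<in> nrm T (f ` S)" "\<forall>x\<in>S. f (cj g x) = cj r (f x)"
      "h \<in> nrm T S" "s \<in> nrm T (f ` S)" "\<forall>x\<in>S. f (cj h x) = cj s (f x)" by (auto simp: Nf_def)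
    have "g \<otimes> h \<in> nrm T S" "r \<otimes> s \<in> nrm T (f ` S)" using g subgroup.m_closed nrmT_sub S R by metis+
    moreover have "f (cj (g \<otimes> h) x) = cj (r \<otimes> s) (f x)" if "x \<in> S" for x
      using that g nrmD[OF g(1) that] car S M_fcar[OF f that] by (simp add: cj_comp sub_mem)
    ultimately show "g \<otimes> h \<in> Nf S f" by (auto simp: Nf_def)
  qed
qed

text \<open>Two elements of D act alike on W exactly when they lie in the same coset of the
  centralizer.\<close>

lemma card_indu:
  assumes D: "subgroup D G" and W: "subgroup W G"
  shows "card (indu D W) * card (cen D W) = card D"
proof -
  let ?f = "\<lambda>g. restrict (cj g) W"
  have fD: "finite D" using D fin_sub by blast
  have fib: "card {g \<in> D. ?f g = y} = card (cen D W)" if y: "y \<in> ?f ` D" for y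
  proof -
    obtain d where d: "d \<in> D" "y = ?f d" using y by auto
    have dc: "d \<in> carrier G" using d D sub_mem by blast
    have "bij_betw (\<lambda>c. c \<otimes> d) (cen D W) {g \<in> D. ?f g = y}"
    proof (rule bij_betw_byWitness[where f' = "\<lambda>g. g \<otimes> inv d"])
      show "\<forall>c\<in>cen D W. c \<otimes> d \<otimes> inv d = c" using dc D cen_sub sub_mem by (auto simp: m_assoc cen_def)
      show "\<forall>g\<in>{g \<in> D. ?f g = y}. g \<otimes> inv d \<otimes> d = g" using dc D sub_mem by (auto simp: m_assoc)
      show "(\<lambda>c. c \<otimes> d) ` cen D W \<subseteq> {g \<in> D. ?f g = y}"
        using d dc D W by (auto simp: cen_def subgroup.m_closed restrict_def fun_eq_iff cj_comp sub_mem)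
      show "(\<lambda>g. g \<otimes> inv d) ` {g \<in> D. ?f g = y} \<subseteq> cen D W"
      proof (rule image_subsetI)
        fix g assume "g \<in> {g \<in> D. ?f g = y}"
        then have g: "g \<in> D" "?f g = y" by auto
        have "cj (g \<otimes> inv d) x = x" if x: "x \<in> W" for x
        proof -
          have "cj g x = cj d x" using g(2) d(2) x by (metis restrict_apply')
          then show ?thesis using g d dc x D W sub_mem by (simp add: cj_comp)
        qed
        then show "g \<otimes> inv d \<in> cen D W" using g d D by (auto simp: cen_def subgroup.m_closed subgroup.m_inv_closed)
      qed
    qed
    then show ?thesis by (rule bij_betw_same_card[symmetric])
  qed
  have "card D = (\<Sum>g\<in>D. 1)" by simp
  also have "\<dots> = (\<Sum>y\<in>?f ` D. \<Sum>g\<in>{g \<in> D. ?f g = y}. 1)" by (rule sum.image_gen[OF fD])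
  also have "\<dots> = (\<Sum>y\<in>?f ` D. card (cen D W))" using fib by (intro sum.cong) auto
  finally show ?thesis by (simp add: indu_def)
qed

end

section \<open>Saturation from the centric subgroups\<close>

text \<open>\<open>repr\<close> holds of well-chosen members of the conjugacy classes, and \<open>centric\<close> of the subgroups that generate the
  system in the sense of the induction rule \<open>gen\<close>: a morphism of any other subgroup is a composite of
  restrictions of morphisms of strictly larger subgroups.\<close>

locale centric_generated = fsys +
  fixes repr centric :: "'a set \<Rightarrow> bool"
  assumes R_rep: "subgroup U G \<Longrightarrow> U \<subseteq> T \<Longrightarrow> \<exists>e. M (nrm T U) e \<and> repr (e ` U)"
    and R_dom: "repr R \<Longrightarrow> subgroup R G \<and> R \<subseteq> T"
    and R_fa: "repr R \<Longrightarrow> fa R"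
    and R_rec: "repr R \<Longrightarrow> centric R \<Longrightarrow> rec R"
    and centric_iso: "M U f \<Longrightarrow> centric U \<Longrightarrow> centric (f ` U)"
    and R_UC: "repr R \<Longrightarrow> nice (R <#> cen T R)"
    and R_max: "repr R \<Longrightarrow> M S f \<Longrightarrow> f ` S = R \<Longrightarrow> card (nrm T S) \<le> card (nrm T R) \<and> card (cen T S) \<le> card (cen T R)"
    and gen: "\<lbrakk>M U f; \<not> centric U; \<And>U f V. \<lbrakk>M V f; subgroup U G; U \<subset> V\<rbrakk> \<Longrightarrow> P U f;
       \<And>U f g. \<lbrakk>M U f; P U f; M (f ` U) g; P (f ` U) g\<rbrakk> \<Longrightarrow> P U (\<lambda>x. g (f x));
       \<And>U f g. \<lbrakk>P U f; M U f; \<And>x. x \<in> U \<Longrightarrow> f x = g x\<rbrakk> \<Longrightarrow> P U g\<rbrakk> \<Longrightarrow> P U f"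
begin

text \<open>By downward induction on \<open>U\<close>: \<open>k\<close> is factored through representatives of the class of \<open>U\<close>. There it can be
  modified by an automorphism fixing \<open>R1\<close> pointwise, which does not affect its restriction to \<open>R1\<close>, so
  that it extends to a larger subgroup.\<close>

lemma extends_to_UC:
  assumes IH: "\<And>V. repr V \<Longrightarrow> card V > n \<Longrightarrow> rec V"
  shows "\<lbrakk>repr R1; repr R2; M U k; R1 \<subseteq> U; U \<subseteq> nrm T R1; k ` R1 = R2; card U > n; n = card R1\<rbrakk>
    \<Longrightarrow> \<exists>h. M (R1 <#> cen T R1) h \<and> (\<forall>x\<in>R1. h x = k x)"
proof (induction "card T - card U" arbitrary: R1 R2 U k rule: less_induct)
  case less
  note R1 = less.prems(1) and R2 = less.prems(2) and k = less.prems(3)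
  have U: "subgroup U G" "U \<subseteq> T" using k M_dom by auto
  have R1s: "subgroup R1 G" "R1 \<subseteq> T" and R2s: "subgroup R2 G" "R2 \<subseteq> T" using R1 R2 R_dom by auto
  let ?U2 = "k ` U"
  have U2: "subgroup ?U2 G" "?U2 \<subseteq> T" using M_img[OF k] M_imgT[OF k] by auto
  have kR1: "M R1 k" by (rule M_restrict[OF k R1s(1) less.prems(4)])
  show ?case
  proof (cases "cen T R1 \<subseteq> U")
    case True
    have "M (R1 <#> cen T R1) k"
      by (rule M_restrict[OF k UC_sub[OF R1s(1)] prod_least[OF U(1) less.prems(4) True]])
    then show ?thesis by blast
  next
    case False
    \<comment> \<open>The induction is on the size of the intermediate group: a morphism given on a
      group larger than U, between representatives of the same order, already extends.\<close>
    have IH2: "\<exists>h. M (A <#> cen T A) h \<and> (\<forall>x\<in>A. h x = g x)"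
      if "repr A" "repr B" "M V g" "A \<subseteq> V" "V \<subseteq> nrm T A" "g ` A = B" "card V > card U" "card A = card R1" for A B V g
    proof (rule less.hyps[OF _ that(1-6)])
      have "card V \<le> card T" by (rule card_mono[OF fin_sub[OF T_sub] conjunct2[OF M_dom[OF that(3)]]])
      then show "card T - card V < card T - card U" using that(7) by simp
    qed (use that less.prems in auto)
    have U2n: "?U2 \<subseteq> nrm T R2" using M_nrm_img[OF k R1s(1) less.prems(4) subset_refl less.prems(5)] less.prems(6) by simp
    have R2U2: "R2 \<subseteq> ?U2" using less.prems by auto
    \<comment> \<open>By \<open>R_max\<close> the centralizer of R1 is no larger than that of R2. If
      \<open>?U2\<close> contained the latter, its preimage under k would be all of C_T(R1) and
      would lie in U.\<close>
    have False2: "\<not> cen T R2 \<subseteq> ?U2"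
    proof
      assume sub: "cen T R2 \<subseteq> ?U2"
      let ?k' = "inv_into U k"
      have k': "M ?U2 ?k'" by (rule M_inv_into[OF k])
      have k'R: "?k' ` R2 = R1" using inv_img[OF k less.prems(4)] less.prems(6) by simp
      have "?k' ` cen T R2 \<subseteq> cen T R1"
      proof (rule image_subsetI)
        fix x assume x: "x \<in> cen T R2"
        show "?k' x \<in> cen T R1" using M_cen[OF k' R2U2 subsetD[OF sub x] x] k'R by simp
      qed
      moreover have "card (?k' ` cen T R2) = card (cen T R2)" using M_card[OF k' sub] .
      moreover have "card (cen T R1) \<le> card (cen T R2)" using R_max[OF R2 kR1 less.prems(6)] by simp
      ultimately have "?k' ` cen T R2 = cen T R1" using card_seteq[OF fin_sub[OF cenT_sub[OF R1s(1)]]] by metis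
      moreover have "?k' ` cen T R2 \<subseteq> U" using image_mono[OF sub, of ?k'] inv_img[OF k subset_refl] by simp
      ultimately show False using False by simp
    qed
    \<comment> \<open>Applied to R1 in U and to R2 in k(U). V goes to a representative where T
      induces a Sylow subgroup of the automorphisms fixing the image of A, by a map defined on more
      than V; \<omega> then returns the image of A to a representative, so that \<open>IH2\<close>
      becomes applicable.\<close>
    have step: "\<exists>\<tau> \<omega>. M (V <#> nrm (cen T A) V) \<tau> \<and> repr (\<tau> ` V) \<and> nice (\<tau> ` V) \<and>
        card (indu (nrm (cen T (\<tau> ` A)) (\<tau> ` V)) (\<tau> ` V)) = p ^ multiplicity p (card (cauts (\<tau> ` V) (\<tau> ` A))) \<and>
        M (nrm T (\<tau> ` A)) \<omega> \<and> repr (\<omega> ` \<tau> ` A) \<and> subgroup (V <#> nrm (cen T A) V) G \<and>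
        V <#> nrm (cen T A) V \<subseteq> nrm T A \<and> card V < card (V <#> nrm (cen T A) V) \<and> V \<subseteq> V <#> nrm (cen T A) V"
      if A: "repr A" "A \<subseteq> V" and V: "subgroup V G" "V \<subseteq> nrm T A" "\<not> cen T A \<subseteq> V" "card V > n" for A V
    proof -
      have VT: "V \<subseteq> T" using V nrm_sub by blast
      have As: "subgroup A G" "A \<subseteq> T" using A R_dom by auto
      obtain e where e: "M (nrm T V) e" "repr (e ` V)" using R_rep[OF V(1) VT] by blast
      have eV: "M V e" by (rule M_restrict[OF e(1) V(1) self_nrm[OF T_sub V(1) VT]])
      have "card (e ` V) > n" using M_card[OF eV subset_refl] V by simp
      then have nV: "nice (e ` V)" using IH[OF e(2)] R_dom[OF e(2)] R_fa[OF e(2)] by (simp add: nice_def)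
      obtain \<tau> where \<tau>: "M (V <#> nrm (cen T A) V) \<tau>" "\<tau> ` V = e ` V"
        "card (indu (nrm (cen T (\<tau> ` A)) (e ` V)) (e ` V)) = p ^ multiplicity p (card (cauts (e ` V) (\<tau> ` A)))"
        using cauts_sylow_ext[OF nV eV refl As(1) A(2)] by blast
      have D: "subgroup (nrm (cen T A) V) G" by (rule subgroup_nrm[OF cenT_sub[OF As(1)] V(1)])
      have VW: "V \<subseteq> V <#> nrm (cen T A) V" by (rule prod_left[OF V(1) D])
      have Ws: "subgroup (V <#> nrm (cen T A) V) G" using M_dom[OF \<tau>(1)] by simp
      have \<tau>A: "subgroup (\<tau> ` A) G" "\<tau> ` A \<subseteq> T"
        using M_img_sub[OF \<tau>(1) As(1)] M_imgT[OF \<tau>(1)] A(2) VW by blast+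
      obtain \<omega> where \<omega>: "M (nrm T (\<tau> ` A)) \<omega>" "repr (\<omega> ` \<tau> ` A)" using R_rep[OF \<tau>A] by blast
      have Wn: "V <#> nrm (cen T A) V \<subseteq> nrm T A"
        by (rule prod_least[OF nrmT_sub[OF As(1)] V(2)]) (use nrm_sub cen_nrm in blast)
      \<comment> \<open>V normalizes C_T(A), and in the p-group \<open>cen T A <#> V\<close> the
        normalizer of V is larger than V. Removing the V-component of a new element leaves a new
        element of C_T(A).\<close>
      have "card V < card (V <#> nrm (cen T A) V)"
      proof (rule psubset_card_mono[OF fin_sub[OF Ws]])
        have c0: "subgroup (cen T A) G" by (rule cenT_sub[OF As(1)])
        have "V \<subseteq> nrm (carrier G) (cen T A)"
        proof
          fix v assume v: "v \<in> V"
          then have vT: "v \<in> T" "cj v ` A = A" using VT V(2) by (auto simp: nrm_def)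
          show "v \<in> nrm (carrier G) (cen T A)"
          proof (rule nrmI[OF T_car[OF vT(1)] subgroup_self c0])
            fix x assume x: "x \<in> cen T A"
            then have "x \<in> T" using cen_sub by blast
            then show "cj v x \<in> cen T A" using M_cen[OF M_conj[OF T_sub subset_refl vT(1)] As(2) _ x] vT by simp
          qed
        qed
        then have H: "subgroup (cen T A <#> V) G" by (rule subgroup_prod[OF c0 V(1)])
        have "V \<noteq> cen T A <#> V" using prod_left[OF c0 V(1)] V(3) by blast
        then obtain g where g: "g \<in> nrm (cen T A <#> V) V" "g \<notin> V"
          using normalizer_grows[OF H V(1) prod_right[OF c0 V(1)]] by blast
        then obtain c v where cv: "c \<in> cen T A" "v \<in> V" "g = c \<otimes> v" using nrm_sub by (fastforce simp: prod_mem)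
        have car: "c \<in> carrier G" "v \<in> carrier G" using cv c0 V sub_mem by auto
        have cg: "c = g \<otimes> inv v" using cv car by (simp add: m_assoc)
        have "inv v \<in> nrm (cen T A <#> V) V"
          using self_nrm[OF H V(1) prod_right[OF c0 V(1)]] subgroup.m_inv_closed[OF V(1) cv(2)] by blast
        then have "c \<in> nrm (cen T A <#> V) V" unfolding cg
          using subgroup.m_closed[OF subgroup_nrm[OF H V(1)] g(1)] by blast
        then have "c \<in> nrm (cen T A) V" using cv by (simp add: nrm_def)
        moreover have "c \<notin> V" using g(2) cv subgroup.m_closed[OF V(1)] by metis
        ultimately have "c \<in> V <#> nrm (cen T A) V" "c \<notin> V" using prod_right[OF V(1) D] by auto
        then show "V \<subset> V <#> nrm (cen T A) V" using VW by blast
      qed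
      then show ?thesis using \<tau> \<omega> nV e Ws Wn VW by auto
    qed
    define X1 where "X1 = U <#> nrm (cen T R1) U"
    define X2 where "X2 = ?U2 <#> nrm (cen T R2) ?U2"
    obtain t1 w1 where s1: "M X1 t1" "repr (t1 ` U)" "nice (t1 ` U)" "M (nrm T (t1 ` R1)) w1" "repr (w1 ` t1 ` R1)"
      "X1 \<subseteq> nrm T R1" "card U < card X1" "U \<subseteq> X1" "subgroup X1 G"
      unfolding X1_def using step[OF R1 less.prems(4) U(1) less.prems(5) False less.prems(7)] by blast
    have cU2: "card ?U2 = card U" by (rule M_card[OF k subset_refl])
    obtain t2 w2 where s2: "M X2 t2" "repr (t2 ` ?U2)" "nice (t2 ` ?U2)" "M (nrm T (t2 ` R2)) w2" "repr (w2 ` t2 ` R2)"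
      "X2 \<subseteq> nrm T R2" "card ?U2 < card X2" "?U2 \<subseteq> X2" "subgroup X2 G"
      "card (indu (nrm (cen T (t2 ` R2)) (t2 ` ?U2)) (t2 ` ?U2)) = p ^ multiplicity p (card (cauts (t2 ` ?U2) (t2 ` R2)))"
      unfolding X2_def using step[OF R2 R2U2 U2(1) U2n False2] less.prems(7) cU2 by metis
    define V1 where "V1 = t1 ` U"
    define V2 where "V2 = t2 ` ?U2"
    define A1 where "A1 = t1 ` R1"
    define A2 where "A2 = t2 ` R2"
    define B1 where "B1 = w1 ` A1"
    define B2 where "B2 = w2 ` A2"
    note defs = V1_def V2_def A1_def A2_def B1_def B2_def
    have R1X: "R1 \<subseteq> X1" and R2X: "R2 \<subseteq> X2" using less.prems(4) s1(8) s2(8) R2U2 by auto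
    have t1U: "M U t1" by (rule M_restrict[OF s1(1) U(1) s1(8)])
    have t2U: "M ?U2 t2" by (rule M_restrict[OF s2(1) U2(1) s2(8)])
    have V1: "subgroup V1 G" "V1 \<subseteq> T" and V2: "subgroup V2 G" "V2 \<subseteq> T" and recV2: "rec V2"
      using s1(3) s2(3) by (auto simp: nice_def V1_def V2_def)
    have A1V: "A1 \<subseteq> V1" and A2V: "A2 \<subseteq> V2" using less.prems(4) R2U2 by (auto simp: defs)
    have A1: "subgroup A1 G" "A1 \<subseteq> T" and A2: "subgroup A2 G" "A2 \<subseteq> T"
      using M_img_sub[OF t1U R1s(1) less.prems(4)] M_img_sub[OF t2U R2s(1) R2U2] A1V A2V V1 V2 by (auto simp: defs)
    define \<sigma> where "\<sigma> y = t2 (k (inv_into U t1 y))" for y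
    have \<sigma>t: "\<sigma> (t1 x) = t2 (k x)" if "x \<in> U" for x using that M_inj[OF t1U] by (simp add: \<sigma>_def)
    have \<sigma>: "M V1 \<sigma>" unfolding V1_def by (rule M_transport[OF t1U k t2U \<sigma>t])
    have \<sigma>V: "\<sigma> ` V1 = V2" unfolding V1_def V2_def image_image using \<sigma>t by (intro image_cong) auto
    have \<sigma>A: "\<sigma> ` A1 = A2" unfolding A1_def A2_def less.prems(6)[symmetric] image_image
      using \<sigma>t less.prems(4) by (intro image_cong) auto
    define D1 where "D1 = nrm (cen T A1) V1"
    define D2 where "D2 = nrm (cen T A2) V2"
    have D1: "subgroup D1 G" unfolding D1_def by (rule subgroup_nrm[OF cenT_sub[OF A1(1)] V1(1)])
    have D2: "subgroup D2 G" unfolding D2_def by (rule subgroup_nrm[OF cenT_sub[OF A2(1)] V2(1)])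
    have D1n: "D1 \<subseteq> nrm T V1" and D2n: "D2 \<subseteq> nrm T V2" using cen_sub by (auto simp: D1_def D2_def nrm_def)
    have D1c: "D1 \<subseteq> cen T A1" and D2c: "D2 \<subseteq> cen T A2" using nrm_sub by (auto simp: D1_def D2_def)
    have pc: "permset V2 (cauts V2 A2)" by (rule permset_cauts[OF V2 A2V])
    have icu: "indu D2 V2 \<subseteq> cauts V2 A2"
    proof
      fix f assume f: "f \<in> indu D2 V2"
      then have "f \<in> auts V2" using indu_auts[OF V2 D2n] by blast
      moreover have "f x = x" if x: "x \<in> A2" for x
      proof -
        obtain d where "d \<in> D2" "f = restrict (cj d) V2" using f by (auto simp: indu_def)
        moreover have "x \<in> V2" "cj d x = x" if "d \<in> D2" for d
          using that subsetD[OF D2c] x A2V by (auto simp: cen_def)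
        ultimately show ?thesis by simp
      qed
      ultimately show "f \<in> cauts V2 A2" by (simp add: auts_def cauts_def)
    qed
    \<comment> \<open>Correcting \<sigma> by an automorphism of V2 that fixes A2 pointwise changes
      nothing on A1 but lets D1 act through D2, so the corrected map extends over D1.\<close>
    have "\<exists>a\<in>cauts V2 A2. \<forall>d\<in>D1. \<exists>s\<in>indu D2 V2. \<forall>x\<in>V1. a (\<sigma> (cj d x)) = s (a (\<sigma> x))"
    proof (rule sylow_move[OF \<sigma> \<sigma>V D1 D1n pc permset_indu[OF D2 V2(1) D2n] icu])
      show "card (indu D2 V2) = p ^ multiplicity p (card (cauts V2 A2))" using s2(10) by (simp add: D2_def defs)
      fix d assume d: "d \<in> D1"
      have "tr V1 \<sigma> (cj d) y = y" if y: "y \<in> A2" for y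
      proof -
        obtain x where x: "x \<in> A1" "y = \<sigma> x" using y \<sigma>A by auto
        then have "cj d x = x" using d D1c by (auto simp: cen_def)
        then show ?thesis using x A1V tr_apply[OF M_inj[OF \<sigma>], of x "cj d"] by auto
      qed
      then show "tr V1 \<sigma> (cj d) \<in> cauts V2 A2" using tr_cj[OF \<sigma> subsetD[OF D1n d]] \<sigma>V by (simp add: cauts_def)
    qed
    then obtain c where c: "c\<in>cauts V2 A2"
      "\<And>d. d \<in> D1 \<Longrightarrow> \<exists>s\<in>indu D2 V2. \<forall>x\<in>V1. c (\<sigma> (cj d x)) = s (c (\<sigma> x))" by blast
    have cV: "M V2 c" "c ` V2 = V2" "\<And>x. x \<in> A2 \<Longrightarrow> c x = x" using c(1) by (auto simp: cauts_def)
    have c\<sigma>: "M V1 (\<lambda>x. c (\<sigma> x))" "(\<lambda>x. c (\<sigma> x)) ` V1 = V2"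
      using M_comp[OF \<sigma>, of c] image_image[of c \<sigma> V1] \<sigma>V cV(1,2) by simp_all
    have "\<exists>h. M (V1 <#> D1) h \<and> (\<forall>x\<in>V1. h x = c (\<sigma> x))"
    proof (rule rec_ext_prod[OF recV2 c\<sigma> D1 D1n])
      fix d assume d: "d \<in> D1"
      obtain s where s: "s\<in>indu D2 V2" "\<forall>x\<in>V1. c (\<sigma> (cj d x)) = s (c (\<sigma> x))" using c(2)[OF d] by blast
      then obtain r where r: "r \<in> D2" "s = restrict (cj r) V2" by (auto simp: indu_def)
      have "c (\<sigma> (cj d x)) = cj r (c (\<sigma> x))" if "x \<in> V1" for x using s(2) r(2) that c\<sigma>(2) by auto
      then show "\<exists>r\<in>nrm T V2. \<forall>x\<in>V1. c (\<sigma> (cj d x)) = cj r (c (\<sigma> x))" using r D2n by blast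
    qed
    then obtain kk where kk: "M (V1 <#> D1) kk" "\<And>x. x \<in> V1 \<Longrightarrow> kk x = c (\<sigma> x)" by blast
    define Y where "Y = V1 <#> D1"
    have Ys: "subgroup Y G" using M_dom[OF kk(1)] by (simp add: Y_def)
    have V1Y: "V1 \<subseteq> Y" and D1Y: "D1 \<subseteq> Y" unfolding Y_def by (rule prod_left[OF V1(1) D1], rule prod_right[OF V1(1) D1])
    have kkA: "kk x = \<sigma> x" if "x \<in> A1" for x using that A1V kk(2) cV(3) \<sigma>A by auto
    have kkA1: "kk ` A1 = A2" using kkA \<sigma>A by (metis (no_types, lifting) image_cong)
    have kkY: "M Y kk" using kk(1) by (simp add: Y_def)
    have t1X: "t1 ` X1 \<subseteq> nrm T A1" unfolding A1_def by (rule M_nrm_img[OF s1(1) R1s(1) R1X subset_refl s1(6)])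
    have t2X: "t2 ` X2 \<subseteq> nrm T A2" unfolding A2_def by (rule M_nrm_img[OF s2(1) R2s(1) R2X subset_refl s2(6)])
    have V1n: "V1 \<subseteq> nrm T A1" using t1X s1(8) by (auto simp: V1_def)
    have Yn: "Y \<subseteq> nrm T A1" unfolding Y_def
      by (rule prod_least[OF nrmT_sub[OF A1(1)] V1n]) (use D1c cen_nrm in blast)
    have A1Y: "A1 \<subseteq> Y" using A1V V1Y by blast
    have kkYn: "kk ` Y \<subseteq> nrm T A2" using M_nrm_img[OF kkY A1(1) A1Y subset_refl Yn] kkA1 by simp
    have w1A: "M (nrm T A1) w1" and w2A: "M (nrm T A2) w2" using s1(4) s2(4) by (auto simp: defs)
    have w1Y: "M Y w1" by (rule M_restrict[OF w1A Ys Yn])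
    have B1: "repr B1" and B2: "repr B2" using s1(5) s2(5) by (auto simp: defs)
    have cardA: "card B1 = card R1" "card B2 = card R1"
      using M_card[OF w1A self_nrm[OF T_sub A1]] M_card[OF w2A self_nrm[OF T_sub A2]]
        M_card[OF s1(1) R1X] M_card[OF s2(1) R2X] M_card[OF k less.prems(4)] less.prems(6) by (auto simp: B1_def B2_def A1_def A2_def)
    \<comment> \<open>On R1 the map k is a composite of three maps, each given on a group larger
      than U: to B1 along t1 and w1, from B1 to B2 along kk, and back to R2 by the inverse of G2.
      Each extends by \<open>IH2\<close> to the product with the centralizer, and
      \<open>M_UC\<close> makes these products match.\<close>
    have g1: "M X1 (\<lambda>x. w1 (t1 x))" by (rule M_comp_sub[OF s1(1) w1A t1X])
    have "(\<lambda>x. w1 (t1 x)) ` R1 = B1" by (simp add: B1_def A1_def image_image)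
    from IH2[OF R1 B1 g1 R1X s1(6) this s1(7)]
    obtain ha where ha: "M (R1 <#> cen T R1) ha" "\<And>x. x \<in> R1 \<Longrightarrow> ha x = w1 (t1 x)" by auto
    define g2 where "g2 y = w2 (kk (inv_into Y w1 y))" for y
    have g2w: "g2 (w1 x) = w2 (kk x)" if "x \<in> Y" for x using that M_inj[OF w1Y] by (simp add: g2_def)
    have "M (w1 ` Y) g2"
      by (rule M_transport[OF w1Y kkY M_restrict[OF w2A M_img[OF kkY] kkYn] g2w])
    moreover have "B1 \<subseteq> w1 ` Y" using A1Y by (auto simp: B1_def)
    moreover have "w1 ` Y \<subseteq> nrm T B1" unfolding B1_def
      by (rule M_nrm_img[OF w1A A1(1) self_nrm[OF T_sub A1] Yn Yn])
    moreover have "g2 ` B1 = B2" unfolding B1_def B2_def kkA1[symmetric] image_image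
      using g2w A1Y by (intro image_cong) auto
    \<comment> \<open>Under t1 the elements of C_T(R1) normalizing U go into D1, so Y contains the
      image of X1, which is larger than U.\<close>
    moreover have "card U < card (w1 ` Y)"
    proof -
      have "t1 ` X1 \<subseteq> Y"
      proof clarify
        fix x assume "x \<in> X1"
        then obtain u d where ud: "u \<in> U" "d \<in> nrm (cen T R1) U" "x = u \<otimes> d" by (auto simp: X1_def prod_mem)
        have sD: "subgroup (nrm (cen T R1) U) G" by (rule subgroup_nrm[OF cenT_sub[OF R1s(1)] U(1)])
        have dX: "d \<in> X1" "u \<in> X1" using ud prod_right[OF U(1) sD] s1(8) by (auto simp: X1_def)
        have "t1 d \<in> nrm T V1" unfolding V1_def by (rule M_nrm[OF s1(1) U(1) s1(8) dX(1) ud(2)])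
        moreover have "t1 d \<in> cen T A1" unfolding A1_def
          by (rule M_cen[OF s1(1) R1X dX(1)]) (use ud nrm_sub in blast)
        ultimately have "t1 d \<in> D1" by (simp add: D1_def nrm_def)
        then have "t1 u \<otimes> t1 d \<in> Y" using ud V1Y D1Y subgroup.m_closed[OF Ys] by (auto simp: V1_def)
        then show "t1 x \<in> Y" using M_mult[OF s1(1) dX(2,1)] ud by simp
      qed
      then have "card (t1 ` X1) \<le> card Y" using fin_sub[OF Ys] card_mono by blast
      then show ?thesis using M_card[OF s1(1) subset_refl] M_card[OF w1Y subset_refl] s1(7) by simp
    qed
    ultimately obtain hb where hb: "M (B1 <#> cen T B1) hb" "\<And>x. x \<in> B1 \<Longrightarrow> hb x = g2 x"
      using IH2[OF B1 B2, of "w1 ` Y" g2] cardA by auto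
    define G2 where "G2 x = w2 (t2 x)" for x
    have G2: "M X2 G2" unfolding G2_def by (rule M_comp_sub[OF s2(1) w2A t2X])
    have G2R: "G2 ` R2 = B2" by (simp add: G2_def B2_def A2_def image_image)
    have G2X: "G2 ` X2 \<subseteq> nrm T B2" using M_nrm_img[OF G2 R2s(1) R2X subset_refl s2(6)] G2R by simp
    have "\<exists>h. M (B2 <#> cen T B2) h \<and> (\<forall>x\<in>B2. h x = inv_into X2 G2 x)"
    proof (rule IH2[OF B2 R2 M_inv_into[OF G2] _ G2X])
      show "B2 \<subseteq> G2 ` X2" using G2R R2X by blast
      show "inv_into X2 G2 ` B2 = R2" using inv_img[OF G2 R2X] G2R by simp
      show "card U < card (G2 ` X2)" using M_card[OF G2 subset_refl] s2(7) cU2 by simp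
    qed (use cardA in auto)
    then obtain hc where hc: "M (B2 <#> cen T B2) hc" "\<And>x. x \<in> B2 \<Longrightarrow> hc x = inv_into X2 G2 x" by blast
    have haR: "ha ` R1 = B1" using ha(2) unfolding B1_def A1_def image_image by (intro image_cong) auto
    have hbR: "hb ` B1 = B2" using hb(2) \<open>g2 ` B1 = B2\<close> by (metis (no_types, lifting) image_cong)
    have "M (R1 <#> cen T R1) (\<lambda>x. hb (ha x))"
      by (rule M_comp_sub[OF ha(1) hb(1)]) (use M_UC[OF ha(1) R1s(1)] haR in simp)
    moreover have "(\<lambda>x. hb (ha x)) ` (R1 <#> cen T R1) \<subseteq> B2 <#> cen T B2"
      using M_UC[OF ha(1) R1s(1)] M_UC[OF hb(1)] haR hbR R_dom[OF B1] by auto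
    ultimately have "M (R1 <#> cen T R1) (\<lambda>x. hc (hb (ha x)))" by (rule M_comp_sub[OF _ hc(1)])
    moreover have "hc (hb (ha x)) = k x" if x: "x \<in> R1" for x
    proof -
      have tx: "t1 x \<in> A1" using x by (auto simp: A1_def)
      have "hb (ha x) = g2 (w1 (t1 x))" using ha(2)[OF x] hb(2) tx by (auto simp: B1_def)
      also have "\<dots> = w2 (\<sigma> (t1 x))" using g2w kkA tx A1Y by auto
      also have "\<dots> = G2 (k x)" using \<sigma>t x less.prems(4) by (auto simp: G2_def)
      finally have e: "hb (ha x) = G2 (k x)" .
      have kx: "k x \<in> R2" using x less.prems(6) by auto
      then have "G2 (k x) \<in> B2" using G2R by auto
      then show ?thesis using e hc(2) kx R2X M_inj[OF G2] by auto
    qed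
    ultimately show ?thesis by blast
  qed
qed

text \<open>By \<open>gen\<close> a morphism of a non-centric S is a composite of restrictions from
  larger domains, and \<open>extends_to_UC\<close> treats the restrictions. The property P
  quantifies over all maps l1 and l2 to representatives, so that a common one can be chosen in the
  middle of a composite.\<close>

lemma isos_extend_to_UC:
  assumes IH: "\<And>V. repr V \<Longrightarrow> card V > n \<Longrightarrow> rec V"
    and f: "M S f" "\<not> centric S" "card S = n"
    and l1: "M (nrm T S) l1" "repr (l1 ` S)" and l2: "M (nrm T (f ` S)) l2" "repr (l2 ` f ` S)"
  shows "\<exists>h. M (l1 ` S <#> cen T (l1 ` S)) h \<and> (\<forall>x\<in>S. h (l1 x) = l2 (f x))"
proof -
  define P where "P S f \<longleftrightarrow> (card S = n \<longrightarrow> (\<forall>l1 l2. M (nrm T S) l1 \<longrightarrow> repr (l1 ` S) \<longrightarrow> M (nrm T (f ` S)) l2 \<longrightarrow> repr (l2 ` f ` S) \<longrightarrow>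
    (\<exists>h. M (l1 ` S <#> cen T (l1 ` S)) h \<and> (\<forall>x\<in>S. h (l1 x) = l2 (f x)))))" for S f
  have "P S f"
  proof (rule gen[OF f(1,2)])
    fix S f V assume f: "M V f" and S: "subgroup S G" "S \<subset> V"
    show "P S f" unfolding P_def
    proof (intro impI allI)
      fix l1 l2 assume n: "card S = n" and l1: "M (nrm T S) l1" "repr (l1 ` S)" and l2: "M (nrm T (f ` S)) l2" "repr (l2 ` f ` S)"
      have V: "subgroup V G" "V \<subseteq> T" using M_dom[OF f] by auto
      have ST: "S \<subseteq> T" and SV: "S \<subseteq> V" using S V by auto
      note SN = self_nrm[OF T_sub S(1) ST]
      \<comment> \<open>N_V(S) instead of V: it is still larger than S, lies in the domain of l1,
        and its image under f lies in the domain of l2.\<close>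
      define U where "U = nrm V S"
      have U: "subgroup U G" unfolding U_def by (rule subgroup_nrm[OF V(1) S(1)])
      have UV: "U \<subseteq> V" unfolding U_def by (rule nrm_sub)
      have Un: "U \<subseteq> nrm T S" using V by (auto simp: U_def nrm_def)
      have SU: "S \<subset> U" using normalizer_grows[OF V(1) S(1) SV] self_nrm[OF V(1) S(1) SV] S by (auto simp: U_def)
      have fU: "M U f" by (rule M_restrict[OF f U UV])
      have l1U: "M U l1" by (rule M_restrict[OF l1(1) U Un])
      have fUn: "f ` U \<subseteq> nrm T (f ` S)" by (rule M_nrm_img[OF fU S(1) _ subset_refl Un]) (use SU in blast)
      have l2U: "M (f ` U) l2" by (rule M_restrict[OF l2(1) M_img[OF fU] fUn])
      define k where "k y = l2 (f (inv_into U l1 y))" for y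
      have kl: "k (l1 x) = l2 (f x)" if "x \<in> U" for x using that M_inj[OF l1U] by (simp add: k_def)
      have k: "M (l1 ` U) k" by (rule M_transport[OF l1U fU l2U kl])
      have "\<exists>h. M (l1 ` S <#> cen T (l1 ` S)) h \<and> (\<forall>x\<in>l1 ` S. h x = k x)"
      proof (rule extends_to_UC[OF IH l1(2) l2(2) k])
        show "l1 ` S \<subseteq> l1 ` U" using SU by blast
        show "l1 ` U \<subseteq> nrm T (l1 ` S)" by (rule M_nrm_img[OF l1(1) S(1) SN Un Un])
        show "k ` l1 ` S = l2 ` f ` S" unfolding image_image using kl SU by (intro image_cong) auto
        show "n < card (l1 ` U)" using M_card[OF l1U subset_refl] psubset_card_mono[OF fin_sub[OF U] SU] n by simp
        show "n = card (l1 ` S)" using M_card[OF l1(1) SN] n by simp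
      qed
      then obtain h where h: "M (l1 ` S <#> cen T (l1 ` S)) h" "\<forall>x\<in>l1 ` S. h x = k x" by blast
      have "h (l1 x) = l2 (f x)" if "x \<in> S" for x using that h(2) kl[of x] SU by auto
      then show "\<exists>h. M (l1 ` S <#> cen T (l1 ` S)) h \<and> (\<forall>x\<in>S. h (l1 x) = l2 (f x))" using h(1) by blast
    qed
  next
    fix S f g assume f: "M S f" "P S f" and g: "M (f ` S) g" "P (f ` S) g"
    show "P S (\<lambda>x. g (f x))" unfolding P_def
    proof (intro impI allI)
      fix l1 l2 assume n: "card S = n" and l1: "M (nrm T S) l1" "repr (l1 ` S)"
        and l2: "M (nrm T ((\<lambda>x. g (f x)) ` S)) l2" "repr (l2 ` (\<lambda>x. g (f x)) ` S)"
      have eq: "(\<lambda>x. g (f x)) ` S = g ` f ` S" by (simp add: image_image)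
      obtain l where l: "M (nrm T (f ` S)) l" "repr (l ` f ` S)" using R_rep[OF M_img[OF f(1)] M_imgT[OF f(1)]] by blast
      have n2: "card (f ` S) = n" using n M_card[OF f(1) subset_refl] by simp
      obtain h1 where h1: "M (l1 ` S <#> cen T (l1 ` S)) h1" "\<forall>x\<in>S. h1 (l1 x) = l (f x)"
        using f(2) n l1 l unfolding P_def by blast
      obtain h2 where h2: "M (l ` f ` S <#> cen T (l ` f ` S)) h2" "\<forall>x\<in>f ` S. h2 (l x) = l2 (g x)"
        using g(2) n2 l l2 unfolding P_def eq by blast
      have "h1 ` l1 ` S = l ` f ` S" unfolding image_image using h1(2) by (intro image_cong) auto
      then have "h1 ` (l1 ` S <#> cen T (l1 ` S)) \<subseteq> l ` f ` S <#> cen T (l ` f ` S)"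
        using M_UC[OF h1(1)] R_dom[OF l1(2)] by simp
      then have "M (l1 ` S <#> cen T (l1 ` S)) (\<lambda>x. h2 (h1 x))" by (rule M_comp_sub[OF h1(1) h2(1)])
      then show "\<exists>h. M (l1 ` S <#> cen T (l1 ` S)) h \<and> (\<forall>x\<in>S. h (l1 x) = l2 (g (f x)))"
        using h1(2) h2(2) by (intro exI[of _ "\<lambda>x. h2 (h1 x)"]) simp
    qed
  next
    fix S f g assume f: "P S f" "M S f" and eq: "\<And>x. x \<in> S \<Longrightarrow> f x = g x"
    have "f ` S = g ` S" using eq by (intro image_cong) auto
    then show "P S g" using f(1) eq unfolding P_def by simp
  qed
  then show ?thesis using assms unfolding P_def by blast
qed

text \<open>For non-centric R the isomorphism first extends to products with centralizers, giving h
  from W0 onto W, and W is receptive. It remains to make N0 act on W through N_T(R). A Sylow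
  argument among the automorphisms of W that act on R like elements of N_T(R) does this, up to
  conjugation by an n in N_T(R) that is undone at the end.\<close>

theorem repr_receptive: "repr R \<Longrightarrow> rec R"
proof (induction "card T - card R" arbitrary: R rule: less_induct)
  case less
  note R = less.prems
  have Rs: "subgroup R G" "R \<subseteq> T" using R_dom[OF R] by auto
  have IH: "rec V" if "repr V" "card V > card R" for V
  proof (rule less.hyps[OF _ that(1)])
    have "card V \<le> card T" by (rule card_mono[OF fin_sub[OF T_sub]]) (use R_dom[OF that(1)] in blast)
    then show "card T - card V < card T - card R" using that(2) by simp
  qed
  show ?case
  proof (cases "centric R")
    case True then show ?thesis using R_rec R by blast
  next
    case False
    show ?thesis unfolding rec_def
    proof (intro allI impI, elim conjE)
      fix S f assume f: "M S f" "f ` S = R"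
      have S: "subgroup S G" "S \<subseteq> T" using M_dom[OF f(1)] by auto
      note SN = self_nrm[OF T_sub S]
      have RN: "R \<subseteq> nrm T R" by (rule self_nrm[OF T_sub Rs])
      have idN: "M (nrm T R) (\<lambda>x. x)" by (rule M_id[OF nrmT_sub[OF Rs(1)] nrm_sub])
      have nS: "card S = card R" using M_card[OF f(1) subset_refl] f(2) by simp
      let ?f' = "inv_into S f"
      have f': "M R ?f'" "?f' ` R = S" using M_inv_into[OF f(1)] inv_img[OF f(1) subset_refl] f(2) by auto
      obtain l where l: "M (nrm T S) l" "repr (l ` S)" using R_rep[OF S] by blast
      have NCS: "\<not> centric S" using centric_iso[OF f(1)] f(2) False by auto
      define A where "A = l ` S"
      have A: "subgroup A G" "A \<subseteq> T" and RA: "repr A" using R_dom[OF l(2)] l(2) by (auto simp: A_def)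
      define W0 where "W0 = A <#> cen T A"
      define W where "W = R <#> cen T R"
      have W0: "subgroup W0 G" "W0 \<subseteq> T" unfolding W0_def by (rule UC_sub[OF A(1)], rule UC_T[OF A(2)])
      have W: "subgroup W G" "W \<subseteq> T" unfolding W_def by (rule UC_sub[OF Rs(1)], rule UC_T[OF Rs(2)])
      have AW: "A \<subseteq> W0" and RW: "R \<subseteq> W" unfolding W0_def W_def by (rule UC_left[OF A(1)], rule UC_left[OF Rs(1)])
      obtain h where h: "M W0 h" "\<And>x. x \<in> S \<Longrightarrow> h (l x) = f x"
        using isos_extend_to_UC[OF IH f(1) NCS nS l, of "\<lambda>x. x"] idN R f(2) unfolding W0_def A_def by auto
      \<comment> \<open>A map in the opposite direction, needed only to compare orders and conclude
        that h is onto W.\<close>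
      obtain h' where h': "M W h'" "\<And>x. x \<in> R \<Longrightarrow> h' x = l (?f' x)"
        using isos_extend_to_UC[OF IH f'(1) False refl idN _ , of l] R l f'(2) unfolding W_def by auto
      have hA: "h ` A = R" unfolding A_def image_image f(2)[symmetric] using h(2) by (intro image_cong) auto
      have h'R: "h' ` R = A" 
      proof -
        have "h' ` R = l ` ?f' ` R" unfolding image_image using h'(2) by (intro image_cong) auto
        then show ?thesis using f'(2) by (simp add: A_def)
      qed
      have hsub: "h ` W0 \<subseteq> W" using M_UC[of A h] h(1) A(1) hA unfolding W0_def W_def by simp
      have h'sub: "h' ` W \<subseteq> W0" using M_UC[of R h'] h'(1) Rs(1) h'R unfolding W0_def W_def by simp
      have "card W \<le> card W0" using card_mono[OF fin_sub[OF W0(1)] h'sub] M_card[OF h'(1) subset_refl] by simp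
      then have hW: "h ` W0 = W" using M_card[OF h(1) subset_refl] by (intro card_seteq[OF fin_sub[OF W(1)] hsub]) simp
      have nW: "nice W" unfolding W_def by (rule R_UC[OF R])
      have faW: "fa W" and recW: "rec W" using nW by (auto simp: nice_def)
      have NW: "nrm T R \<subseteq> nrm T W" unfolding W_def by (rule nrm_nrm_UC[OF Rs])
      have NA: "nrm T A \<subseteq> nrm T W0" unfolding W0_def by (rule nrm_nrm_UC[OF A])
      have hAM: "M A h" by (rule M_restrict[OF h(1) A(1) AW])
      define N0 where "N0 = Nf A h"
      have N0: "subgroup N0 G" "A \<subseteq> N0" "N0 \<subseteq> nrm T A" unfolding N0_def by (rule subgroup_Nf[OF hAM])+
      have N0W: "N0 \<subseteq> nrm T W0" using N0 NA by blast
      \<comment> \<open>By the definition of \<open>Nf\<close>, conjugations by elements of N0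
        become maps of this kind when transported along h.\<close>
      define Q where "Q a \<longleftrightarrow> M W a \<and> a ` W = W \<and> (\<exists>n\<in>nrm T R. \<forall>x\<in>R. a x = cj n x)" for a
      define AA where "AA = {a \<in> extensional W. Q a}"
      have nrmR: "subgroup (nrm T R) G" by (rule nrmT_sub[OF Rs(1)])
      have ncar: "n \<in> carrier G" if "n \<in> nrm T R" for n using that sub_mem[OF nrmR] by blast
      have Rcar: "x \<in> carrier G" if "x \<in> R" for x using that sub_mem[OF Rs(1)] by blast
      have QR: "a ` R = R" if "Q a" for a
      proof -
        obtain n where n: "n\<in>nrm T R" "\<forall>x\<in>R. a x = cj n x" using \<open>Q a\<close> by (auto simp: Q_def)
        then have "a ` R = cj n ` R" by (intro image_cong) auto
        then show ?thesis using n by (simp add: nrm_def)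
      qed
      have pAA: "permset W AA" unfolding AA_def
      proof (rule permset_sel[OF W])
        fix a b assume Qa: "Q a" and eq: "\<And>x. x \<in> W \<Longrightarrow> a x = b x"
        have "a ` W = b ` W" using eq by (intro image_cong) auto
        moreover have "M W b" using Qa M_cong[of W a b] eq by (simp add: Q_def)
        moreover have "\<forall>x\<in>R. a x = b x" using eq RW by blast
        ultimately show "Q b" using Qa unfolding Q_def by simp
      next
        show "Q (\<lambda>x. x)" unfolding Q_def using M_id[OF W] subgroup.one_closed[OF nrmR] Rcar by (auto intro!: bexI[of _ \<one>])
      next
        fix a b assume Qa: "Q a" and Qb: "Q b"
        obtain n where n: "n\<in>nrm T R" "\<forall>x\<in>R. a x = cj n x" using Qa by (auto simp: Q_def)
        obtain m where m: "m\<in>nrm T R" "\<forall>x\<in>R. b x = cj m x" using Qb by (auto simp: Q_def)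
        have "a (b x) = cj (m \<otimes> n) x" if x: "x \<in> R" for x
          using x n m nrmD[OF m(1) x] ncar Rcar by (simp add: cj_comp)
        then have "\<exists>n\<in>nrm T R. \<forall>x\<in>R. a (b x) = cj n x" using subgroup.m_closed[OF nrmR m(1) n(1)] by blast
        then show "Q (\<lambda>x. a (b x))" using Qa Qb M_aut_comp[of W a b] unfolding Q_def by simp
      next
        fix a assume Qa: "Q a"
        obtain n where n: "n\<in>nrm T R" "\<forall>x\<in>R. a x = cj n x" using Qa by (auto simp: Q_def)
        have ni: "inv n \<in> nrm T R" by (rule subgroup.m_inv_closed[OF nrmR n(1)])
        have "inv_into W a x = cj (inv n) x" if x: "x \<in> R" for x
        proof -
          have y: "cj (inv n) x \<in> R" by (rule nrmD[OF ni x])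
          then have "a (cj (inv n) x) = x" using n x ncar Rcar by simp
          moreover have "inj_on a W" using Qa M_inj[of W a] by (simp add: Q_def)
          ultimately show ?thesis using inv_into_f_f[OF _ subsetD[OF RW y], of a] by simp
        qed
        then have "\<exists>n\<in>nrm T R. \<forall>x\<in>R. inv_into W a x = cj n x" using ni by blast
        then show "Q (inv_into W a)" using Qa M_aut_inv[of W a] unfolding Q_def by simp
      qed (simp add: Q_def)
      have indW: "indu (nrm T R) W \<subseteq> AA"
      proof
        fix a assume a: "a \<in> indu (nrm T R) W"
        then obtain n where n: "n \<in> nrm T R" "a = restrict (cj n) W" by (auto simp: indu_def)
        have "a \<in> auts W" using indu_auts[OF W NW] a by blast
        then show "a \<in> AA" using n RW by (auto simp: AA_def Q_def auts_def)
      qed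
      have cenW: "cen D W = cen T W" if "cen T W \<subseteq> D" "D \<subseteq> T" for D using that by (auto simp: cen_def)
      \<comment> \<open>A Sylow subgroup Z of AA is conjugated into Aut_T(W) by some a in Aut(W).
        The elements realizing it normalize a(R), and N_T(a(R)) is no larger than N_T(R) by
        \<open>R_max\<close>. Since N' and N_T(R) both contain C_T(W), the comparison of orders
        passes to the groups induced on W.\<close>
      have cS: "card (indu (nrm T R) W) = p ^ multiplicity p (card AA)"
      proof (rule antisym)
        show "card (indu (nrm T R) W) \<le> p ^ multiplicity p (card AA)" unfolding indu_def
          by (rule card_indu_le[OF nrmR fin_sub[OF W(1)] pAA])
            (use indW ncar W in \<open>auto simp: indu_def cj_comp sub_mem\<close>)
        obtain Z where Z: "permset W Z" "Z \<subseteq> AA" "card Z = p ^ multiplicity p (card AA)"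
          using permset_sylow_exists[OF prime_p fin_sub[OF W(1)] pAA] by blast
        have ZA: "Z \<subseteq> auts W" using Z(2) by (auto simp: AA_def Q_def auts_def)
        obtain a where a: "a\<in>auts W" "\<And>d. d\<in>Z \<Longrightarrow> \<exists>s\<in>indu (nrm T W) W. \<forall>x\<in>W. a (d x) = s (a x)"
          using auts_sylow_conj[OF W faW Z(1) ZA Z(3)] by blast
        have aW: "M W a" "a ` W = W" using a by (auto simp: auts_def)
        have aRW: "a ` R \<subseteq> W" using aW RW by blast
        have aRM: "M R a" by (rule M_restrict[OF aW(1) Rs(1) RW])
        have aRs: "subgroup (a ` R) G" "a ` R \<subseteq> T" using M_img[OF aRM] M_imgT[OF aRM] by auto
        define N' where "N' = nrm (nrm T W) (a ` R)"
        have N's: "subgroup N' G" unfolding N'_def by (rule subgroup_nrm[OF nrmT_sub[OF W(1)] aRs(1)])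
        have N'W: "N' \<subseteq> nrm T W" unfolding N'_def by (rule nrm_sub)
        have N'R: "N' \<subseteq> nrm T (a ` R)" unfolding N'_def by (auto simp: nrm_def)
        have "card Z \<le> card (indu N' W)"
        proof (rule card_inj_on_le[of "tr W a"])
          show "inj_on (tr W a) Z"
            by (rule tr_inj[OF M_inj[OF aW(1)]]) (use Z(1) in \<open>auto simp: permset_def\<close>)
          show "finite (indu N' W)" by (rule finite_indu[OF fin_sub[OF N's]])
          show "tr W a ` Z \<subseteq> indu N' W"
          proof (rule image_subsetI)
            fix z assume z: "z \<in> Z"
            obtain s where s: "s\<in>indu (nrm T W) W" "\<forall>x\<in>W. a (z x) = s (a x)" using a(2)[OF z] by blast
            then obtain r where r: "r \<in> nrm T W" "s = restrict (cj r) W" by (auto simp: indu_def)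
            have eq: "a (z x) = cj r (a x)" if "x \<in> W" for x using s(2) r(2) that aW by auto
            have zR: "z ` R = R" using QR z Z(2) by (auto simp: AA_def)
            have "cj r ` a ` R = a ` z ` R" unfolding image_image using eq RW by (intro image_cong) auto
            then have "r \<in> N'" using r zR by (simp add: N'_def nrm_def)
            moreover have "tr W a z = restrict (cj r) W"
            proof (rule extensionalityI[of _ W])
              fix y assume "y \<in> W"
              then obtain w where w: "w \<in> W" "y = a w" using aW by auto
              then show "tr W a z y = restrict (cj r) W y" using tr_apply[OF M_inj[OF aW(1)] w(1)] eq aW by auto
            qed (use aW in \<open>auto simp: tr_def\<close>)
            ultimately show "tr W a z \<in> indu N' W" by (auto simp: indu_def)
          qed
        qed
        moreover have "card (indu N' W) \<le> card (indu (nrm T R) W)"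
        proof -
          have c0: "cen T W \<subseteq> nrm T R" using RW by (auto simp: cen_def nrm_def subset_iff image_iff)
          have c1: "cen T W \<subseteq> N'" using aRW unfolding N'_def by (auto simp: cen_def nrm_def subset_iff image_iff)
          have "card (indu N' W) * card (cen T W) = card N'"
            using card_indu[OF N's W(1)] cenW[OF c1 subset_trans[OF N'W nrm_sub]] by simp
          also have "\<dots> \<le> card (nrm T (a ` R))" by (rule card_mono[OF fin_sub[OF nrmT_sub[OF aRs(1)]] N'R])
          also have "\<dots> \<le> card (nrm T R)"
            using R_max[OF R M_inv_into[OF aRM] inv_img[OF aRM subset_refl]] by simp
          also have "\<dots> = card (indu (nrm T R) W) * card (cen T W)"
            using card_indu[OF nrmR W(1)] cenW[OF c0 nrm_sub] by simp
          finally have "card (indu N' W) * card (cen T W) \<le> card (indu (nrm T R) W) * card (cen T W)" .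
          moreover have "card (cen T W) > 0"
            using subgroup.one_closed[OF cenT_sub[OF W(1)]] fin_sub[OF cenT_sub[OF W(1)]] by (auto simp: card_gt_0_iff)
          ultimately show ?thesis by simp
        qed
        ultimately show "p ^ multiplicity p (card AA) \<le> card (indu (nrm T R) W)" using Z(3) by simp
      qed
      have "\<exists>y\<in>AA. \<forall>d\<in>N0. \<exists>s\<in>indu (nrm T R) W. \<forall>x\<in>W0. y (h (cj d x)) = s (y (h x))"
      proof (rule sylow_move[OF h(1) hW N0(1) N0W pAA permset_indu[OF nrmR W(1) NW] indW cS])
        fix d assume d: "d \<in> N0"
        then obtain r where r: "r \<in> nrm T R" "\<forall>x\<in>A. h (cj d x) = cj r (h x)" using hA by (auto simp: N0_def Nf_def)
        have "tr W0 h (cj d) y = cj r y" if y: "y \<in> R" for y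
        proof -
          obtain x where x: "x \<in> A" "y = h x" using y hA by auto
          then show ?thesis using AW tr_apply[OF M_inj[OF h(1)], of x "cj d"] r by auto
        qed
        then show "tr W0 h (cj d) \<in> AA"
          using r(1) tr_cj[OF h(1) subsetD[OF N0W d]] hW unfolding AA_def Q_def by auto
      qed
      then obtain y where y: "y\<in>AA" "\<And>d. d \<in> N0 \<Longrightarrow> \<exists>s\<in>indu (nrm T R) W. \<forall>x\<in>W0. y (h (cj d x)) = s (y (h x))" by blast
      have yW: "M W y" "y ` W = W" using y(1) by (auto simp: AA_def Q_def)
      \<comment> \<open>The map y adapts the action on W but also alters h on A. On R it is
        conjugation by n, so following with the inverse of n restores the original values.\<close>
      obtain n where n: "n \<in> nrm T R" "\<And>x. x \<in> R \<Longrightarrow> y x = cj n x" using y(1) by (auto simp: AA_def Q_def)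
      have yh: "M W0 (\<lambda>x. y (h x))" "(\<lambda>x. y (h x)) ` W0 = W"
        using M_comp[OF h(1), of y] image_image[of y h W0] hW yW by simp_all
      have "\<exists>k. M (W0 <#> N0) k \<and> (\<forall>x\<in>W0. k x = y (h x))"
      proof (rule rec_ext_prod[OF recW yh N0(1) N0W])
        fix d assume d: "d \<in> N0"
        obtain s where s: "s\<in>indu (nrm T R) W" "\<forall>x\<in>W0. y (h (cj d x)) = s (y (h x))" using y(2)[OF d] by blast
        then obtain r where r: "r \<in> nrm T R" "s = restrict (cj r) W" by (auto simp: indu_def)
        have "y (h (cj d x)) = cj r (y (h x))" if "x \<in> W0" for x using s(2) r(2) that yh(2) by auto
        then show "\<exists>r\<in>nrm T W. \<forall>x\<in>W0. y (h (cj d x)) = cj r (y (h x))" using r NW by blast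
      qed
      then obtain k where k: "M (W0 <#> N0) k" "\<And>x. x \<in> W0 \<Longrightarrow> k x = y (h x)" by blast
      have kN: "M N0 k" by (rule M_restrict[OF k(1) N0(1) prod_right[OF W0(1) N0(1)]])
      have ni: "inv n \<in> T" "n \<in> carrier G" using subgroup.m_inv_closed[OF nrmR n(1)] nrm_sub ncar[OF n(1)] by auto
      have k2: "M N0 (\<lambda>x. cj (inv n) (k x))"
        by (rule M_comp_sub[OF kN M_conj[OF T_sub subset_refl ni(1)] M_imgT[OF kN]])
      \<comment> \<open>On S the map f is h after l, so l carries \<open>Nf S f\<close> into
        \<open>Nf A h\<close>.\<close>
      define N where "N = Nf S f"
      have N: "subgroup N G" "S \<subseteq> N" "N \<subseteq> nrm T S" unfolding N_def by (rule subgroup_Nf[OF f(1)])+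
      have lN: "M N l" by (rule M_restrict[OF l(1) N(1,3)])
      have "l ` N \<subseteq> N0"
      proof (rule image_subsetI)
        fix g assume g: "g \<in> N"
        then have gN: "g \<in> nrm T S" using N by blast
        obtain r where r: "r \<in> nrm T R" "\<forall>x\<in>S. f (cj g x) = cj r (f x)" using g f(2) by (auto simp: N_def Nf_def)
        have "l g \<in> nrm T A" unfolding A_def by (rule M_nrm[OF l(1) S(1) SN gN gN])
        moreover have "h (cj (l g) z) = cj r (h z)" if z: "z \<in> A" for z
        proof -
          obtain x where x: "x \<in> S" "z = l x" using z by (auto simp: A_def)
          have "cj (l g) z = l (cj g x)" using M_cj_eq[OF l(1) _ gN, of x] x SN by auto
          then show ?thesis using h(2) r x nrmD[OF gN x(1)] by simp
        qed
        ultimately show "l g \<in> N0" using r(1) hA by (auto simp: N0_def Nf_def)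
      qed
      then have "M N (\<lambda>x. cj (inv n) (k (l x)))" by (rule M_comp_sub[OF lN k2])
      moreover have "cj (inv n) (k (l x)) = f x" if x: "x \<in> S" for x
      proof -
        have "l x \<in> W0" using x AW by (auto simp: A_def)
        moreover have "f x \<in> R" using x f by auto
        ultimately show ?thesis using k(2) h(2) x n(2) ni(2) Rcar by simp
      qed
      ultimately show "\<exists>h. M (Nf S f) h \<and> (\<forall>x\<in>S. h x = f x)" unfolding N_def by blast
    qed
  qed
qed

end

section \<open>The Frattini argument\<close>

lemma sylow_between:
  assumes p: "Factorial_Ring.prime (p::nat)" and U: "finite U" and S: "permset U \<S>" and B: "permset U \<B>" and A: "permset U \<A>"
    and sub: "\<S> \<subseteq> \<B>" "\<B> \<subseteq> \<A>" and c: "card \<S> = p ^ multiplicity p (card \<A>)"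
  shows "card \<S> = p ^ multiplicity p (card \<B>)"
proof -
  have nz: "card \<A> \<noteq> 0" "card \<B> \<noteq> 0"
    using permset_finite[OF U A] permset_finite[OF U B] A B by (auto simp: permset_def)
  have "multiplicity p (card \<B>) \<le> multiplicity p (card \<A>)"
    by (rule dvd_imp_multiplicity_le[OF permset_dvd[OF U A B sub(2)] nz(1)])
  moreover have "p ^ multiplicity p (card \<A>) dvd card \<B>" using permset_dvd[OF U B S sub(1)] c by simp
  then have "multiplicity p (card \<A>) \<le> multiplicity p (card \<B>)"
    using p nz by (intro multiplicity_geI) (auto simp: not_prime_unit)
  ultimately show ?thesis using c by simp
qed

context fsys
begin

lemma tr_restrict: "tr U f (restrict a U) = tr U f a"
  unfolding tr_def by (rule restrict_ext) (simp add: inv_into_into)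

lemma nice_top: assumes saturated shows "nice T"
proof -
  obtain f where f: "M T f" "nice (f ` T)" using assms T_sub unfolding saturated_def by blast
  have "f ` T = T" using M_imgT[OF f(1)] M_card[OF f(1) subset_refl] fin_sub[OF T_sub] by (intro card_seteq) auto
  then show ?thesis using f by simp
qed

lemma M_onto: assumes f: "M T f" shows "f ` T = T"
  using M_imgT[OF f] M_card[OF f subset_refl] fin_sub[OF T_sub] by (intro card_seteq) auto

end

text \<open>N is later both the ambient system and the weakly normal subsystem, with the same Z. Of
  normality only invariance under Aut_N(T) is assumed, because this is available before invariance
  under all of F is known.\<close>

locale frattini_setup = finite_p_group G p for G (structure) and p +
  fixes P N T Z
  assumes NN: "fsys G p P N" and ZZ: "fsys G p T Z"
    and TP: "T \<subseteq> P" and ZN: "Z U f \<Longrightarrow> N U f"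
    and closed: "N U f \<Longrightarrow> U \<subseteq> T \<Longrightarrow> f ` U \<subseteq> T"
    and auto_inv: "\<lbrakk>Z U f; N T \<alpha>; \<And>x. x \<in> U \<Longrightarrow> g (\<alpha> x) = \<alpha> (f x)\<rbrakk> \<Longrightarrow> Z (\<alpha> ` U) g"
begin

sublocale N: fsys G p P N by (rule NN)
sublocale Z: fsys G p T Z by (rule ZZ)

lemma N_onto: assumes "N T \<alpha>" shows "\<alpha> ` T = T"
  using closed[OF assms subset_refl] N.M_card[OF assms subset_refl] fin_sub[OF Z.T_sub] by (intro card_seteq) auto

definition dec :: "'a set \<Rightarrow> ('a \<Rightarrow> 'a) \<Rightarrow> bool" where
  "dec U f \<longleftrightarrow> (\<exists>e \<alpha>. Z U e \<and> N T \<alpha> \<and> (\<forall>x\<in>U. f x = \<alpha> (e x)))"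

lemma dec_Z: "Z U e \<Longrightarrow> dec U e"
  unfolding dec_def using N.M_id[OF Z.T_sub TP] by blast

lemma dec_cong: "dec U f \<Longrightarrow> (\<And>x. x \<in> U \<Longrightarrow> f x = g x) \<Longrightarrow> dec U g"
  unfolding dec_def by (metis (no_types, lifting))

lemma dec_restrict: "dec U f \<Longrightarrow> subgroup V G \<Longrightarrow> V \<subseteq> U \<Longrightarrow> dec V f"
  unfolding dec_def by (meson Z.M_restrict subsetD)

text \<open>A Z-morphism can be moved past an automorphism of T: conjugating d by \<alpha> gives the
  Z-morphism k, by \<open>auto_inv\<close>.\<close>

lemma dec_comp:
  assumes f: "dec U f" and g: "dec (f ` U) g"
  shows "dec U (\<lambda>x. g (f x))"
proof -
  obtain e \<alpha> where e: "Z U e" "N T \<alpha>" "\<And>x. x \<in> U \<Longrightarrow> f x = \<alpha> (e x)" using f by (auto simp: dec_def)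
  obtain d \<gamma> where d: "Z (f ` U) d" "N T \<gamma>" "\<And>x. x \<in> f ` U \<Longrightarrow> g x = \<gamma> (d x)" using g by (auto simp: dec_def)
  define \<beta> where "\<beta> = inv_into T \<alpha>"
  have \<beta>: "N T \<beta>" using N.M_inv_into[OF e(2)] N_onto[OF e(2)] by (simp add: \<beta>_def)
  have eT: "e x \<in> T" if "x \<in> U" for x using Z.M_ran[OF e(1) that] .
  have \<beta>\<alpha>: "\<beta> (\<alpha> y) = y" if "y \<in> T" for y using that N.M_inj[OF e(2)] by (simp add: \<beta>_def)
  have \<alpha>\<beta>: "\<alpha> (\<beta> y) = y" if "y \<in> T" for y using that N_onto[OF e(2)] by (auto simp: \<beta>_def f_inv_into_f)
  have \<beta>f: "\<beta> (f x) = e x" if "x \<in> U" for x using e(3)[OF that] \<beta>\<alpha>[OF eT[OF that]] by simp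
  define k where "k y = \<beta> (d (\<alpha> y))" for y
  have "Z (\<beta> ` f ` U) k"
    by (rule auto_inv[OF d(1) \<beta>]) (use \<beta>f e(3) in \<open>auto simp: k_def\<close>)
  moreover have "\<beta> ` f ` U = e ` U" unfolding image_image using \<beta>f by (intro image_cong) auto
  ultimately have "Z U (\<lambda>x. k (e x))" using Z.M_comp[OF e(1)] by simp
  moreover have "N T (\<lambda>x. \<gamma> (\<alpha> x))" using N.M_comp[OF e(2)] N_onto[OF e(2)] d(2) by simp
  moreover have "g (f x) = \<gamma> (\<alpha> (k (e x)))" if x: "x \<in> U" for x
  proof -
    have fx: "f x \<in> f ` U" using x by blast
    have "\<alpha> (k (e x)) = d (f x)" using Z.M_ran[OF d(1) fx] \<alpha>\<beta> e(3)[OF x] by (simp add: k_def)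
    then show ?thesis using d(3)[OF fx] by simp
  qed
  ultimately show ?thesis unfolding dec_def by (intro exI[of _ "\<lambda>x. k (e x)"] exI[of _ "\<lambda>x. \<gamma> (\<alpha> x)"]) simp
qed

lemma dec_inv:
  assumes f: "dec U f" and g: "\<And>x. x \<in> U \<Longrightarrow> g (f x) = x"
  shows "dec (f ` U) g"
proof -
  obtain e \<alpha> where e: "Z U e" "N T \<alpha>" "\<And>x. x \<in> U \<Longrightarrow> f x = \<alpha> (e x)" using f by (auto simp: dec_def)
  define \<beta> where "\<beta> = inv_into T \<alpha>"
  have \<beta>: "N T \<beta>" using N.M_inv_into[OF e(2)] N_onto[OF e(2)] by (simp add: \<beta>_def)
  have eT: "e x \<in> T" if "x \<in> U" for x using Z.M_ran[OF e(1) that] .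
  have \<beta>\<alpha>: "\<beta> (\<alpha> y) = y" if "y \<in> T" for y using that N.M_inj[OF e(2)] by (simp add: \<beta>_def)
  define k where "k y = \<alpha> (inv_into U e (\<beta> y))" for y
  have UT: "U \<subseteq> T" using Z.M_dom[OF e(1)] by simp
  have ke: "k (\<alpha> (e x)) = \<alpha> x" if "x \<in> U" for x
    using that \<beta>\<alpha>[OF eT[OF that]] Z.M_inj[OF e(1)] by (simp add: k_def)
  have "Z (\<alpha> ` e ` U) k"
    by (rule auto_inv[OF Z.M_inv_into[OF e(1)] e(2)]) (use ke Z.M_inj[OF e(1)] in auto)
  moreover have "\<alpha> ` e ` U = f ` U" unfolding image_image using e(3) by (intro image_cong) auto
  moreover have "g y = \<beta> (k y)" if y: "y \<in> f ` U" for y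
  proof -
    obtain x where x: "x \<in> U" "y = f x" using y by auto
    have "\<beta> (k y) = x" using ke[OF x(1)] e(3)[OF x(1)] \<beta>\<alpha>[of x] UT x by auto
    then show ?thesis using g[OF x(1)] x(2) by simp
  qed
  ultimately show ?thesis unfolding dec_def using \<beta> by (intro exI[of _ k] exI[of _ \<beta>]) simp
qed

text \<open>U and f(U) are both mapped to one nice R by morphisms defined on their normalizers, so
  only an automorphism g of R is left. If R does not contain C_T(R), then g extends to the product.
  Otherwise g is followed by an element of \<A>, a subgroup stable under automorphisms of R with
  Aut_T(R) as a Sylow subgroup; the result can be made to normalize Aut_T(R), and so extends to
  N_T(R).\<close>

theorem frattini:
  assumes sat: N.saturated
    and H: "\<And>R. \<lbrakk>N.nice R; R \<subseteq> T; R \<noteq> T; cen T R \<subseteq> R\<rbrakk> \<Longrightarrow>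
      \<exists>\<A>. permset R \<A> \<and> indu (nrm T R) R \<subseteq> \<A> \<and> (\<forall>a\<in>\<A>. Z R a) \<and> card (indu (nrm T R) R) = p ^ multiplicity p (card \<A>) \<and>
        (\<forall>a\<in>\<A>. \<forall>g. N R g \<longrightarrow> g ` R = R \<longrightarrow> N.tr R g a \<in> \<A>)"
  shows "N U f \<Longrightarrow> U \<subseteq> T \<Longrightarrow> dec U f"
proof (induction "card T - card U" arbitrary: U f rule: less_induct)
  case less
  note f = less.prems(1) and UT = less.prems(2)
  have U: "subgroup U G" using N.M_dom[OF f] by blast
  show ?case
  proof (cases "U = T")
    case True
    then show ?thesis unfolding dec_def using f Z.M_id[OF U UT] by blast
  next
    case False
    have IH: "dec V g" if "N V g" "V \<subseteq> T" "card U < card V" for V g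
    proof (rule less.hyps[OF _ that(1,2)])
      have "card V \<le> card T" by (rule card_mono[OF fin_sub[OF Z.T_sub] that(2)])
      then show "card T - card V < card T - card U" using that(3) by simp
    qed
    \<comment> \<open>A morphism on N_P(V) restricts to N_T(V), which is strictly larger than V, so
      the induction hypothesis applies to it.\<close>
    have grow: "dec V g" if g: "N (nrm P V) g" and V: "subgroup V G" "V \<subseteq> T" "card V = card U" for V g
    proof -
      have VT: "V \<noteq> T" using V UT False fin_sub[OF Z.T_sub] by (metis card_subset_eq)
      have Vn: "V \<subseteq> nrm T V" by (rule self_nrm[OF Z.T_sub V(1,2)])
      have n: "subgroup (nrm T V) G" by (rule Z.nrmT_sub[OF V(1)])
      have "N (nrm T V) g" by (rule N.M_restrict[OF g n]) (use TP in \<open>auto simp: nrm_def\<close>)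
      moreover have "V \<subset> nrm T V" using normalizer_grows[OF Z.T_sub V(1,2) VT] Vn by blast
      from psubset_card_mono[OF fin_sub[OF n] this] have "card U < card (nrm T V)" using V(3) by simp
      ultimately have "dec (nrm T V) g" using IH nrm_sub by blast
      then show ?thesis by (rule dec_restrict[OF _ V(1) Vn])
    qed
    have UP: "U \<subseteq> P" using UT TP by blast
    obtain h where h: "N (nrm P U) h" "N.nice (h ` U)" using N.nice_rep[OF sat U UP] by blast
    define R where "R = h ` U"
    have hU: "N U h" by (rule N.M_restrict[OF h(1) U self_nrm[OF N.T_sub U UP]])
    have R: "subgroup R G" "R \<subseteq> T" "card R = card U" "N.nice R"
      using N.M_img[OF hU] closed[OF hU UT] N.M_card[OF hU subset_refl] h(2) by (auto simp: R_def)
    have fU: "subgroup (f ` U) G" "f ` U \<subseteq> T" "card (f ` U) = card U"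
      using N.M_img[OF f] closed[OF f UT] N.M_card[OF f subset_refl] by auto
    define q where "q y = h (inv_into U f y)" for y
    have q: "N (f ` U) q" unfolding q_def
      by (rule N.M_comp[OF N.M_inv_into[OF f]]) (use N.inv_img[OF f subset_refl] hU in simp)
    have qR: "q ` f ` U = R" unfolding q_def R_def
      using N.inv_img[OF f subset_refl] image_image[of h "inv_into U f" "f ` U"] by simp
    obtain h' where h': "N (nrm P (f ` U)) h'" "h' ` f ` U = R" using N.nice_ext[OF R(4) q qR] by blast
    have d1: "dec U h" by (rule grow[OF h(1) U UT refl])
    have d2: "dec (f ` U) h'" by (rule grow[OF h'(1) fU])
    have h'U: "N (f ` U) h'"
      by (rule N.M_restrict[OF h'(1) fU(1) self_nrm[OF N.T_sub fU(1)]]) (use fU(2) TP in blast)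
    \<comment> \<open>f, read as an automorphism of R through h and h'.\<close>
    define g where "g y = h' (f (inv_into U h y))" for y
    have gh: "g (h x) = h' (f x)" if "x \<in> U" for x using that N.M_inj[OF hU] by (simp add: g_def)
    have g: "N R g" unfolding R_def by (rule N.M_transport[OF hU f h'U gh])
    have gR: "g ` R = R"
    proof -
      have "g ` R = h' ` f ` U" unfolding R_def image_image using gh by (intro image_cong) auto
      then show ?thesis using h'(2) by simp
    qed
    have RP: "R \<subseteq> P" using R(2) TP by blast
    have recR: "N.rec R" using R(4) by (simp add: N.nice_def)
    have RT: "R \<noteq> T" using R UT False fin_sub[OF Z.T_sub] by (metis card_subset_eq)
    have "dec R g"
    proof (cases "cen T R \<subseteq> R")
      case False
      have c: "subgroup (cen T R) G" by (rule Z.cenT_sub[OF R(1)])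
      have "\<exists>k. N (R <#> cen T R) k \<and> (\<forall>x\<in>R. k x = g x)"
      proof (rule N.rec_ext_prod[OF recR g gR c])
        show "cen T R \<subseteq> nrm P R" using TP by (auto simp: cen_def nrm_def)
        fix d assume "d \<in> cen T R"
        then have "\<forall>x\<in>R. g (cj d x) = cj \<one> (g x)" using N.M_fcar[OF g] by (auto simp: cen_def)
        moreover have "\<one> \<in> nrm P R" using subgroup.one_closed[OF N.nrmT_sub[OF R(1)]] .
        ultimately show "\<exists>r\<in>nrm P R. \<forall>x\<in>R. g (cj d x) = cj r (g x)" by blast
      qed
      then obtain k where k: "N (R <#> cen T R) k" "\<forall>x\<in>R. k x = g x" by blast
      have RW: "R \<subset> R <#> cen T R" using Z.UC_left[OF R(1)] Z.UC_right[OF R(1)] False by blast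
      from psubset_card_mono[OF fin_sub[OF Z.UC_sub[OF R(1)]] this]
      have "card U < card (R <#> cen T R)" using R(3) by simp
      then have "dec (R <#> cen T R) k" using IH[OF k(1) Z.UC_T[OF R(2)]] by simp
      then have "dec R k" by (rule dec_restrict[OF _ R(1) Z.UC_left[OF R(1)]])
      then show ?thesis by (rule dec_cong) (use k(2) in simp)
    next
      case True
      obtain \<A> where A0: "permset R \<A> \<and> indu (nrm T R) R \<subseteq> \<A> \<and> (\<forall>a\<in>\<A>. Z R a) \<and> card (indu (nrm T R) R) = p ^ multiplicity p (card \<A>) \<and>
        (\<forall>a\<in>\<A>. \<forall>g. N R g \<longrightarrow> g ` R = R \<longrightarrow> N.tr R g a \<in> \<A>)"
        using H[OF R(4,2) RT True] by (rule exE)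
      note A = conjunct1[OF A0] conjunct1[OF conjunct2[OF A0]] bspec[OF conjunct1[OF conjunct2[OF conjunct2[OF A0]]]]
        conjunct1[OF conjunct2[OF conjunct2[OF conjunct2[OF A0]]]] conjunct2[OF conjunct2[OF conjunct2[OF conjunct2[OF A0]]], rule_format]
      have n: "subgroup (nrm T R) G" by (rule Z.nrmT_sub[OF R(1)])
      have nP: "nrm T R \<subseteq> nrm P R" using TP by (auto simp: nrm_def)
      have Rn: "R \<subseteq> nrm T R" by (rule self_nrm[OF Z.T_sub R(1,2)])
      have "\<exists>a\<in>\<A>. \<forall>d\<in>nrm T R. \<exists>s\<in>indu (nrm T R) R. \<forall>x\<in>R. a (g (cj d x)) = s (a (g x))"
      proof (rule N.sylow_move[OF g gR n nP A(1) permset_indu[OF n R(1) subset_refl] A(2,4)])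
        fix d assume "d \<in> nrm T R"
        then have "restrict (cj d) R \<in> \<A>" using A(2) by (auto simp: indu_def)
        from A(5)[OF this g gR] show "N.tr R g (cj d) \<in> \<A>" by (simp add: N.tr_restrict)
      qed
      then obtain a where a: "a\<in>\<A>" "\<And>d. d\<in>nrm T R \<Longrightarrow> \<exists>s\<in>indu (nrm T R) R. \<forall>x\<in>R. a (g (cj d x)) = s (a (g x))" by blast
      have Za: "Z R a" "a ` R = R" "inj_on a R" using A(1,3) a(1) by (auto simp: permset_def)
      have ag: "N R (\<lambda>x. a (g x))" using N.M_comp[OF g] gR ZN[OF Za(1)] by simp
      have agR: "(\<lambda>x. a (g x)) ` R = R" using image_image[of a g R] gR Za(2) by simp
      have "\<exists>k. N (nrm T R) k \<and> (\<forall>x\<in>R. k x = a (g x))"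
      proof (rule N.recD[OF recR ag agR n])
        show "nrm T R \<subseteq> P" using nrm_sub TP by blast
        fix d assume d: "d \<in> nrm T R"
        obtain s where s: "s\<in>indu (nrm T R) R" "\<forall>x\<in>R. a (g (cj d x)) = s (a (g x))" using a(2)[OF d] by blast
        then obtain r where r: "r \<in> nrm T R" "s = restrict (cj r) R" by (auto simp: indu_def)
        have "a (g (cj d x)) = cj r (a (g x))" if "x \<in> R" for x using s(2) r(2) that agR by auto
        then show "\<exists>r\<in>nrm P R. \<forall>x\<in>R. a (g (cj d x)) = cj r (a (g x))" using r nP by blast
      qed (rule nrmD)
      then obtain k where k: "N (nrm T R) k" "\<forall>x\<in>R. k x = a (g x)" by blast
      have "R \<subset> nrm T R" using normalizer_grows[OF Z.T_sub R(1,2) RT] Rn by blast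
      from psubset_card_mono[OF fin_sub[OF n] this] have "card U < card (nrm T R)" using R(3) by simp
      then have "dec (nrm T R) k" using IH[OF k(1) nrm_sub] by simp
      then have "dec R k" by (rule dec_restrict[OF _ R(1) Rn])
      then have dag: "dec R (\<lambda>x. a (g x))" by (rule dec_cong) (use k(2) in simp)
      \<comment> \<open>The correction a belongs to Z, so undoing it keeps the map
        decomposable.\<close>
      have "dec R (inv_into R a)" by (rule dec_Z) (use Z.M_inv_into[OF Za(1)] Za(2) in simp)
      then have "dec R (\<lambda>x. inv_into R a (a (g x)))" using dec_comp[OF dag] agR by simp
      then show ?thesis by (rule dec_cong) (metis Za(3) gR imageI inv_into_f_f)
    qed
    then have d3: "dec U (\<lambda>x. g (h x))" using dec_comp[OF d1] by (simp add: R_def)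
    have "dec R (inv_into (f ` U) h')" using dec_inv[OF d2, of "inv_into (f ` U) h'"] N.M_inj[OF h'U] h'(2) by simp
    moreover have "(\<lambda>x. g (h x)) ` U = R" using image_image[of g h U] gR by (simp add: R_def)
    ultimately have "dec U (\<lambda>x. inv_into (f ` U) h' (g (h x)))" using dec_comp[OF d3] by simp
    then show ?thesis by (rule dec_cong) (use gh N.M_inj[OF h'U] in auto)
  qed
qed

end

section \<open>The subsystem generated by good morphisms\<close>

text \<open>In \<open>invar\<close> the conjugate of f by k is given by an equation on Q, so any
  total function with these values will do.\<close>

locale weakly_normal_pair = finite_p_group G p for G (structure) and p +
  fixes MF ME T
  assumes FF: "fsys G p (carrier G) MF" and EE: "fsys G p T ME"
    and EF: "ME U f \<Longrightarrow> MF U f"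
    and closed: "MF U f \<Longrightarrow> U \<subseteq> T \<Longrightarrow> f ` U \<subseteq> T"
    and invar: "\<lbrakk>ME Q f; MF R k; Q \<subseteq> R; f ` Q \<subseteq> R; R \<subseteq> T; \<And>x. x \<in> Q \<Longrightarrow> g (k x) = k (f x)\<rbrakk> \<Longrightarrow> ME (k ` Q) g"
    and Fsat: "fsys.saturated G p (carrier G) MF" and Esat: "fsys.saturated G p T ME"
begin

sublocale F: fsys G p "carrier G" MF by (rule FF)
sublocale E: fsys G p T ME by (rule EE)

lemma T_sub: "subgroup T G" by (rule E.T_sub)
lemma T_le: "T \<subseteq> carrier G" by (rule subgroup.subset[OF T_sub])

definition C where "C = cen (carrier G) T"

lemma C_sub: "subgroup C G" unfolding C_def by (rule subgroup_cen[OF subgroup_self T_le])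
lemma C_mono: "U \<subseteq> T \<Longrightarrow> C \<subseteq> cen (carrier G) U" by (auto simp: C_def cen_def)

lemma F_onto: "MF T \<alpha> \<Longrightarrow> \<alpha> ` T = T"
  using closed[of T \<alpha>] F.M_card[of T \<alpha> T] fin_sub[OF T_sub] by (intro card_seteq) auto

lemma T_cj: "g \<in> carrier G \<Longrightarrow> t \<in> T \<Longrightarrow> cj g t \<in> T"
  using closed[OF F.M_conj[OF T_sub T_le, of g] subset_refl] by blast

lemma prod_sub: "subgroup U G \<Longrightarrow> subgroup K G \<Longrightarrow> K \<subseteq> cen (carrier G) U \<Longrightarrow> subgroup (U <#> K) G"
  by (rule subgroup_prod) (use cen_nrm in blast)+

text \<open>Centralizers are taken in T but conjugates in F, so that the class is stable under
  F-conjugation and upward closed among the subgroups of T.\<close>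

definition centric :: "'a set \<Rightarrow> bool" where
  "centric U \<longleftrightarrow> subgroup U G \<and> U \<subseteq> T \<and> (\<forall>f. MF U f \<longrightarrow> cen T (f ` U) \<subseteq> f ` U)"

lemma centricD: "centric U \<Longrightarrow> subgroup U G" "centric U \<Longrightarrow> U \<subseteq> T" "centric U \<Longrightarrow> MF U f \<Longrightarrow> cen T (f ` U) \<subseteq> f ` U"
  by (auto simp: centric_def)

lemma centric_cen: "centric U \<Longrightarrow> cen T U \<subseteq> U"
  using centricD(3)[OF _ F.M_id[of U]] centricD(1,2) T_le by fastforce

lemma centric_iso: assumes "MF U f" "centric U" shows "centric (f ` U)"
  unfolding centric_def
proof (intro conjI allI impI)
  show "subgroup (f ` U) G" by (rule F.M_img[OF assms(1)])
  show "f ` U \<subseteq> T" by (rule closed[OF assms(1) centricD(2)[OF assms(2)]])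
  fix g assume "MF (f ` U) g"
  then have "MF U (\<lambda>x. g (f x))" by (rule F.M_comp[OF assms(1)])
  from centricD(3)[OF assms(2) this] show "cen T (g ` f ` U) \<subseteq> g ` f ` U" by (simp add: image_image)
qed

lemma centric_iso': assumes f: "MF U f" and U: "U \<subseteq> T" and c: "centric (f ` U)" shows "centric U"
  using centric_iso[OF F.M_inv_into[OF f] c] F.inv_img[OF f subset_refl] by simp

lemma centric_mono: assumes "centric U" "subgroup V G" "U \<subseteq> V" "V \<subseteq> T" shows "centric V"
  unfolding centric_def
proof (intro conjI allI impI)
  fix f assume f: "MF V f"
  have "cen T (f ` V) \<subseteq> cen T (f ` U)" using assms(3) by (auto simp: cen_def)
  also have "\<dots> \<subseteq> f ` U" by (rule centricD(3)[OF assms(1) F.M_restrict[OF f centricD(1)[OF assms(1)] assms(3)]])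
  finally show "cen T (f ` V) \<subseteq> f ` V" using assms(3) by blast
qed (use assms in auto)

lemma centric_T: "centric T"
  unfolding centric_def using T_sub F_onto by (auto simp: cen_def)

text \<open>K will be C for good morphisms and C_P(R) for automorphisms of R. Triviality modulo T is
  imposed on K alone, since U and f(U) lie in T in every application.\<close>

definition ext_mod_T :: "'a set \<Rightarrow> 'a set \<Rightarrow> ('a \<Rightarrow> 'a) \<Rightarrow> bool" where
  "ext_mod_T K U f \<longleftrightarrow> (\<exists>h. MF (U <#> K) h \<and> (\<forall>x\<in>U. h x = f x) \<and> (\<forall>c\<in>K. inv c \<otimes> h c \<in> T))"

lemma ext_mod_T_cong: "ext_mod_T K U f \<Longrightarrow> (\<And>x. x \<in> U \<Longrightarrow> f x = g x) \<Longrightarrow> ext_mod_T K U g"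
  unfolding ext_mod_T_def by metis

lemma ext_mod_T_restrict:
  assumes f: "ext_mod_T K U f" and K: "subgroup K' G" "K' \<subseteq> K" "subgroup K G" "K' \<subseteq> cen (carrier G) V" and V: "subgroup V G" "V \<subseteq> U" "subgroup U G"
  shows "ext_mod_T K' V f"
proof -
  obtain h where h: "MF (U <#> K) h" "\<forall>x\<in>U. h x = f x" "\<forall>c\<in>K. inv c \<otimes> h c \<in> T" using f by (auto simp: ext_mod_T_def)
  have "V <#> K' \<subseteq> U <#> K" by (rule mono_set_mult[OF V(2) K(2)])
  then have "MF (V <#> K') h" using F.M_restrict[OF h(1) prod_sub[OF V(1) K(1,4)]] by blast
  then show ?thesis using h V K unfolding ext_mod_T_def by blast
qed

text \<open>The point where centricity enters. As c centralizes U, h(c) centralizes f(U); so does c;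
  hence their quotient lies in C_T(f(U)), which is contained in f(U).\<close>

lemma ext_mod_T_shift:
  assumes h: "MF (U <#> K) h" "\<And>x. x \<in> U \<Longrightarrow> h x = f x" "\<And>c. c \<in> K \<Longrightarrow> inv c \<otimes> h c \<in> T"
    and K: "subgroup K G" "K \<subseteq> cen (carrier G) U" "K \<subseteq> cen (carrier G) (f ` U)"
    and U: "subgroup U G" "U \<subseteq> T" and cf: "cen T (f ` U) \<subseteq> f ` U" and c: "c \<in> K"
  shows "\<exists>u\<in>U. h c = c \<otimes> f u"
proof -
  have UK: "U \<subseteq> U <#> K" "K \<subseteq> U <#> K" by (rule prod_left[OF U(1) K(1)], rule prod_right[OF U(1) K(1)])
  have cc: "c \<in> carrier G" "h c \<in> carrier G" using c K sub_mem F.M_fcar[OF h(1)] UK by auto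
  have "inv c \<otimes> h c \<in> cen T (f ` U)" unfolding cen_def
  proof (intro CollectI conjI ballI)
    show "inv c \<otimes> h c \<in> T" by (rule h(3)[OF c])
    fix y assume "y \<in> f ` U"
    then obtain x where x: "x \<in> U" "y = f x" by auto
    have yc: "y \<in> carrier G" using x h(2) F.M_fcar[OF h(1)] UK by (metis subsetD)
    have "inv c \<in> cen (carrier G) (f ` U)" using K(3) subgroup.m_inv_closed[OF K(1) c] by blast
    then have "cj (inv c) y = y" using x by (auto simp: cen_def)
    moreover have "cj (h c) y = y"
    proof -
      have "cj c x = x" using K(2) c x by (auto simp: cen_def)
      then have "h x = cj (h c) (h x)" using F.M_cj_eq[OF h(1), of x c] x c UK by auto
      then show ?thesis using x h(2) by simp
    qed
    ultimately show "cj (inv c \<otimes> h c) y = y" using cc yc by (simp add: cj_comp)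
  qed
  then obtain u where "u \<in> U" "inv c \<otimes> h c = f u" using cf by blast
  then show ?thesis using cc by (metis inv_cancel(1))
qed

text \<open>The exact image is what makes composites and inverses of such extensions live on the
  right products.\<close>

lemma ext_mod_T_img:
  assumes h: "MF (U <#> K) h" "\<And>x. x \<in> U \<Longrightarrow> h x = f x" "\<And>c. c \<in> K \<Longrightarrow> inv c \<otimes> h c \<in> T"
    and K: "subgroup K G" "K \<subseteq> cen (carrier G) U" "K \<subseteq> cen (carrier G) (f ` U)"
    and U: "subgroup U G" "U \<subseteq> T" and cf: "cen T (f ` U) \<subseteq> f ` U"
  shows "h ` (U <#> K) = f ` U <#> K"
proof
  have sh: "\<exists>u\<in>U. h c = c \<otimes> f u" if "c \<in> K" for c by (rule ext_mod_T_shift[OF h K U cf that])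
  have UK: "U \<subseteq> U <#> K" "K \<subseteq> U <#> K" by (rule prod_left[OF U(1) K(1)], rule prod_right[OF U(1) K(1)])
  have fs: "subgroup (f ` U) G" 
  proof -
    have "f ` U = h ` U" using h(2) by (intro image_cong) auto
    then show ?thesis using F.M_img_sub[OF h(1) U(1) UK(1)] by simp
  qed
  note P = prod_sub[OF fs K(1,3)]
  have fP: "f ` U \<subseteq> f ` U <#> K" "K \<subseteq> f ` U <#> K" by (rule prod_left[OF fs K(1)], rule prod_right[OF fs K(1)])
  have car: "K \<subseteq> carrier G" "f ` U \<subseteq> carrier G" using subgroup.subset K fs by auto
  show "h ` (U <#> K) \<subseteq> f ` U <#> K"
  proof clarify
    fix x assume "x \<in> U <#> K"
    then obtain u c where x: "u \<in> U" "c \<in> K" "x = u \<otimes> c" by (auto simp: prod_mem)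
    obtain v where v: "v \<in> U" "h c = c \<otimes> f v" using sh[OF x(2)] by blast
    have "h x = f u \<otimes> (c \<otimes> f v)" using F.M_mult[OF h(1) subsetD[OF UK(1) x(1)] subsetD[OF UK(2) x(2)]] x h(2) v by simp
    also have "\<dots> \<in> f ` U <#> K"
      using subgroup.m_closed[OF P] fP x v by (meson imageI subsetD)
    finally show "h x \<in> f ` U <#> K" .
  qed
  have Hs: "subgroup (h ` (U <#> K)) G" by (rule F.M_img[OF h(1)])
  have f1: "f ` U \<subseteq> h ` (U <#> K)" using h(2) UK by force
  have "K \<subseteq> h ` (U <#> K)"
  proof
    fix c assume c: "c \<in> K"
    obtain v where v: "v \<in> U" "h c = c \<otimes> f v" using sh[OF c] by blast
    have fv: "f v \<in> h ` (U <#> K)" "h c \<in> h ` (U <#> K)" using f1 v c UK by blast+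
    have "c = h c \<otimes> inv (f v)" using v c car by (auto simp: m_assoc subset_iff)
    then show "c \<in> h ` (U <#> K)" using subgroup.m_closed[OF Hs fv(2) subgroup.m_inv_closed[OF Hs fv(1)]] by simp
  qed
  then show "f ` U <#> K \<subseteq> h ` (U <#> K)" by (rule prod_least[OF Hs f1])
qed

text \<open>With h(c) = c f(u), the second extension k sends h(c) to k(c) k(f(u)); modulo T the
  first factor is c, and the second lies in T.\<close>

lemma ext_mod_T_comp:
  assumes f: "ext_mod_T K U f" and g: "ext_mod_T K (f ` U) g"
    and K: "subgroup K G" "K \<subseteq> cen (carrier G) U" "K \<subseteq> cen (carrier G) (f ` U)"
    and U: "subgroup U G" "U \<subseteq> T" and cf: "cen T (f ` U) \<subseteq> f ` U" and fU: "f ` U \<subseteq> T" "subgroup (f ` U) G"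
  shows "ext_mod_T K U (\<lambda>x. g (f x))"
proof -
  obtain h where h: "MF (U <#> K) h" "\<And>x. x\<in>U \<Longrightarrow> h x = f x" "\<And>c. c\<in>K \<Longrightarrow> inv c \<otimes> h c \<in> T" using f by (auto simp: ext_mod_T_def)
  obtain k where k: "MF (f ` U <#> K) k" "\<And>x. x\<in>f ` U \<Longrightarrow> k x = g x" "\<And>c. c\<in>K \<Longrightarrow> inv c \<otimes> k c \<in> T" using g by (auto simp: ext_mod_T_def)
  have "MF (U <#> K) (\<lambda>x. k (h x))"
    by (rule F.M_comp[OF h(1)]) (use ext_mod_T_img[OF h K U cf] k(1) in simp)
  moreover have "inv c \<otimes> k (h c) \<in> T" if c: "c \<in> K" for c
  proof -
    obtain u where u: "u \<in> U" "h c = c \<otimes> f u" using ext_mod_T_shift[OF h K U cf c] by blast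
    have m: "c \<in> f ` U <#> K" "f u \<in> f ` U <#> K" using u c prod_left[OF fU(2) K(1)] prod_right[OF fU(2) K(1)] by auto
    have "k (f u) \<in> T" using closed[OF F.M_restrict[OF k(1) fU(2) prod_left[OF fU(2) K(1)]] fU(1)] u by blast
    then have "inv c \<otimes> k c \<otimes> k (f u) \<in> T" using k(3)[OF c] subgroup.m_closed[OF T_sub] by blast
    moreover have "inv c \<otimes> k (h c) = inv c \<otimes> k c \<otimes> k (f u)"
      using u F.M_mult[OF k(1) m] F.M_fcar[OF k(1) m(1)] F.M_fcar[OF k(1) m(2)] F.M_car[OF k(1) m(1)] by (simp add: m_assoc)
    ultimately show ?thesis by simp
  qed
  ultimately show ?thesis using h k unfolding ext_mod_T_def by (intro exI[of _ "\<lambda>x. k (h x)"]) auto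
qed

lemma ext_mod_T_inv:
  assumes f: "ext_mod_T K U f"
    and K: "subgroup K G" "K \<subseteq> cen (carrier G) U" "K \<subseteq> cen (carrier G) (f ` U)"
    and U: "subgroup U G" "U \<subseteq> T" and cf: "cen T (f ` U) \<subseteq> f ` U" and g: "\<And>x. x \<in> U \<Longrightarrow> g (f x) = x"
  shows "ext_mod_T K (f ` U) g"
proof -
  obtain h where h: "MF (U <#> K) h" "\<And>x. x\<in>U \<Longrightarrow> h x = f x" "\<And>c. c\<in>K \<Longrightarrow> inv c \<otimes> h c \<in> T" using f by (auto simp: ext_mod_T_def)
  define k where "k = inv_into (U <#> K) h"
  have UK: "U \<subseteq> U <#> K" "K \<subseteq> U <#> K" by (rule prod_left[OF U(1) K(1)], rule prod_right[OF U(1) K(1)])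
  have Us: "subgroup (U <#> K) G" by (rule prod_sub[OF U(1) K(1,2)])
  have kh: "k (h x) = x" if "x \<in> U <#> K" for x using that F.M_inj[OF h(1)] by (simp add: k_def)
  have "MF (f ` U <#> K) k" using F.M_inv_into[OF h(1)] ext_mod_T_img[OF h K U cf] by (simp add: k_def)
  moreover have "k (f x) = g (f x)" if "x \<in> U" for x using kh[of x] h(2)[OF that] g[OF that] that UK by auto
  moreover have "inv c \<otimes> k c \<in> T" if c: "c \<in> K" for c
  proof -
    obtain u where u: "u \<in> U" "h c = c \<otimes> f u" using ext_mod_T_shift[OF h K U cf c] by blast
    have m: "c \<in> U <#> K" "inv u \<in> U <#> K" "inv u \<in> U" "u \<in> U <#> K" using c u UK subgroup.m_inv_closed[OF U(1) u(1)] by auto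
    have car: "c \<in> carrier G" "h c \<in> carrier G" "f u \<in> carrier G"
      using F.M_car[OF h(1) m(1)] F.M_fcar[OF h(1) m(1)] F.M_fcar[OF h(1) m(4)] h(2)[OF u(1)] by auto
    have "h (c \<otimes> inv u) = h c \<otimes> inv (f u)" using F.M_mult[OF h(1) m(1,2)] F.M_minv[OF h(1) m(4)] h(2)[OF u(1)] by simp
    also have "\<dots> = c" using u car by (simp add: m_assoc)
    finally have "k c = c \<otimes> inv u" using kh[of "c \<otimes> inv u"] subgroup.m_closed[OF Us m(1,2)] by simp
    then have "inv c \<otimes> k c = inv u" using car sub_mem[OF U(1) m(3)] by simp
    then show ?thesis using m U by auto
  qed
  ultimately show ?thesis unfolding ext_mod_T_def by (intro exI[of _ k]) auto
qed

text \<open>K is the full centralizer of W, so a maps K to itself and the conjugated extension lives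
  on a(U) K. For d = a(c) and h(c) = c f(u) it sends d to d a(f(u)), and a(f(u)) lies in W, hence in
  T.\<close>

lemma ext_mod_T_transport:
  assumes f: "ext_mod_T K U f" and a: "MF (W <#> K) a" "a ` W = W" and W: "subgroup W G" "W \<subseteq> T" and UW: "U \<subseteq> W" "f ` U \<subseteq> W"
    and Kd: "K = cen (carrier G) W"
    and U: "subgroup U G" and cf: "cen T (f ` U) \<subseteq> f ` U" and g: "\<And>x. x \<in> U \<Longrightarrow> g (a x) = a (f x)"
  shows "ext_mod_T K (a ` U) g"
proof -
  have K: "subgroup K G" unfolding Kd by (rule subgroup_cen[OF subgroup_self subgroup.subset[OF W(1)]])
  have KU: "K \<subseteq> cen (carrier G) U" "K \<subseteq> cen (carrier G) (f ` U)" using UW by (auto simp: Kd cen_def)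
  obtain h where h: "MF (U <#> K) h" "\<And>x. x\<in>U \<Longrightarrow> h x = f x" "\<And>c. c\<in>K \<Longrightarrow> inv c \<otimes> h c \<in> T" using f by (auto simp: ext_mod_T_def)
  have UT: "U \<subseteq> T" using UW W by blast
  have Us: "subgroup (U <#> K) G" by (rule prod_sub[OF U K KU(1)])
  have UsW: "U <#> K \<subseteq> W <#> K" by (rule mono_set_mult[OF UW(1) subset_refl])
  have aU: "MF (U <#> K) a" by (rule F.M_restrict[OF a(1) Us UsW])
  have hUK: "h ` (U <#> K) = f ` U <#> K" by (rule ext_mod_T_img[OF h K KU U UT cf])
  have "f ` U <#> K \<subseteq> W <#> K" by (rule mono_set_mult[OF UW(2) subset_refl])
  then have ah: "MF (h ` (U <#> K)) a" using F.M_restrict[OF a(1) F.M_img[OF h(1)]] hUK by simp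
  define k where "k y = a (h (inv_into (U <#> K) a y))" for y
  have ka: "k (a x) = a (h x)" if "x \<in> U <#> K" for x using that F.M_inj[OF aU] by (simp add: k_def)
  have kM: "MF (a ` (U <#> K)) k" by (rule F.M_transport[OF aU h(1) ah ka])
  have UK: "U \<subseteq> U <#> K" "K \<subseteq> U <#> K" by (rule prod_left[OF U(1) K(1)], rule prod_right[OF U(1) K(1)])
  have WK: "W \<subseteq> W <#> K" "K \<subseteq> W <#> K" by (rule prod_left[OF W(1) K(1)], rule prod_right[OF W(1) K(1)])
  have aK: "a ` K = K"
  proof (rule card_seteq[OF fin_sub[OF K]])
    show "a ` K \<subseteq> K"
    proof (rule image_subsetI)
      fix c assume c: "c \<in> K"
      have "a c \<in> cen (carrier G) (a ` W)" by (rule F.M_cen[OF a(1) WK(1)]) (use c WK Kd in auto)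
      then show "a c \<in> K" using a(2) Kd by simp
    qed
    show "card K \<le> card (a ` K)" using F.M_card[OF a(1) WK(2)] by simp
  qed
  have aUK: "a ` U <#> K = a ` (U <#> K)"
  proof
    show "a ` U <#> K \<subseteq> a ` (U <#> K)"
      by (rule prod_least[OF F.M_img[OF aU]]) (use UK aK in blast)+
    show "a ` (U <#> K) \<subseteq> a ` U <#> K"
    proof clarify
      fix x assume "x \<in> U <#> K"
      then obtain u c where x: "u \<in> U" "c \<in> K" "x = u \<otimes> c" by (auto simp: prod_mem)
      have "a x = a u \<otimes> a c" using F.M_mult[OF aU] x UK by auto
      then show "a x \<in> a ` U <#> K" using x aK by (auto simp: prod_mem)
    qed
  qed
  show ?thesis unfolding ext_mod_T_def
  proof (intro exI[of _ k] conjI ballI)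
    show "MF (a ` U <#> K) k" using kM aUK by simp
    show "k y = g y" if "y \<in> a ` U" for y using that ka g h(2) UK by auto
    fix d assume "d \<in> K"
    then obtain c where c: "c \<in> K" "d = a c" using aK by blast
    obtain u where u: "u \<in> U" "h c = c \<otimes> f u" using ext_mod_T_shift[OF h K KU U UT cf c(1)] by blast
    have m: "c \<in> W <#> K" "f u \<in> W <#> K" "f u \<in> W" using c u UW WK by auto
    have "k d = a c \<otimes> a (f u)" using ka[of c] c u UK F.M_mult[OF a(1) m(1,2)] by auto
    then have "inv d \<otimes> k d = a (f u)" using c F.M_fcar[OF a(1) m(1)] F.M_fcar[OF a(1) m(2)] by simp
    then show "inv d \<otimes> k d \<in> T" using m(3) a(2) W by auto
  qed
qed

text \<open>C_P(R) acts trivially on R and so satisfies the extension condition for every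
  automorphism g, with r = 1.\<close>

lemma aut_ext:
  assumes R: "F.nice R" "R \<subseteq> T" and g: "MF R g" "g ` R = R"
  shows "\<exists>h. MF (R <#> cen (carrier G) R) h \<and> (\<forall>x\<in>R. h x = g x)"
proof (rule F.rec_ext_prod[OF _ g])
  have Rs: "subgroup R G" using R by (simp add: F.nice_def)
  show "F.rec R" using R by (simp add: F.nice_def)
  show "subgroup (cen (carrier G) R) G" by (rule F.cenT_sub[OF Rs])
  show "cen (carrier G) R \<subseteq> nrm (carrier G) R" by (rule cen_nrm)
  fix d assume "d \<in> cen (carrier G) R"
  then have "\<forall>x\<in>R. g (cj d x) = cj \<one> (g x)" using F.M_fcar[OF g(1)] by (auto simp: cen_def)
  moreover have "\<one> \<in> nrm (carrier G) R" using subgroup.one_closed[OF F.nrmT_sub[OF Rs]] .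
  ultimately show "\<exists>r\<in>nrm (carrier G) R. \<forall>x\<in>R. g (cj d x) = cj r (g x)" by blast
qed

lemma F_nice_T: "F.nice T"
proof -
  obtain f where f: "MF T f" "F.nice (f ` T)" using Fsat T_sub T_le unfolding F.saturated_def by blast
  then show ?thesis using F_onto by simp
qed

lemma aut_ext_T: "MF T \<alpha> \<Longrightarrow> \<exists>h. MF (T <#> C) h \<and> (\<forall>x\<in>T. h x = \<alpha> x)"
  unfolding C_def by (rule aut_ext[OF F_nice_T subset_refl]) (auto simp: F_onto)

definition good :: "'a set \<Rightarrow> ('a \<Rightarrow> 'a) \<Rightarrow> bool" where
  "good U f \<longleftrightarrow> centric U \<and> ME U f \<and> ext_mod_T C U f"

lemma good_facts:
  assumes "good U f"
  shows "subgroup U G" "U \<subseteq> T" "centric U" "ME U f" "MF U f" "ext_mod_T C U f" "cen T (f ` U) \<subseteq> f ` U" "f ` U \<subseteq> T" "subgroup (f ` U) G" "centric (f ` U)"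
    "C \<subseteq> cen (carrier G) U" "C \<subseteq> cen (carrier G) (f ` U)"
proof -
  show *: "centric U" "ME U f" "ext_mod_T C U f" using assms by (auto simp: good_def)
  show "MF U f" by (rule EF[OF *(2)])
  show "subgroup U G" "U \<subseteq> T" using centricD * by auto
  show "cen T (f ` U) \<subseteq> f ` U" by (rule centricD(3)[OF *(1) \<open>MF U f\<close>])
  show fT: "f ` U \<subseteq> T" by (rule E.M_imgT[OF *(2)])
  show "subgroup (f ` U) G" by (rule E.M_img[OF *(2)])
  show "centric (f ` U)" by (rule centric_iso[OF \<open>MF U f\<close> *(1)])
  show "C \<subseteq> cen (carrier G) U" by (rule C_mono) fact
  show "C \<subseteq> cen (carrier G) (f ` U)" by (rule C_mono[OF fT])
qed

lemma good_cong: "good U f \<Longrightarrow> (\<And>x. x \<in> U \<Longrightarrow> f x = g x) \<Longrightarrow> good U g"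
  unfolding good_def by (metis E.M_cong ext_mod_T_cong)

lemma good_restrict: "good V f \<Longrightarrow> centric U \<Longrightarrow> U \<subseteq> V \<Longrightarrow> good U f"
  unfolding good_def
  using E.M_restrict[of V f U] ext_mod_T_restrict[of C V f C U] centricD(1,2)[of U] centricD(1,2)[of V] C_sub C_mono[of U] by simp

lemma good_comp: assumes f: "good U f" and g: "good (f ` U) g" shows "good U (\<lambda>x. g (f x))"
  unfolding good_def
  using good_facts[OF f] good_facts[OF g] E.M_comp[of U f g] ext_mod_T_comp[of C U f g] C_sub by simp

lemma good_inv: assumes f: "good U f" and g: "\<And>x. x \<in> U \<Longrightarrow> g (f x) = x" shows "good (f ` U) g"
  unfolding good_def
  using good_facts[OF f] E.M_inv[of U f g] ext_mod_T_inv[of C U f g] C_sub g by simp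

text \<open>T is receptive in F, so \<alpha> extends to T C; conjugation by this extension preserves
  triviality modulo T.\<close>

lemma good_auto: assumes f: "good U f" and a: "MF T \<alpha>" and g: "\<And>x. x \<in> U \<Longrightarrow> g (\<alpha> x) = \<alpha> (f x)"
  shows "good (\<alpha> ` U) g"
proof -
  note ff = good_facts[OF f]
  obtain h where h: "MF (T <#> C) h" "\<forall>x\<in>T. h x = \<alpha> x" using aut_ext_T[OF a] by blast
  have hT: "h ` T = T" using h(2) F_onto[OF a] by (metis (no_types, lifting) image_cong)
  have hU: "h ` U = \<alpha> ` U" using h(2) ff(2) by (intro image_cong) auto
  have "g (h x) = h (f x)" if x: "x \<in> U" for x
  proof -
    have "x \<in> T" "f x \<in> T" using x ff(2,8) by auto
    then show ?thesis using g[OF x] h(2) by simp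
  qed
  then have "ext_mod_T C (h ` U) g"
    by (rule ext_mod_T_transport[OF ff(6) h(1) hT T_sub subset_refl ff(2,8) C_def ff(1,7)])
  moreover have "ME (\<alpha> ` U) g" by (rule invar[OF ff(4) a ff(2,8) subset_refl g])
  moreover have "centric (\<alpha> ` U)" by (rule centric_iso[OF F.M_restrict[OF a ff(1,2)] ff(3)])
  ultimately show ?thesis using hU by (simp add: good_def)
qed

lemma good_conj: assumes t: "t \<in> T" shows "good T (cj t)"
  unfolding good_def ext_mod_T_def
proof (intro conjI exI[of _ "cj t"] ballI)
  show "centric T" by (rule centric_T)
  show "ME T (cj t)" by (rule E.M_conj[OF T_sub subset_refl t])
  have tc: "t \<in> carrier G" using t T_le by blast
  have TC: "subgroup (T <#> C) G" unfolding C_def by (rule F.UC_sub[OF T_sub])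
  show "MF (T <#> C) (cj t)" by (rule F.M_conj[OF TC subgroup.subset[OF TC] tc])
  fix c assume c: "c \<in> C"
  then have cc: "c \<in> carrier G" "cj c t = t" using t by (auto simp: C_def cen_def)
  then have "cj t c = c" using cj_swap tc by blast
  then show "inv c \<otimes> cj t c \<in> T" using cc subgroup.one_closed[OF T_sub] by simp
qed simp

text \<open>Pointwise agreement is built into both rules because morphisms are total functions with
  arbitrary values off the domain.\<close>

inductive M0 :: "'a set \<Rightarrow> ('a \<Rightarrow> 'a) \<Rightarrow> bool" where
  base: "good V f \<Longrightarrow> subgroup U G \<Longrightarrow> U \<subseteq> V \<Longrightarrow> (\<And>x. x \<in> U \<Longrightarrow> f x = g x) \<Longrightarrow> M0 U g"
| step: "M0 U f \<Longrightarrow> M0 (f ` U) g \<Longrightarrow> (\<And>x. x \<in> U \<Longrightarrow> g (f x) = k x) \<Longrightarrow> M0 U k"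

lemma M0_E: "M0 U f \<Longrightarrow> ME U f"
proof (induction rule: M0.induct)
  case (base V f U g)
  have "ME U f" by (rule E.M_restrict[OF good_facts(4)[OF base(1)] base(2,3)])
  then show ?case by (rule E.M_cong) (rule base(4))
next
  case (step U f g k)
  show ?case by (rule E.M_cong[OF E.M_comp[OF step(4,5)] step(3)])
qed

lemma M0_cong: "M0 U f \<Longrightarrow> (\<And>x. x \<in> U \<Longrightarrow> f x = g x) \<Longrightarrow> M0 U g"
proof (induction rule: M0.cases)
  case (base V f' U' f'')
  show ?case unfolding base(1)[symmetric]
    by (rule M0.base[OF base(3)]) (use base in auto)
next
  case (step U' f' g' k')
  show ?case by (rule M0.step[of _ f' g']) (use step in auto)
qed

lemma M0_restrict: "M0 U f \<Longrightarrow> subgroup V G \<Longrightarrow> V \<subseteq> U \<Longrightarrow> M0 V f"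
proof (induction arbitrary: V rule: M0.induct)
  case (base W f U g)
  show ?case by (rule M0.base[OF base(1) base(5)]) (use base in auto)
next
  case (step U f g k)
  have "subgroup (f ` V) G" by (rule E.M_img_sub[OF M0_E[OF step(1)] step(6,7)])
  then have "M0 (f ` V) g" using step(5) step(7) by blast
  then show ?case by (rule M0.step[OF step(4)[OF step(6,7)]]) (use step in auto)
qed

lemma M0_inv: "M0 U f \<Longrightarrow> (\<And>x. x \<in> U \<Longrightarrow> i (f x) = x) \<Longrightarrow> M0 (f ` U) i"
proof (induction arbitrary: i rule: M0.induct)
  case (base V f U g)
  have "good (f ` V) (inv_into V f)"
    by (rule good_inv[OF base(1)]) (use E.M_inj[OF good_facts(4)[OF base(1)]] in auto)
  moreover have gU: "g ` U = f ` U" using base(4) by (intro image_cong) auto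
  moreover have "subgroup (f ` U) G" by (rule E.M_img_sub[OF good_facts(4)[OF base(1)] base(2,3)])
  moreover have "inv_into V f y = i y" if y: "y \<in> f ` U" for y
  proof -
    obtain x where x: "x \<in> U" "y = f x" using y by auto
    then have "inv_into V f y = x" using base(3) E.M_inj[OF good_facts(4)[OF base(1)]] by auto
    then show ?thesis using x base(4,5) by metis
  qed
  ultimately show ?case unfolding gU using M0.base[of "f ` V" "inv_into V f" "f ` U" i] image_mono[OF base(3)] by metis
next
  case (step U f g k)
  have inj: "inj_on f U" "inj_on g (f ` U)" using E.M_inj M0_E step(1,2) by blast+
  have k: "k ` U = g ` f ` U" unfolding image_image using step(3) by (intro image_cong) auto
  have 1: "M0 (g ` f ` U) (inv_into (f ` U) g)" using step(5) inj by simp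
  have 2: "M0 (f ` U) (inv_into U f)" using step(4) inj by simp
  have "inv_into U f (inv_into (f ` U) g y) = i y" if y: "y \<in> g ` f ` U" for y
  proof -
    obtain x where x: "x \<in> U" "y = g (f x)" using y by auto
    then have "inv_into U f (inv_into (f ` U) g y) = x" using inj by simp
    then show ?thesis using step(3,6) x by metis
  qed
  moreover have "M0 (inv_into (f ` U) g ` g ` f ` U) (inv_into U f)" using 2 inj(2) by simp
  ultimately show ?case unfolding k by (rule_tac M0.step[OF 1]) auto
qed

lemma M0_conj: "subgroup U G \<Longrightarrow> U \<subseteq> T \<Longrightarrow> t \<in> T \<Longrightarrow> M0 U (cj t)"
  by (rule M0.base[OF good_conj]) auto

lemma M0_auto: "M0 U f \<Longrightarrow> MF T \<alpha> \<Longrightarrow> (\<And>x. x \<in> U \<Longrightarrow> g (\<alpha> x) = \<alpha> (f x)) \<Longrightarrow> M0 (\<alpha> ` U) g"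
proof (induction arbitrary: g rule: M0.induct)
  case (base V f U f')
  have VT: "V \<subseteq> T" by (rule good_facts(2)[OF base(1)])
  define k where "k y = \<alpha> (f (inv_into T \<alpha> y))" for y
  have ka: "k (\<alpha> x) = \<alpha> (f x)" if "x \<in> V" for x using that VT F.M_inj[OF base(5)] by (auto simp: k_def)
  have "good (\<alpha> ` V) k" by (rule good_auto[OF base(1,5) ka])
  moreover have "subgroup (\<alpha> ` U) G" by (rule F.M_img_sub[OF base(5,2)]) (use base VT in blast)
  ultimately show ?case by (rule M0.base) (use base ka in auto)
next
  case (step U f h f')
  have UT: "U \<subseteq> T" "f ` U \<subseteq> T" using E.M_dom E.M_imgT M0_E step(1) by blast+
  have inj: "inv_into T \<alpha> (\<alpha> x) = x" if "x \<in> T" for x using that F.M_inj[OF step(6)] by simp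
  define k where "k y = \<alpha> (f (inv_into T \<alpha> y))" for y
  define l where "l y = \<alpha> (h (inv_into T \<alpha> y))" for y
  have k: "k (\<alpha> x) = \<alpha> (f x)" if "x \<in> U" for x using that UT inj by (auto simp: k_def)
  have l: "l (\<alpha> x) = \<alpha> (h x)" if "x \<in> f ` U" for x using subsetD[OF UT(2) that] inj by (simp add: l_def)
  have "k ` \<alpha> ` U = \<alpha> ` f ` U" unfolding image_image using k by (intro image_cong) auto
  then have m: "M0 (k ` \<alpha> ` U) l" using step(5)[OF step(6), of l] l by simp
  have m2: "M0 (\<alpha> ` U) k" by (rule step(4)[OF step(6) k])
  show ?case by (rule M0.step[OF m2 m]) (use k l step(3,7) in auto)
qed

lemma fsys_M0: "fsys G p T M0"
proof (rule fsys.intro[OF finite_p_group_axioms fsys_axioms.intro])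
  show "subgroup T G" by (rule T_sub)
  show "M0 U f \<Longrightarrow> subgroup U G \<and> U \<subseteq> T" for U f by (rule E.M_dom[OF M0_E])
  show "M0 U f \<Longrightarrow> x \<in> U \<Longrightarrow> f x \<in> T" for U f x by (rule E.M_ran[OF M0_E])
  show "M0 U f \<Longrightarrow> x \<in> U \<Longrightarrow> y \<in> U \<Longrightarrow> f (x \<otimes> y) = f x \<otimes> f y" for U f x y by (rule E.M_mult[OF M0_E])
  show "M0 U f \<Longrightarrow> inj_on f U" for U f by (rule E.M_inj[OF M0_E])
  show "M0 U f \<Longrightarrow> (\<And>x. x \<in> U \<Longrightarrow> f x = g x) \<Longrightarrow> M0 U g" for U f g by (rule M0_cong)
  show "M0 U f \<Longrightarrow> subgroup V G \<Longrightarrow> V \<subseteq> U \<Longrightarrow> M0 V f" for U f V by (rule M0_restrict)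
  show "subgroup U G \<Longrightarrow> U \<subseteq> T \<Longrightarrow> t \<in> T \<Longrightarrow> M0 U (cj t)" for U t by (rule M0_conj)
  show "M0 U f \<Longrightarrow> M0 (f ` U) g \<Longrightarrow> M0 U (\<lambda>x. g (f x))" for U f g by (rule M0.step[of U f g]) simp_all
  show "M0 U f \<Longrightarrow> (\<And>x. x \<in> U \<Longrightarrow> g (f x) = x) \<Longrightarrow> M0 (f ` U) g" for U f g by (rule M0_inv)
qed

sublocale Z: fsys G p T M0 by (rule fsys_M0)

text \<open>Good morphisms are closed under composition and under restriction to centric subgroups,
  so generation adds nothing on a centric domain. In particular this holds for T, which is how the
  extension condition of normality is obtained.\<close>

lemma M0_good: "M0 U f \<Longrightarrow> centric U \<Longrightarrow> good U f"
proof (induction rule: M0.induct)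
  case (base V f U g)
  show ?case by (rule good_cong[OF good_restrict[OF base(1,5,3)] base(4)])
next
  case (step U f g k)
  have "centric (f ` U)" by (rule centric_iso[OF EF[OF M0_E[OF step(1)]] step(6)])
  then show ?case using good_comp[OF step(4)[OF step(6)] step(5)] good_cong[of U "\<lambda>x. g (f x)" k] step(3) by simp
qed

lemma good_M0: "good U f \<Longrightarrow> M0 U f"
  by (rule M0.base) (auto dest: good_facts)

text \<open>A good morphism has a centric domain, so its restriction to a non-centric U comes from a
  strictly larger group. Images of non-centric subgroups are non-centric, which keeps the induction
  going through composites.\<close>

lemma M0_gen:
  assumes "M0 U f" "\<not> centric U"
    and P1: "\<And>U f V. \<lbrakk>M0 V f; subgroup U G; U \<subset> V\<rbrakk> \<Longrightarrow> P U f"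
    and P2: "\<And>U f g. \<lbrakk>M0 U f; P U f; M0 (f ` U) g; P (f ` U) g\<rbrakk> \<Longrightarrow> P U (\<lambda>x. g (f x))"
    and P3: "\<And>U f g. \<lbrakk>P U f; M0 U f; \<And>x. x \<in> U \<Longrightarrow> f x = g x\<rbrakk> \<Longrightarrow> P U g"
  shows "P U f"
  using assms(1,2)
proof (induction rule: M0.induct)
  case (base V f U g)
  have f: "M0 V f" by (rule good_M0[OF base(1)])
  have "U \<subset> V" using base good_facts(3) by blast
  then have "P U f" by (rule P1[OF f base(2)])
  then show ?case by (rule P3[OF _ M0_restrict[OF f base(2,3)] base(4)])
next
  case (step U f g k)
  have "\<not> centric (f ` U)" using centric_iso'[OF EF[OF M0_E[OF step(1)]]] E.M_dom[OF M0_E[OF step(1)]] step(6) by blast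
  then have "P U (\<lambda>x. g (f x))" using P2[OF step(1) step(4)[OF step(6)] step(2) step(5)] by simp
  then show ?case by (rule P3[OF _ Z.M_comp[OF step(1,2)] step(3)])
qed

end

section \<open>Powers of automorphisms\<close>

lemma permset_pow:
  assumes A: "permset U \<A>" and a: "a \<in> \<A>"
  shows "a [^]\<^bsub>BijGroup U\<lparr>carrier := \<A>\<rparr>\<^esub> (n::nat) = restrict (a ^^ n) U"
proof (induction n)
  case 0
  then show ?case by (simp add: BijGroup_def restrict_def)
next
  case (Suc n)
  let ?A = "BijGroup U\<lparr>carrier := \<A>\<rparr>"
  interpret A: group ?A using subgroup.subgroup_is_group[OF permset_sub[OF A] group_BijGroup] .
  have sub: "\<A> \<subseteq> Bij U" using A by (auto simp: permset_def Bij_def bij_betw_def)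
  have "a [^]\<^bsub>?A\<^esub> n \<in> \<A>" using A.nat_pow_closed[of a n] a by simp
  then have "restrict (a ^^ n) U \<in> \<A>" unfolding Suc .
  then have m: "restrict (a ^^ n) U \<in> Bij U" "a \<in> Bij U" using a sub by blast+
  have aU: "a x \<in> U" if "x \<in> U" for x using that a A by (auto simp: permset_def)
  have "a [^]\<^bsub>?A\<^esub> Suc n = a [^]\<^bsub>?A\<^esub> n \<otimes>\<^bsub>?A\<^esub> a" by (rule A.nat_pow_Suc)
  also have "\<dots> = restrict (a ^^ n) U \<otimes>\<^bsub>?A\<^esub> a" unfolding Suc ..
  also have "\<dots> = compose U (restrict (a ^^ n) U) a" using m by (simp add: BijGroup_def)
  also have "\<dots> = restrict (a ^^ Suc n) U"
    using aU by (auto simp: compose_def restrict_def fun_eq_iff funpow_swap1)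
  finally show ?case .
qed

lemma permset_order:
  assumes U: "finite U" and A: "permset U \<A>" and a: "a \<in> \<A>"
  shows "\<forall>x\<in>U. (a ^^ card \<A>) x = x"
proof -
  let ?A = "BijGroup U\<lparr>carrier := \<A>\<rparr>"
  interpret A: group ?A using subgroup.subgroup_is_group[OF permset_sub[OF A] group_BijGroup] .
  have "a [^]\<^bsub>?A\<^esub> order ?A = \<one>\<^bsub>?A\<^esub>" by (rule A.pow_order_eq_1) (use a in simp)
  then have "restrict (a ^^ card \<A>) U = (\<lambda>x\<in>U. x)"
    using permset_pow[OF A a, of "card \<A>"] by (simp add: order_def BijGroup_def)
  then show ?thesis by (metis restrict_apply')
qed

text \<open>\<I> is a normal Sylow subgroup; m is its index, that is, the order of the
  quotient.\<close>

lemma permset_index_pow: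
  assumes p: "Factorial_Ring.prime (p::nat)" and U: "finite U" and A: "permset U \<A>" and I: "permset U \<I>" "\<I> \<subseteq> \<A>"
    and c: "card \<I> = p ^ multiplicity p (card \<A>)"
    and nrm: "\<And>a i. a \<in> \<A> \<Longrightarrow> i \<in> \<I> \<Longrightarrow> \<exists>j\<in>\<I>. \<forall>x\<in>U. a (i x) = j (a x)"
    and a: "a \<in> \<A>"
  shows "\<exists>m>0. \<not> p dvd m \<and> restrict (a ^^ m) U \<in> \<I>"
proof -
  let ?A = "BijGroup U\<lparr>carrier := \<A>\<rparr>"
  interpret A: group ?A using subgroup.subgroup_is_group[OF permset_sub[OF A] group_BijGroup] .
  have S: "subgroup \<I> ?A" by (rule permset_mono_sub[OF A I])
  have sub: "\<A> \<subseteq> Bij U" using A by (auto simp: permset_def Bij_def bij_betw_def)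
  have mul: "f \<otimes>\<^bsub>?A\<^esub> g = compose U f g" if "f \<in> \<A>" "g \<in> \<A>" for f g
    using that sub by (auto simp: BijGroup_def)
  have N: "\<I> \<lhd> ?A"
    unfolding A.normal_inv_iff
  proof (intro conjI ballI S)
    fix x h assume x: "x \<in> carrier ?A" and h: "h \<in> \<I>"
    have xA: "x \<in> \<A>" using x by simp
    have hA: "h \<in> carrier ?A" using h I by auto
    obtain j where j: "j\<in>\<I>" "\<forall>y\<in>U. x (h y) = j (x y)" using nrm[OF xA h] by blast
    have jA: "j \<in> carrier ?A" using j I by auto
    have "compose U x h = compose U j x" using j(2) by (auto simp: compose_def restrict_def fun_eq_iff)
    then have "x \<otimes>\<^bsub>?A\<^esub> h = j \<otimes>\<^bsub>?A\<^esub> x" using mul[OF xA] mul[of j x] h j(1) xA I(2) by (metis subsetD)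
    then have "x \<otimes>\<^bsub>?A\<^esub> h \<otimes>\<^bsub>?A\<^esub> inv\<^bsub>?A\<^esub> x = j"
      by (metis A.inv_solve_right' A.m_closed hA jA x)
    then show "x \<otimes>\<^bsub>?A\<^esub> h \<otimes>\<^bsub>?A\<^esub> inv\<^bsub>?A\<^esub> x \<in> \<I>" using j(1) by simp
  qed
  interpret N: normal \<I> ?A by (rule N)
  interpret Q: group "?A Mod \<I>" by (rule N.factorgroup_is_group)
  interpret h: group_hom ?A "?A Mod \<I>" "\<lambda>a. \<I> #>\<^bsub>?A\<^esub> a"
    using N.r_coset_hom_Mod by (simp add: group_hom_def group_hom_axioms_def A.group_axioms Q.group_axioms)
  define m where "m = card (rcosets\<^bsub>?A\<^esub> \<I>)"
  have l: "m * card \<I> = card \<A>" using A.lagrange[OF S] by (simp add: m_def order_def)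
  have pos: "card \<A> > 0" using permset_finite[OF U A] a by (auto simp: card_gt_0_iff)
  have m0: "m > 0" using l pos by (metis gr0I mult_0 not_less0)
  have "\<not> p dvd m"
  proof
    assume "p dvd m"
    then have "p ^ Suc (multiplicity p (card \<A>)) dvd card \<A>"
      using l c by (metis mult_dvd_mono dvd_refl power_Suc)
    then show False using pos p
      by (metis Suc_n_not_le_n multiplicity_geI not_prime_unit less_not_refl)
  qed
  moreover have "restrict (a ^^ m) U \<in> \<I>"
  proof -
    have aA: "a \<in> carrier ?A" using a by simp
    have "order (?A Mod \<I>) = m" by (simp add: order_def m_def FactGroup_def)
    then have "(\<I> #>\<^bsub>?A\<^esub> a) [^]\<^bsub>?A Mod \<I>\<^esub> m = \<one>\<^bsub>?A Mod \<I>\<^esub>" using Q.pow_order_eq_1[OF h.hom_closed[OF aA]] by simp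
    then have "\<I> #>\<^bsub>?A\<^esub> (a [^]\<^bsub>?A\<^esub> m) = \<I>" using h.hom_nat_pow[OF aA, of m] by (simp add: FactGroup_def)
    then have "a [^]\<^bsub>?A\<^esub> m \<in> \<I>" using A.rcos_self[OF A.nat_pow_closed[OF aA] S] by blast
    then show ?thesis using permset_pow[OF A a] by simp
  qed
  ultimately show ?thesis using m0 by blast
qed

context fsys
begin

lemma M_pow: "M Y f \<Longrightarrow> f ` Y = Y \<Longrightarrow> M Y (f ^^ n) \<and> (f ^^ n) ` Y = Y"
proof (induction n)
  case 0 then show ?case using M_id[of Y] M_dom[of Y f] by (simp add: id_def)
next
  case (Suc n)
  then have "M Y (\<lambda>x. f ((f ^^ n) x)) \<and> (\<lambda>x. f ((f ^^ n) x)) ` Y = Y" by (intro M_aut_comp) auto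
  then show ?case by (simp add: comp_def)
qed

lemma M_pow_in: "M Y f \<Longrightarrow> f ` Y = Y \<Longrightarrow> x \<in> Y \<Longrightarrow> (f ^^ n) x \<in> Y"
  using M_pow[of Y f n] by blast

text \<open>The order of Aut(Y) serves as an exponent, split into its p-part and the rest.\<close>

lemma M_order:
  assumes f: "M Y f" "f ` Y = Y"
  shows "\<exists>a m. m > 0 \<and> \<not> p dvd m \<and> (\<forall>x\<in>Y. (f ^^ (p ^ a * m)) x = x)"
proof -
  have Y: "subgroup Y G" "Y \<subseteq> T" using M_dom[OF f(1)] by auto
  let ?f = "restrict f Y"
  have fA: "?f \<in> auts Y" using f M_cong[OF f(1), of ?f] by (simp add: auts_def)
  have eq: "(?f ^^ n) x = (f ^^ n) x" if "x \<in> Y" for n x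
    using M_pow_in[OF f that] by (induction n) (auto simp: that)
  have pos: "card (auts Y) > 0" using finite_auts[OF Y] fA by (auto simp: card_gt_0_iff)
  obtain m where m: "card (auts Y) = p ^ multiplicity p (card (auts Y)) * m" "\<not> p dvd m"
    using multiplicity_decompose'[of "card (auts Y)" p] pos prime_p by (metis less_not_refl not_prime_unit)
  have "m > 0" using m pos by (metis gr0I mult_0_right)
  moreover have "(f ^^ card (auts Y)) x = x" if "x \<in> Y" for x
    using permset_order[OF fin_sub[OF Y(1)] permset_auts[OF Y] fA] eq[OF that] that by metis
  ultimately show ?thesis using m by metis
qed

text \<open>By maximality of its order, C_T(R) is mapped by e onto C_T(e(R)). Whatever centralizes
  the image of R C_T(R) centralizes e(R), and so lies in that image.\<close>

lemma nice_UC_centric: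
  assumes R: "nice R" and e: "M (R <#> cen T R) e"
  shows "cen T (e ` (R <#> cen T R)) \<subseteq> e ` (R <#> cen T R)"
proof -
  have Rs: "subgroup R G" "R \<subseteq> T" using R by (auto simp: nice_def)
  note L = UC_left[OF Rs(1)] and U = UC_right[OF Rs(1)]
  have eR: "M R e" by (rule M_restrict[OF e Rs(1) L])
  have s: "e ` cen T R \<subseteq> cen T (e ` R)" using M_cen[OF e L] U by blast
  have "card (cen T (e ` R)) \<le> card (cen T R)"
    by (rule nice_max(2)[OF R M_inv_into[OF eR] inv_img[OF eR subset_refl]])
  also have "\<dots> = card (e ` cen T R)" using M_card[OF e U] by simp
  finally have "e ` cen T R = cen T (e ` R)" by (intro card_seteq[OF fin_sub[OF cenT_sub[OF M_img[OF eR]]] s])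
  moreover have "cen T (e ` (R <#> cen T R)) \<subseteq> cen T (e ` R)" using L by (auto simp: cen_def)
  ultimately show ?thesis using U by blast
qed

end

section \<open>Decomposition over the generated subsystem, and its invariance\<close>

context weakly_normal_pair
begin

text \<open>Let V be an E-nice conjugate. In F some map from V onto R extends to N_P(V) and, T being
  strongly closed, takes N_T(V) into N_T(R). So T induces at least as much on R as on V, where it
  induces a Sylow subgroup.\<close>

lemma E_fa: assumes R: "F.nice R" "R \<subseteq> T" shows "E.fa R"
proof -
  have Rs: "subgroup R G" using R by (simp add: F.nice_def)
  obtain f where f: "ME R f" "E.nice (f ` R)" using Esat Rs R(2) unfolding E.saturated_def by blast
  let ?V = "f ` R"
  have V: "subgroup ?V G" "?V \<subseteq> T" "E.fa ?V" using f by (auto simp: E.nice_def)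
  have g: "MF ?V (inv_into R f)" "inv_into R f ` ?V = R"
    using F.M_inv_into[OF EF[OF f(1)]] F.inv_img[OF EF[OF f(1)] subset_refl] by auto
  obtain h where h: "MF (nrm (carrier G) ?V) h" "h ` ?V = R" using F.nice_ext[OF R(1) g] by blast
  have nsub: "nrm T ?V \<subseteq> nrm (carrier G) ?V" using T_le by (auto simp: nrm_def)
  have n: "subgroup (nrm T ?V) G" by (rule E.nrmT_sub[OF V(1)])
  have Vn: "?V \<subseteq> nrm (carrier G) ?V" by (rule self_nrm[OF subgroup_self V(1)]) (use V T_le in blast)
  have "h ` nrm T ?V \<subseteq> T" by (rule closed[OF F.M_restrict[OF h(1) n nsub] nrm_sub])
  moreover have "h ` nrm T ?V \<subseteq> nrm (carrier G) R" using F.M_nrm_img[OF h(1) V(1) Vn nsub nsub] h(2) by simp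
  ultimately have s: "h ` nrm T ?V \<subseteq> nrm T R" by (auto simp: nrm_def)
  have "p ^ multiplicity p (card (E.auts R)) = card (indu (nrm T ?V) ?V)"
    using V(3) E.card_auts[OF f(1)] by (simp add: E.fa_def)
  also have "\<dots> = card (indu (h ` nrm T ?V) R)" using F.card_indu_img[OF h(1) V(1) Vn nsub nsub] h(2) by simp
  also have "\<dots> \<le> card (indu (nrm T R) R)"
    by (rule card_mono[OF E.finite_indu[OF fin_sub[OF E.nrmT_sub[OF Rs]]] E.indu_mono[OF s]])
  finally show ?thesis using E.indu_bound[OF Rs R(2)] by (simp add: E.fa_def)
qed

definition mod_T_auts :: "'a set \<Rightarrow> ('a \<Rightarrow> 'a) set" where
  "mod_T_auts R = {a \<in> extensional R. ME R a \<and> a ` R = R \<and> ext_mod_T (cen (carrier G) R) R a}"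

text \<open>Aut_T(R) is Sylow here because the group lies between Aut_T(R) and Aut_E(R), and R is
  fully automized in E. Its elements are good since C lies in C_P(R). Stability under g in Aut_F(R)
  follows by extending g to R C_P(R).\<close>

lemma mod_T_auts_sylow:
  assumes R: "F.nice R" "R \<subseteq> T" and c: "centric R"
  shows "permset R (mod_T_auts R)" "indu (nrm T R) R \<subseteq> mod_T_auts R" "a \<in> mod_T_auts R \<Longrightarrow> M0 R a"
    "card (indu (nrm T R) R) = p ^ multiplicity p (card (mod_T_auts R))"
    "a \<in> mod_T_auts R \<Longrightarrow> MF R g \<Longrightarrow> g ` R = R \<Longrightarrow> F.tr R g a \<in> mod_T_auts R"
proof -
  have Rs: "subgroup R G" using R by (simp add: F.nice_def)
  let ?K = "cen (carrier G) R"
  have K: "subgroup ?K G" by (rule F.cenT_sub[OF Rs])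
  have cR: "cen T R \<subseteq> R" by (rule centric_cen[OF c])
  have KR: "subgroup (R <#> ?K) G" by (rule F.UC_sub[OF Rs])
  have ind: "ME R (cj t) \<and> cj t ` R = R \<and> ext_mod_T ?K R (cj t)" if t: "t \<in> nrm T R" for t
  proof (intro conjI)
    have tT: "t \<in> T" "t \<in> carrier G" using t nrm_sub T_le by blast+
    show "ME R (cj t)" by (rule E.M_conj[OF Rs R(2) tT(1)])
    show "cj t ` R = R" using t by (simp add: nrm_def)
    \<comment> \<open>T is normal in P, so the commutator of k and t is a product of two elements of
      T.\<close>
    have "inv k \<otimes> cj t k \<in> T" if k: "k \<in> ?K" for k
    proof -
      have kc: "k \<in> carrier G" using k cen_sub by blast
      have "inv k \<otimes> cj t k = cj k (inv t) \<otimes> t" using kc tT by (simp add: cj_def m_assoc)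
      moreover have "cj k (inv t) \<in> T" by (rule T_cj[OF kc subgroup.m_inv_closed[OF T_sub tT(1)]])
      ultimately show ?thesis using subgroup.m_closed[OF T_sub] tT by simp
    qed
    then show "ext_mod_T ?K R (cj t)" unfolding ext_mod_T_def
      using F.M_conj[OF KR subgroup.subset[OF KR] tT(2)] by blast
  qed
  show pL: "permset R (mod_T_auts R)" unfolding mod_T_auts_def
  proof (rule E.permset_sel[OF Rs R(2)])
    fix f g assume f: "ME R f \<and> f ` R = R \<and> ext_mod_T ?K R f" and eq: "\<And>x. x \<in> R \<Longrightarrow> f x = g x"
    have "f ` R = g ` R" using eq by (intro image_cong) auto
    then show "ME R g \<and> g ` R = R \<and> ext_mod_T ?K R g" using f E.M_cong[of R f g] ext_mod_T_cong[of ?K R f g] eq by simp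
  next
    show "ME R (\<lambda>x. x) \<and> (\<lambda>x. x) ` R = R \<and> ext_mod_T ?K R (\<lambda>x. x)"
    proof (intro conjI)
      show "ext_mod_T ?K R (\<lambda>x. x)" unfolding ext_mod_T_def
        using F.M_id[OF KR subgroup.subset[OF KR]] subgroup.one_closed[OF T_sub] cen_sub l_inv by fastforce
    qed (use E.M_id[OF Rs R(2)] in auto)
  next
    fix f g assume f: "ME R f \<and> f ` R = R \<and> ext_mod_T ?K R f" and g: "ME R g \<and> g ` R = R \<and> ext_mod_T ?K R g"
    then show "ME R (\<lambda>x. f (g x)) \<and> (\<lambda>x. f (g x)) ` R = R \<and> ext_mod_T ?K R (\<lambda>x. f (g x))"
      using E.M_aut_comp[of R f g] ext_mod_T_comp[of ?K R g f] K Rs R(2) cR by simp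
  next
    fix f assume f: "ME R f \<and> f ` R = R \<and> ext_mod_T ?K R f"
    then show "ME R (inv_into R f) \<and> inv_into R f ` R = R \<and> ext_mod_T ?K R (inv_into R f)"
      using E.M_aut_inv[of R f] ext_mod_T_inv[of ?K R f "inv_into R f"] K Rs R(2) cR E.M_inj[of R f] by simp
  qed simp
  show iL: "indu (nrm T R) R \<subseteq> mod_T_auts R"
  proof
    fix a assume "a \<in> indu (nrm T R) R"
    then obtain t where t: "t \<in> nrm T R" "a = restrict (cj t) R" by (auto simp: indu_def)
    show "a \<in> mod_T_auts R" using ind[OF t(1)] E.M_cong[of R "cj t" a] ext_mod_T_cong[of ?K R "cj t" a] t(2) by (simp add: mod_T_auts_def)
  qed
  show "M0 R a" if "a \<in> mod_T_auts R" for a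
  proof (rule good_M0)
    have a: "ME R a" "ext_mod_T ?K R a" using that by (auto simp: mod_T_auts_def)
    show "good R a" unfolding good_def
      using c a ext_mod_T_restrict[OF a(2) C_sub C_mono[OF R(2)] K C_mono[OF R(2)] Rs subset_refl Rs] by simp
  qed
  have LE: "mod_T_auts R \<subseteq> E.auts R" by (auto simp: mod_T_auts_def E.auts_def)
  show "card (indu (nrm T R) R) = p ^ multiplicity p (card (mod_T_auts R))"
    by (rule sylow_between[OF prime_p fin_sub[OF Rs] permset_indu[OF E.nrmT_sub[OF Rs] Rs subset_refl] pL
          E.permset_auts[OF Rs R(2)] iL LE]) (use E_fa[OF R] in \<open>simp add: E.fa_def\<close>)
  show "F.tr R g a \<in> mod_T_auts R" if a: "a \<in> mod_T_auts R" and g: "MF R g" "g ` R = R" for a g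
  proof -
    have a': "ME R a" "a ` R = R" "ext_mod_T ?K R a" using a by (auto simp: mod_T_auts_def)
    obtain h where h: "MF (R <#> ?K) h" "\<forall>x\<in>R. h x = g x" using aut_ext[OF R g] by blast
    have hR: "h ` R = R" using h(2) g(2) by (metis (no_types, lifting) image_cong)
    have t: "F.tr R g a (g x) = g (a x)" if "x \<in> R" for x by (rule F.tr_apply[OF F.M_inj[OF g(1)] that])
    have t2: "F.tr R g a (h x) = h (a x)" if x: "x \<in> R" for x
    proof -
      have "a x \<in> R" using x a'(2) by auto
      then show ?thesis using t[OF x] h(2) x by simp
    qed
    have "ext_mod_T ?K (h ` R) (F.tr R g a)"
      by (rule ext_mod_T_transport[OF a'(3) h(1) hR Rs R(2) subset_refl _ refl Rs _ t2]) (use a'(2) cR in auto)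
    moreover have "ME (g ` R) (F.tr R g a)"
      by (rule invar[OF a'(1) g(1) subset_refl _ R(2) t]) (use a'(2) in auto)
    moreover have "F.tr R g a ` R = R" using F.tr_M(2)[OF g(1) EF[OF a'(1)] a'(2)] g(2) by simp
    moreover have "F.tr R g a \<in> extensional R" using g(2) by (simp add: F.tr_def)
    ultimately show ?thesis using hR g(2) by (simp add: mod_T_auts_def)
  qed
qed

sublocale B: frattini_setup G p "carrier G" MF T M0
  by (rule frattini_setup.intro[OF finite_p_group_axioms frattini_setup_axioms.intro])
    (fact FF fsys_M0 T_le EF[OF M0_E] closed M0_auto)+

sublocale A: frattini_setup G p T ME T M0
  by (rule frattini_setup.intro[OF finite_p_group_axioms frattini_setup_axioms.intro])
    (fact EE fsys_M0 subset_refl M0_E E.M_imgT M0_auto[OF _ EF] | (erule E.M_imgT))+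

text \<open>\<open>frattini\<close> provides only that C_T(R) lies in R, while
  \<open>centric\<close> concerns all F-conjugates. A conjugate S is mapped onto R by some h on
  N_P(S); it sends S C_T(S) into R, and comparing orders shows that C_T(S) lies in S.\<close>

lemma F_frattini: "MF U f \<Longrightarrow> U \<subseteq> T \<Longrightarrow> B.dec U f"
proof (rule B.frattini[OF Fsat])
  fix R assume R: "F.nice R" "R \<subseteq> T" and cR: "cen T R \<subseteq> R"
  have Rs: "subgroup R G" using R by (simp add: F.nice_def)
  have "centric R" unfolding centric_def
  proof (intro conjI Rs R(2) allI impI)
    fix f assume f: "MF R f"
    let ?S = "f ` R"
    have S: "subgroup ?S G" "?S \<subseteq> T" using F.M_img[OF f] closed[OF f R(2)] by auto
    have g: "MF ?S (inv_into R f)" "inv_into R f ` ?S = R"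
      using F.M_inv_into[OF f] F.inv_img[OF f subset_refl] by auto
    obtain h where h: "MF (nrm (carrier G) ?S) h" "h ` ?S = R" using F.nice_ext[OF R(1) g] by blast
    have "cen T ?S \<subseteq> cen (carrier G) ?S" using T_le by (auto simp: cen_def)
    then have n: "cen T ?S \<subseteq> nrm (carrier G) ?S" using cen_nrm by blast
    have Sn: "?S \<subseteq> nrm (carrier G) ?S" by (rule self_nrm[OF subgroup_self S(1)]) (use S T_le in blast)
    have hT: "h ` cen T ?S \<subseteq> T" by (rule closed[OF F.M_restrict[OF h(1) E.cenT_sub[OF S(1)] n] cen_sub])
    have hc: "h ` cen T ?S \<subseteq> R"
    proof (rule image_subsetI)
      fix c assume c: "c \<in> cen T ?S"
      have "h c \<in> cen (carrier G) R" using F.M_cen[OF h(1) Sn subsetD[OF n c] c] h(2) by simp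
      moreover have "h c \<in> T" using hT c by blast
      ultimately show "h c \<in> R" using cR by (auto simp: cen_def)
    qed
    have sub: "?S <#> cen T ?S \<subseteq> nrm (carrier G) ?S" by (rule prod_least[OF F.nrmT_sub[OF S(1)] Sn n])
    have hSC: "MF (?S <#> cen T ?S) h" by (rule F.M_restrict[OF h(1) E.UC_sub[OF S(1)] sub])
    have "h ` (?S <#> cen T ?S) \<subseteq> R"
    proof clarify
      fix x assume "x \<in> ?S <#> cen T ?S"
      then obtain u c where x: "u \<in> ?S" "c \<in> cen T ?S" "x = u \<otimes> c" by (auto simp: prod_mem)
      have "h x = h u \<otimes> h c" using F.M_mult[OF hSC] x E.UC_left[OF S(1)] E.UC_right[OF S(1)] by blast
      moreover have "h u \<in> R" "h c \<in> R" using x hc h(2) by auto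
      ultimately show "h x \<in> R" using subgroup.m_closed[OF Rs] by simp
    qed
    then have "card (?S <#> cen T ?S) \<le> card ?S"
      using F.M_card[OF hSC subset_refl] card_mono[OF fin_sub[OF Rs]] F.M_card[OF f subset_refl] by metis
    then have "?S = ?S <#> cen T ?S"
      by (intro card_seteq[OF fin_sub[OF E.UC_sub[OF S(1)]] E.UC_left[OF S(1)]])
    then show "cen T ?S \<subseteq> ?S" using E.UC_right[OF S(1)] by blast
  qed
  from mod_T_auts_sylow[OF R this] show "\<exists>\<A>. permset R \<A> \<and> indu (nrm T R) R \<subseteq> \<A> \<and> (\<forall>a\<in>\<A>. M0 R a) \<and> card (indu (nrm T R) R) = p ^ multiplicity p (card \<A>) \<and>
        (\<forall>a\<in>\<A>. \<forall>g. MF R g \<longrightarrow> g ` R = R \<longrightarrow> F.tr R g a \<in> \<A>)"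
    by (intro exI[of _ "mod_T_auts R"]) simp
qed

text \<open>Write k as an \<open>M0\<close>-morphism e followed by \<alpha> in Aut_F(T). Conjugation
  by e stays in the system that e belongs to; conjugation by \<alpha> is
  \<open>M0_auto\<close>.\<close>

lemma M0_invar:
  assumes f: "M0 Q f" and k: "MF R k" and s: "Q \<subseteq> R" "f ` Q \<subseteq> R" "R \<subseteq> T" and g: "\<And>x. x \<in> Q \<Longrightarrow> g (k x) = k (f x)"
  shows "M0 (k ` Q) g"
proof -
  obtain e \<alpha> where e: "M0 R e" "MF T \<alpha>" "\<And>x. x \<in> R \<Longrightarrow> k x = \<alpha> (e x)"
    using F_frattini[OF k s(3)] by (auto simp: B.dec_def)
  have Qs: "subgroup Q G" "subgroup (f ` Q) G" using Z.M_dom[OF f] Z.M_img[OF f] by auto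
  have eQ: "M0 Q e" "M0 (f ` Q) e" by (rule Z.M_restrict[OF e(1) Qs(1) s(1)], rule Z.M_restrict[OF e(1) Qs(2) s(2)])
  define l where "l y = e (f (inv_into Q e y))" for y
  have le: "l (e x) = e (f x)" if "x \<in> Q" for x using that Z.M_inj[OF eQ(1)] by (simp add: l_def)
  have "M0 (e ` Q) l" by (rule Z.M_transport[OF eQ(1) f eQ(2) le])
  then have "M0 (\<alpha> ` e ` Q) g"
  proof (rule M0_auto[OF _ e(2)])
    fix y assume "y \<in> e ` Q"
    then obtain x where x: "x \<in> Q" "y = e x" by auto
    have "x \<in> R" "f x \<in> R" using x s by auto
    then show "g (\<alpha> y) = \<alpha> (l y)" using e(3) g[OF x(1)] le[OF x(1)] x(2) by metis
  qed
  moreover have "\<alpha> ` e ` Q = k ` Q" unfolding image_image using e(3) s(1) by (intro image_cong) auto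
  ultimately show ?thesis by simp
qed

text \<open>With invariance established, the group of all \<open>M0\<close>-automorphisms of R is
  normalized by Aut_E(R) and can serve as \<A>, in place of \<open>mod_T_auts\<close>.\<close>

lemma E_frattini: "ME U f \<Longrightarrow> U \<subseteq> T \<Longrightarrow> A.dec U f"
proof (rule A.frattini[OF Esat])
  fix R assume R: "E.nice R"
  have Rs: "subgroup R G" "R \<subseteq> T" "E.fa R" using R by (auto simp: E.nice_def)
  have i: "indu (nrm T R) R \<subseteq> Z.auts R" by (rule Z.indu_auts[OF Rs(1,2) subset_refl])
  have s: "Z.auts R \<subseteq> E.auts R" by (auto simp: Z.auts_def E.auts_def M0_E)
  have c: "card (indu (nrm T R) R) = p ^ multiplicity p (card (Z.auts R))"
    by (rule sylow_between[OF prime_p fin_sub[OF Rs(1)] permset_indu[OF E.nrmT_sub[OF Rs(1)] Rs(1) subset_refl]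
          Z.permset_auts[OF Rs(1,2)] E.permset_auts[OF Rs(1,2)] i s]) (use Rs in \<open>simp add: E.fa_def\<close>)
  have t: "E.tr R g a \<in> Z.auts R" if a: "a \<in> Z.auts R" and g: "ME R g" "g ` R = R" for a g
  proof -
    have a': "M0 R a" "a ` R = R" using a by (auto simp: Z.auts_def)
    have "M0 (g ` R) (E.tr R g a)"
      by (rule M0_invar[OF a'(1) EF[OF g(1)] subset_refl _ Rs(2)]) (use a' E.tr_apply[OF E.M_inj[OF g(1)]] in auto)
    then show ?thesis using E.tr_M(2)[OF g(1) M0_E[OF a'(1)] a'(2)] g(2) by (auto simp: Z.auts_def E.tr_def)
  qed
  show "\<exists>\<A>. permset R \<A> \<and> indu (nrm T R) R \<subseteq> \<A> \<and> (\<forall>a\<in>\<A>. M0 R a) \<and> card (indu (nrm T R) R) = p ^ multiplicity p (card \<A>) \<and>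
        (\<forall>a\<in>\<A>. \<forall>g. ME R g \<longrightarrow> g ` R = R \<longrightarrow> E.tr R g a \<in> \<A>)"
    by (intro exI[of _ "Z.auts R"] conjI) (use Z.permset_auts[OF Rs(1,2)] i c t in \<open>auto simp: Z.auts_def\<close>)
qed

end

section \<open>Coprime exponents and normal p-subgroups\<close>

lemma funpow_fix_mult: "(f ^^ a) x = x \<Longrightarrow> (f ^^ (a * k)) x = x"
  by (induction k) (auto simp: funpow_add)

lemma funpow_mod_fix: "(f ^^ a) x = x \<Longrightarrow> (f ^^ (a * k + l)) x = (f ^^ l) x"
  using funpow_fix_mult[of a f x k] by (simp add: add.commute[of "a * k"] funpow_add)

lemma funpow_coprime_fix:
  assumes "(f ^^ a) x = x" "(f ^^ b) x = x" "coprime a b" "a \<noteq> (0::nat)"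
  shows "f x = x"
proof -
  obtain u v where "a * u = b * v + 1" using bezout_nat[OF assms(4), of b] assms(3) by auto
  then show ?thesis using funpow_fix_mult[OF assms(1), of u] funpow_mod_fix[OF assms(2), of v 1] by simp
qed

lemma funpow_cong_on: "(\<And>x. x \<in> Y \<Longrightarrow> f x = g x \<and> f x \<in> Y) \<Longrightarrow> x \<in> Y \<Longrightarrow> (f ^^ n) x = (g ^^ n) x"
proof (induction n arbitrary: x)
  case (Suc n) then show ?case by (metis funpow_Suc_right comp_apply)
qed simp

text \<open>Otherwise another prime q divides the order, and a nontrivial element of a Sylow
  q-subgroup would be killed by two coprime exponents.\<close>

lemma permset_p_power:
  assumes p: "Factorial_Ring.prime (p::nat)" and V: "finite V" and K: "permset V K"
    and e: "\<And>k x. k \<in> K \<Longrightarrow> x \<in> V \<Longrightarrow> (k ^^ (p ^ n)) x = x"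
  shows "\<exists>m. card K = p ^ m"
proof (rule ccontr)
  assume *: "\<not> ?thesis"
  have nz: "card K \<noteq> 0" using permset_finite[OF V K] K by (auto simp: permset_def)
  obtain q where q: "Factorial_Ring.prime q" "q dvd card K" "q \<noteq> p"
    using Ex_other_prime_factor[OF nz _ p] * by auto
  obtain S where S: "permset V S" "S \<subseteq> K" "card S = q ^ multiplicity q (card K)"
    using permset_sylow_exists[OF q(1) V K] by blast
  have "multiplicity q (card K) \<noteq> 0" using q nz by (metis not_dvd_imp_multiplicity_0 multiplicity_eq_zero_iff not_prime_unit)
  then have "card S > 1" using S(3) q(1) prime_gt_1_nat one_less_power by (metis gr0I)
  then have "S \<noteq> {\<lambda>x\<in>V. x}" by auto
  moreover have "(\<lambda>x\<in>V. x) \<in> S" using S(1) by (simp add: permset_def)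
  ultimately obtain s where s: "s \<in> S" "s \<noteq> (\<lambda>x\<in>V. x)" by blast
  have "s x = x" if x: "x \<in> V" for x
  proof (rule funpow_coprime_fix)
    show "(s ^^ card S) x = x" using permset_order[OF V S(1) s(1)] x by blast
    show "(s ^^ (p ^ n)) x = x" using e S(2) s(1) x by blast
    show "coprime (card S) (p ^ n)" unfolding S(3) using primes_coprime[OF q(1) p q(3)] by simp
    show "card S \<noteq> 0" using \<open>card S > 1\<close> by simp
  qed
  moreover have "s \<in> extensional V" using S(1) s(1) by (simp add: permset_def)
  ultimately have "s = (\<lambda>x\<in>V. x)" by (intro extensionalityI[of _ V]) auto
  then show False using s by simp
qed

context finite_p_group
begin

lemma sub_pow: "subgroup W G \<Longrightarrow> z \<in> W \<Longrightarrow> z [^] (n::nat) \<in> W"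
  by (induction n) (auto simp: subgroup.one_closed subgroup.m_closed)

end

context fsys
begin

text \<open>Some conjugate of K lies in the Sylow subgroup Aut_T(V), and normality makes this K
  itself.\<close>

lemma normal_p_indu:
  assumes V: "nice V" and K: "permset V K" "K \<subseteq> auts V" "card K = p ^ n"
    and nrm: "\<And>a k. a \<in> auts V \<Longrightarrow> k \<in> K \<Longrightarrow> \<exists>j\<in>K. \<forall>x\<in>V. k (a x) = a (j x)"
    and k: "k \<in> K"
  shows "\<exists>r\<in>nrm T V. \<forall>x\<in>V. k x = cj r x"
proof -
  have Vs: "subgroup V G" "V \<subseteq> T" "fa V" using V by (auto simp: nice_def)
  obtain a where a: "a\<in>auts V" "\<And>d. d\<in>K \<Longrightarrow> \<exists>s\<in>indu (nrm T V) V. \<forall>x\<in>V. a (d x) = s (a x)"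
    using auts_sylow_conj[OF Vs K] by blast
  have aV: "a ` V = V" using a by (simp add: auts_def)
  obtain j where j: "j \<in> K" "\<forall>x\<in>V. k (a x) = a (j x)" using nrm[OF a(1) k] by blast
  obtain s where s: "s\<in>indu (nrm T V) V" "\<forall>x\<in>V. a (j x) = s (a x)" using a(2)[OF j(1)] by blast
  obtain r where r: "r \<in> nrm T V" "s = restrict (cj r) V" using s by (auto simp: indu_def)
  have "k y = cj r y" if y: "y \<in> V" for y
  proof -
    obtain x where x: "x \<in> V" "y = a x" using y aV by auto
    then show ?thesis using j(2) s(2) r(2) y by simp
  qed
  then show ?thesis using r by blast
qed

end

section \<open>Passing goodness from a centric subgroup to T\<close>

context weakly_normal_pair
begin

text \<open>Automorphisms acting trivially on \<open>W = V \<inter> T\<close> and modulo \<open>W\<close> form a normal \<open>p\<close>-subgroup.\<close>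

lemma stabilizing_auts_induced:
  assumes V: "F.nice V" and W: "subgroup W G" "W = V \<inter> T"
    and k: "MF V k" "k ` V = V" "\<And>w. w \<in> W \<Longrightarrow> k w = w" "\<And>x. x \<in> V \<Longrightarrow> inv x \<otimes> k x \<in> W"
  shows "\<exists>r\<in>nrm (carrier G) V. \<forall>x\<in>V. k x = cj r x"
proof -
  have Vs: "subgroup V G" "V \<subseteq> carrier G" using V by (auto simp: F.nice_def)
  have WV: "W \<subseteq> V" using W by blast
  have car: "x \<in> carrier G" if "x \<in> V" for x using that Vs by blast
  define Q where "Q k \<longleftrightarrow> MF V k \<and> k ` V = V \<and> (\<forall>w\<in>W. k w = w) \<and> (\<forall>x\<in>V. inv x \<otimes> k x \<in> W)" for k
  define K where "K = {k \<in> extensional V. Q k}"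
  have Qz: "\<exists>z\<in>W. k x = x \<otimes> z" if "Q k" "x \<in> V" for k x
  proof (intro bexI)
    show "inv x \<otimes> k x \<in> W" using that by (simp add: Q_def)
    have "k x \<in> V" using that by (auto simp: Q_def)
    then show "k x = x \<otimes> (inv x \<otimes> k x)" using car that by simp
  qed
  have QI: "Q k" if "MF V k" "k ` V = V" "\<And>w. w \<in> W \<Longrightarrow> k w = w" "\<And>x. x \<in> V \<Longrightarrow> \<exists>z\<in>W. k x = x \<otimes> z" for k
  proof -
    have "inv x \<otimes> k x \<in> W" if x: "x \<in> V" for x
    proof -
      obtain z where z: "z \<in> W" "k x = x \<otimes> z" using \<open>\<And>x. x \<in> V \<Longrightarrow> \<exists>z\<in>W. k x = x \<otimes> z\<close>[OF x] by blast
      then show ?thesis using car x WV by auto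
    qed
    then show ?thesis using that by (simp add: Q_def)
  qed
  have Qk: "Q k" using k by (simp add: Q_def)
  have mulV: "k (x \<otimes> z) = k x \<otimes> z" if "Q k" "x \<in> V" "z \<in> W" for k x z
    using that F.M_mult[of V k x z] WV by (auto simp: Q_def)
  have pK: "permset V K" unfolding K_def
  proof (rule F.permset_sel[OF Vs])
    fix f g assume f: "Q f" and eq: "\<And>x. x \<in> V \<Longrightarrow> f x = g x"
    have "f ` V = g ` V" using eq by (intro image_cong) auto
    moreover have "MF V g" using f F.M_cong[of V f g] eq by (simp add: Q_def)
    moreover have "\<And>w. w \<in> W \<Longrightarrow> f w = g w" using eq WV by blast
    ultimately show "Q g" using f eq unfolding Q_def by simp
  next
    show "Q (\<lambda>x. x)" by (rule QI) (use F.M_id[OF Vs] subgroup.one_closed[OF W(1)] car in force)+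
  next
    fix f g assume f: "Q f" and g: "Q g"
    show "Q (\<lambda>x. f (g x))"
    proof (rule QI)
      have "MF V (\<lambda>x. f (g x)) \<and> (\<lambda>x. f (g x)) ` V = V" using f g by (intro F.M_aut_comp) (auto simp: Q_def)
      then show "MF V (\<lambda>x. f (g x))" "(\<lambda>x. f (g x)) ` V = V" by auto
      show "f (g w) = w" if "w \<in> W" for w using f g that by (simp add: Q_def)
      fix x assume x: "x \<in> V"
      obtain z where z: "z \<in> W" "g x = x \<otimes> z" using Qz[OF g x] by blast
      obtain y where y: "y \<in> W" "f x = x \<otimes> y" using Qz[OF f x] by blast
      have "f (g x) = x \<otimes> (y \<otimes> z)" using mulV[OF f x z(1)] z y car x WV by (simp add: m_assoc subset_iff)
      then show "\<exists>z\<in>W. f (g x) = x \<otimes> z" using subgroup.m_closed[OF W(1) y(1) z(1)] by blast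
    qed
  next
    fix f assume f: "Q f"
    have fV: "MF V f" "f ` V = V" "inj_on f V" using f F.M_inj by (auto simp: Q_def)
    show "Q (inv_into V f)"
    proof (rule QI)
      show "MF V (inv_into V f)" "inv_into V f ` V = V" using F.M_aut_inv[OF fV(1,2)] by auto
      show "inv_into V f w = w" if w: "w \<in> W" for w
        using f w fV(3) WV inv_into_f_f[of f V w] by (auto simp: Q_def)
      fix x assume x: "x \<in> V"
      obtain z where z: "z \<in> W" "f x = x \<otimes> z" using Qz[OF f x] by blast
      have zi: "inv z \<in> W" by (rule subgroup.m_inv_closed[OF W(1) z(1)])
      have "f (x \<otimes> inv z) = x" using mulV[OF f x zi] z car x WV by (auto simp: m_assoc)
      moreover have "x \<otimes> inv z \<in> V" using subgroup.m_closed[OF Vs(1) x] zi WV by blast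
      ultimately have "inv_into V f x = x \<otimes> inv z" using fV(3) by (metis inv_into_f_f)
      then show "\<exists>z\<in>W. inv_into V f x = x \<otimes> z" using zi by blast
    qed
  qed (simp add: Q_def)
  have KA: "K \<subseteq> F.auts V" by (auto simp: K_def Q_def F.auts_def)
  obtain N where N: "order G = p ^ N" using order_p_power by blast
  have "\<exists>n. card K = p ^ n"
  proof (rule permset_p_power[OF prime_p fin_sub[OF Vs(1)] pK])
    fix f x assume "f \<in> K" and x: "x \<in> V"
    then have f: "Q f" by (simp add: K_def)
    obtain z where z: "z \<in> W" "f x = x \<otimes> z" using Qz[OF f x] by blast
    have zc: "z \<in> carrier G" using z WV car by blast
    \<comment> \<open>f fixes z, so its powers translate x by powers of z. The order of the p-group
      G is therefore an exponent for every element of K.\<close>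
    have "(f ^^ n) x = x \<otimes> z [^] n" for n
    proof (induction n)
      case 0 then show ?case using car[OF x] by simp
    next
      case (Suc n)
      have "(f ^^ Suc n) x = f x \<otimes> z [^] n" using Suc mulV[OF f x sub_pow[OF W(1) z(1)]] by simp
      also have "\<dots> = x \<otimes> (z \<otimes> z [^] n)" using z zc car[OF x] by (simp add: m_assoc)
      also have "\<dots> = x \<otimes> z [^] Suc n" unfolding nat_pow_Suc2[OF zc] ..
      finally show ?case .
    qed
    then have "(f ^^ order G) x = x" using pow_order_eq_1[OF zc] car[OF x] by simp
    then show "(f ^^ p ^ N) x = x" by (simp add: N)
  qed
  then obtain n where n: "card K = p ^ n" by blast
  \<comment> \<open>W is the whole intersection of V with the strongly closed T, so Aut_F(V)
    preserves it; this makes K normal in Aut_F(V).\<close>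
  have aW: "a ` W = W" if a: "a \<in> F.auts V" for a
  proof (rule card_seteq[OF fin_sub[OF W(1)]])
    have aV: "MF V a" "a ` V = V" using a by (auto simp: F.auts_def)
    have "a ` W \<subseteq> T" by (rule closed[OF F.M_restrict[OF aV(1) W(1) WV]]) (use W in blast)
    then show "a ` W \<subseteq> W" using aV WV W(2) by blast
    show "card W \<le> card (a ` W)" using F.M_card[OF aV(1) WV] by simp
  qed
  have "\<exists>r\<in>nrm (carrier G) V. \<forall>x\<in>V. restrict k V x = cj r x"
  proof (rule F.normal_p_indu[OF V pK KA n])
    have "Q (restrict k V)"
      by (rule QI) (use Qk Qz[OF Qk] F.M_cong[of V k "restrict k V"] WV in \<open>auto simp: Q_def\<close>)
    then show "restrict k V \<in> K" by (simp add: K_def)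
    fix a f assume a: "a \<in> F.auts V" and "f \<in> K"
    then have f: "Q f" by (simp add: K_def)
    have aV: "MF V a" "a ` V = V" "inj_on a V" using a F.M_inj by (auto simp: F.auts_def)
    define j where "j x = inv_into V a (f (a x))" for x
    have aj: "a (j x) = f (a x)" if "x \<in> V" for x
    proof -
      have "f (a x) \<in> a ` V" using that aV f by (auto simp: Q_def)
      then show ?thesis unfolding j_def by (rule f_inv_into_f)
    qed
    have fa: "MF V (\<lambda>x. f (a x)) \<and> (\<lambda>x. f (a x)) ` V = V" by (rule F.M_aut_comp) (use f aV in \<open>auto simp: Q_def\<close>)
    have j: "MF V j \<and> j ` V = V" unfolding j_def
      by (rule F.M_aut_comp) (use fa F.M_aut_inv[OF aV(1,2)] in auto)
    have "Q j"
    proof (rule QI)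
      show "j w = w" if w: "w \<in> W" for w
      proof -
        have "a w \<in> W" using aW[OF a] w by blast
        then have "f (a w) = a w" using f by (simp add: Q_def)
        then show ?thesis unfolding j_def using aV(3) w WV by (simp add: subset_iff)
      qed
      fix x assume x: "x \<in> V"
      have ax: "a x \<in> V" using x aV by blast
      obtain z where z: "z \<in> W" "f (a x) = a x \<otimes> z" using Qz[OF f ax] by blast
      obtain y where y: "y \<in> W" "z = a y" using aW[OF a] z by blast
      have yV: "y \<in> V" using y WV by blast
      have "f (a x) = a (x \<otimes> y)" using z y F.M_mult[OF aV(1) x yV] by simp
      then have "j x = x \<otimes> y" unfolding j_def using aV(3) subgroup.m_closed[OF Vs(1) x yV] by simp
      then show "\<exists>z\<in>W. j x = x \<otimes> z" using y by blast
    qed (use j in auto)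
    then have "Q (restrict j V)"
      using Qz[of j] F.M_cong[of V j "restrict j V"] WV by (intro QI) (auto simp: Q_def)
    then have "restrict j V \<in> K" by (simp add: K_def)
    then show "\<exists>j\<in>K. \<forall>x\<in>V. f (a x) = a (j x)" using aj by (intro bexI[of _ "restrict j V"]) auto
  qed
  then show ?thesis by simp
qed

text \<open>One step climbs from U to U' = N_T(U), inside a nice conjugate V of U C. Elements of U'
  act on U C trivially modulo U, and b is trivial on U, so the commutator of the two actions is
  trivial on U and modulo U. By \<open>stabilizing_auts_induced\<close> it is a conjugation, hence b
  extends over U'. A suitable power of the extension still induces b and fixes U' pointwise.\<close>

lemma extends_over_T:
  "\<lbrakk>centric U; MF (U <#> C) b; b ` (U <#> C) = U <#> C; \<And>x. x \<in> U \<Longrightarrow> b x = x; m > 0; \<not> p dvd m; \<And>x. x \<in> U <#> C \<Longrightarrow> (b ^^ m) x = x\<rbrakk>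
    \<Longrightarrow> \<exists>b'. MF (T <#> C) b' \<and> b' ` (T <#> C) = T <#> C \<and> (\<forall>x\<in>T. b' x = x) \<and> (\<forall>x\<in>U <#> C. b' x = b x)"
proof (induction "card T - card U" arbitrary: U b rule: less_induct)
  case less
  note b = less.prems(2,3) and bU = less.prems(4) and m = less.prems(5,6) and bm = less.prems(7)
  have U: "subgroup U G" "U \<subseteq> T" "cen T U \<subseteq> U" using centricD less.prems(1) centric_cen by auto
  show ?case
  proof (cases "U = T")
    case True then show ?thesis using less.prems by blast
  next
    case False
    define V0 where "V0 = U <#> C"
    have CU: "C \<subseteq> cen (carrier G) U" by (rule C_mono[OF U(2)])
    have V0: "subgroup V0 G" unfolding V0_def by (rule prod_sub[OF U(1) C_sub CU])
    have V0c: "V0 \<subseteq> carrier G" by (rule subgroup.subset[OF V0])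
    have UV: "U \<subseteq> V0" and CV: "C \<subseteq> V0" unfolding V0_def by (rule prod_left[OF U(1) C_sub], rule prod_right[OF U(1) C_sub])
    have b0: "MF V0 b" "b ` V0 = V0" "\<And>x. x \<in> V0 \<Longrightarrow> (b ^^ m) x = x" using b bm by (auto simp: V0_def)
    define U' where "U' = nrm T U"
    have U': "subgroup U' G" "U' \<subseteq> T" "U \<subseteq> U'" unfolding U'_def
      by (rule E.nrmT_sub[OF U(1)], rule nrm_sub, rule self_nrm[OF T_sub U(1,2)])
    have UU: "U \<subset> U'" using normalizer_grows[OF T_sub U(1,2) False] U'(3) by (auto simp: U'_def)
    have CU': "C \<subseteq> cen (carrier G) U'" by (rule C_mono[OF U'(2)])
    define Y where "Y = U' <#> C"
    have Y: "subgroup Y G" unfolding Y_def by (rule prod_sub[OF U'(1) C_sub CU'])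
    have U'Y: "U' \<subseteq> Y" and CY: "C \<subseteq> Y" unfolding Y_def by (rule prod_left[OF U'(1) C_sub], rule prod_right[OF U'(1) C_sub])
    have VY: "V0 \<subseteq> Y" unfolding V0_def Y_def by (rule mono_set_mult[OF U'(3) subset_refl])
    have carU': "s \<in> carrier G" if "s \<in> U'" for s using that U'(2) T_le by blast
    have sC: "cj s c = c" if "s \<in> T" "c \<in> C" for s c
    proof -
      have "cj c s = s" "c \<in> carrier G" using that by (auto simp: C_def cen_def)
      then show ?thesis using cj_swap[of c s] that T_le by blast
    qed
    \<comment> \<open>s commutes with c, and the commutator w of u and s lies in U, where c acts
      trivially.\<close>
    have modU: "inv x \<otimes> cj s x \<in> U" if s: "s \<in> U'" and x: "x \<in> V0" for s x
    proof -
      obtain u c where uc: "u \<in> U" "c \<in> C" "x = u \<otimes> c" using x by (auto simp: V0_def prod_mem)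
      have car: "u \<in> carrier G" "c \<in> carrier G" "s \<in> carrier G"
        using uc U(2) T_le C_sub sub_mem carU'[OF s] by blast+
      have su: "cj s u \<in> U" using s uc by (auto simp: U'_def nrm_def)
      define w where "w = inv u \<otimes> cj s u"
      have w: "w \<in> U" unfolding w_def using subgroup.m_closed[OF U(1) subgroup.m_inv_closed[OF U(1) uc(1)] su] .
      have wc: "w \<in> carrier G" using w U(2) T_le by blast
      have "cj s x = cj s u \<otimes> c" using uc car sC[of s c] s U'(2) by (simp add: cj_mult subset_iff)
      then have "inv x \<otimes> cj s x = cj c w" using uc car by (simp add: cj_def w_def inv_mult_group m_assoc)
      also have "\<dots> = w" using CU uc w by (auto simp: cen_def)
      finally show ?thesis using w by simp
    qed
    have U'n: "U' \<subseteq> nrm (carrier G) V0"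
    proof
      fix s assume s: "s \<in> U'"
      show "s \<in> nrm (carrier G) V0"
      proof (rule nrmI[OF carU'[OF s] subgroup_self V0])
        fix x assume x: "x \<in> V0"
        have "inv x \<otimes> cj s x \<in> V0" using modU[OF s x] UV by blast
        then have "x \<otimes> (inv x \<otimes> cj s x) \<in> V0" using subgroup.m_closed[OF V0 x] by blast
        then show "cj s x \<in> V0" using x V0c carU'[OF s] by (simp add: subset_iff)
      qed
    qed
    have V0n: "V0 \<subseteq> nrm (carrier G) V0" by (rule self_nrm[OF subgroup_self V0 V0c])
    obtain q where q: "MF (nrm (carrier G) V0) q" "F.nice (q ` V0)" using F.nice_rep[OF Fsat V0 V0c] by blast
    have Yn: "Y \<subseteq> nrm (carrier G) V0" unfolding Y_def
      by (rule prod_least[OF F.nrmT_sub[OF V0] U'n]) (use CV V0n in blast)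
    have qY: "MF Y q" by (rule F.M_restrict[OF q(1) Y Yn])
    have qV: "MF V0 q" by (rule F.M_restrict[OF q(1) V0 V0n])
    have qi: "inv_into Y q (q x) = x" if "x \<in> Y" for x using that F.M_inj[OF qY] by simp
    define V where "V = q ` V0"
    define W where "W = q ` U"
    define W1 where "W1 = q ` U'"
    have V: "subgroup V G" "F.nice V" using F.M_img[OF qV] q(2) by (auto simp: V_def)
    have W: "subgroup W G" and W1: "subgroup W1 G"
      unfolding W_def W1_def by (rule F.M_img_sub[OF qY U(1)], use UV VY in blast, rule F.M_img_sub[OF qY U'(1) U'Y])
    have qU: "MF U q" and qU': "MF U' q"
      by (rule F.M_restrict[OF qV U(1) UV], rule F.M_restrict[OF qY U'(1) U'Y])
    have WT: "W \<subseteq> T" "W1 \<subseteq> T" unfolding W_def W1_def by (rule closed[OF qU U(2)], rule closed[OF qU' U'(2)])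
    have WV: "W \<subseteq> V" and WW1: "W \<subseteq> W1" using UV U'(3) by (auto simp: W_def V_def W1_def)
    \<comment> \<open>q and its inverse respect T, and U C meets T only in U because C_T(U) is
      contained in U.\<close>
    have VT: "W = V \<inter> T"
    proof
      show "V \<inter> T \<subseteq> W"
      proof
        fix y assume y: "y \<in> V \<inter> T"
        then obtain v where v: "v \<in> V0" "y = q v" by (auto simp: V_def)
        have s: "subgroup (V \<inter> T) G" by (rule subgroups_Inter_pair[OF V(1) T_sub])
        have "MF (V \<inter> T) (inv_into V0 q)"
          by (rule F.M_restrict[OF F.M_inv_into[OF qV] s]) (auto simp: V_def)
        from closed[OF this] have "inv_into V0 q y \<in> T" using y by blast
        then have vT: "v \<in> T" using v F.M_inj[OF qV] by simp
        obtain u c where uc: "u \<in> U" "c \<in> C" "v = u \<otimes> c" using v by (auto simp: V0_def prod_mem)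
        have car: "u \<in> carrier G" "c \<in> carrier G" using uc U(2) T_le C_sub sub_mem by blast+
        have "c = inv u \<otimes> v" using uc car by simp
        then have "c \<in> T" using subgroup.m_closed[OF T_sub subgroup.m_inv_closed[OF T_sub] vT] uc(1) U(2) by blast
        then have "c \<in> cen T U" using CU uc(2) by (auto simp: cen_def)
        then have "v \<in> U" using uc subgroup.m_closed[OF U(1)] U(3) by blast
        then show "y \<in> W" using v by (simp add: W_def)
      qed
    qed (use WV WT in blast)
    define \<beta> where "\<beta> y = q (b (inv_into V0 q y))" for y
    have \<beta>q: "\<beta> (q x) = q (b x)" if "x \<in> V0" for x using that F.M_inj[OF qV] by (simp add: \<beta>_def)
    have qbV: "MF (b ` V0) q" using qV b0(2) by simp
    have \<beta>: "MF V \<beta>" unfolding V_def by (rule F.M_transport[OF qV b0(1) qbV \<beta>q])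
    have \<beta>V: "\<beta> ` V = V"
    proof -
      have "\<beta> ` V = q ` b ` V0" unfolding V_def image_image using \<beta>q by (intro image_cong) auto
      then show ?thesis using b0(2) by (simp add: V_def)
    qed
    have \<beta>W: "\<beta> w = w" if "w \<in> W" for w using that \<beta>q UV bU by (auto simp: W_def)
    have Vcar: "x \<in> carrier G" if "x \<in> V" for x using that V(1) sub_mem by blast
    have W1car: "x \<in> carrier G" if "x \<in> W1" for x using that W1 sub_mem by blast
    have W1n: "W1 \<subseteq> nrm (carrier G) V" unfolding W1_def V_def
      by (rule F.M_nrm_img[OF q(1) V0 V0n U'n U'n])
    have modW: "\<exists>z\<in>W. cj d y = y \<otimes> z" if d: "d \<in> W1" and y: "y \<in> V" for d y
    proof -
      obtain s where s: "s \<in> U'" "d = q s" using d by (auto simp: W1_def)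
      obtain x where x: "x \<in> V0" "y = q x" using y by (auto simp: V_def)
      have xY: "x \<in> Y" "s \<in> Y" "cj s x \<in> V0" using x s VY U'Y nrmD[OF subsetD[OF U'n s(1)] x(1)] by auto
      have z: "inv x \<otimes> cj s x \<in> U" by (rule modU[OF s(1) x(1)])
      have "cj d y = q (cj s x)" using F.M_cj_eq[OF qY xY(1,2)] s x by simp
      also have "cj s x = x \<otimes> (inv x \<otimes> cj s x)" using x(1) xY(3) V0c by (simp add: subset_iff)
      also have "q \<dots> = y \<otimes> q (inv x \<otimes> cj s x)" using F.M_mult[OF qV x(1)] z UV x(2) by blast
      finally show ?thesis using z by (auto simp: W_def)
    qed
    have d_W: "cj d w \<in> W" if d: "d \<in> W1" and w: "w \<in> W" for d w
    proof -
      obtain z where "z \<in> W" "cj d w = w \<otimes> z" using modW[OF d] w WV by blast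
      then show ?thesis using subgroup.m_closed[OF W w] by simp
    qed
    have "\<exists>h. MF (V <#> W1) h \<and> (\<forall>x\<in>V. h x = \<beta> x)"
    proof (rule F.rec_ext_prod[OF _ \<beta> \<beta>V W1 W1n])
      show "F.rec V" using V by (simp add: F.nice_def)
      fix d assume d: "d \<in> W1"
      have dc: "d \<in> carrier G" by (rule W1car[OF d])
      have di: "inv d \<in> W1" by (rule subgroup.m_inv_closed[OF W1 d])
      have dn: "d \<in> nrm (carrier G) V" "inv d \<in> nrm (carrier G) V" using W1n d di by auto
      \<comment> \<open>The failure of \<beta> to commute with conjugation by d: k after
        \<open>cj d\<close> after \<beta> equals \<beta> after \<open>cj d\<close>.\<close>
      define k where "k x = \<beta> (cj d (inv_into V \<beta> (cj (inv d) x)))" for x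
      have cd: "MF V (cj e) \<and> cj e ` V = V" if "e \<in> nrm (carrier G) V" for e
        using that F.M_conj[OF V(1), of e] Vcar nrm_sub by (auto simp: nrm_def)
      have c1: "MF V (\<lambda>x. inv_into V \<beta> (cj (inv d) x)) \<and> (\<lambda>x. inv_into V \<beta> (cj (inv d) x)) ` V = V"
        by (rule F.M_aut_comp) (use F.M_aut_inv[OF \<beta> \<beta>V] cd[OF dn(2)] in auto)
      have c2: "MF V (\<lambda>x. cj d (inv_into V \<beta> (cj (inv d) x))) \<and> (\<lambda>x. cj d (inv_into V \<beta> (cj (inv d) x))) ` V = V"
        by (rule F.M_aut_comp) (use c1 cd[OF dn(1)] in auto)
      have kM: "MF V k \<and> k ` V = V" unfolding k_def by (rule F.M_aut_comp) (use c2 \<beta> \<beta>V in auto)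
      have kd: "k (cj d (\<beta> x)) = \<beta> (cj d x)" if "x \<in> V" for x
      proof -
        have "\<beta> x \<in> V" using that \<beta>V by blast
        then show ?thesis using that dc Vcar F.M_inj[OF \<beta>] by (simp add: k_def)
      qed
      have \<beta>z: "\<beta> (x \<otimes> z) = \<beta> x \<otimes> z" if "x \<in> V" "z \<in> W" for x z
        using F.M_mult[OF \<beta> that(1)] that WV \<beta>W by auto
      have kz: "\<exists>z\<in>W. k y = y \<otimes> z" if y: "y \<in> V" for y
      proof -
        obtain y' where y': "y' \<in> V" "y = cj d y'" using y dn(1) by (auto simp: nrm_def)
        obtain x where x: "x \<in> V" "y' = \<beta> x" using y'(1) \<beta>V by blast
        obtain z where z: "z \<in> W" "cj d x = x \<otimes> z" using modW[OF d x(1)] by blast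
        obtain t where t: "t \<in> W" "y = y' \<otimes> t" using modW[OF d y'(1)] y'(2) by auto
        have ti: "inv t \<in> W" by (rule subgroup.m_inv_closed[OF W t(1)])
        have tc: "t \<in> carrier G" "z \<in> carrier G" "y' \<in> carrier G" using t z y' WV Vcar by auto
        have "k y = y' \<otimes> z" using kd[OF x(1)] y'(2) x(2) z \<beta>z[OF x(1) z(1)] by simp
        also have "\<dots> = y \<otimes> (inv t \<otimes> z)" using t tc by (simp add: m_assoc)
        finally show ?thesis using subgroup.m_closed[OF W ti z(1)] by blast
      qed
      have kW: "k w = w" if w: "w \<in> W" for w
      proof -
        define v where "v = cj (inv d) w"
        have v: "v \<in> W" unfolding v_def by (rule d_W[OF di w])
        have dv: "cj d v = w" unfolding v_def using dc w WV Vcar by auto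
        have "k (cj d (\<beta> v)) = \<beta> (cj d v)" using kd v WV by blast
        then show ?thesis using \<beta>W[OF v] dv \<beta>W[OF w] by simp
      qed
      have "\<exists>r\<in>nrm (carrier G) V. \<forall>x\<in>V. k x = cj r x"
      proof (rule stabilizing_auts_induced[OF V(2) W VT])
        show "MF V k" "k ` V = V" using kM by auto
        show "k w = w" if "w \<in> W" for w by (rule kW[OF that])
        show "inv x \<otimes> k x \<in> W" if x: "x \<in> V" for x
        proof -
          obtain z where z: "z \<in> W" "k x = x \<otimes> z" using kz[OF x] by blast
          then show ?thesis using Vcar x WV by auto
        qed
      qed
      then obtain r where r: "r\<in>nrm (carrier G) V" "\<forall>x\<in>V. k x = cj r x" by blast
      have rc: "r \<in> carrier G" using r nrm_sub by blast
      have "\<beta> (cj d x) = cj (d \<otimes> r) (\<beta> x)" if x: "x \<in> V" for x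
      proof -
        have \<beta>x: "\<beta> x \<in> V" using x \<beta>V by blast
        have "\<beta> (cj d x) = cj r (cj d (\<beta> x))" using kd[OF x] r(2) nrmD[OF dn(1) \<beta>x] by simp
        then show ?thesis using dc rc Vcar[OF \<beta>x] by (simp add: cj_comp)
      qed
      moreover have "d \<otimes> r \<in> nrm (carrier G) V" by (rule subgroup.m_closed[OF F.nrmT_sub[OF V(1)] dn(1) r(1)])
      ultimately show "\<exists>r\<in>nrm (carrier G) V. \<forall>x\<in>V. \<beta> (cj d x) = cj r (\<beta> x)" by blast
    qed
    then obtain h where h: "MF (V <#> W1) h" "\<And>x. x \<in> V \<Longrightarrow> h x = \<beta> x" by blast
    define X1 where "X1 = V <#> W1"
    have X1: "subgroup X1 G" "MF X1 h" using F.M_dom[OF h(1)] h(1) by (auto simp: X1_def)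
    have VX: "V \<subseteq> X1" and WX: "W1 \<subseteq> X1" unfolding X1_def by (rule prod_left[OF V(1) W1], rule prod_right[OF V(1) W1])
    \<comment> \<open>h fixes W pointwise, so h(s) and s act alike on W. Their quotient lies in
      C_T(W), which is contained in W by centricity.\<close>
    have hW1: "\<exists>z\<in>W. h s = z \<otimes> s" if s: "s \<in> W1" for s
    proof -
      have sc: "s \<in> carrier G" "h s \<in> carrier G" using W1car[OF s] F.M_fcar[OF X1(2)] WX s by auto
      have "h ` W1 \<subseteq> T" by (rule closed[OF F.M_restrict[OF X1(2) W1 WX] WT(2)])
      then have hT: "h s \<in> T" using s by blast
      have si: "inv s \<in> W1" by (rule subgroup.m_inv_closed[OF W1 s])
      have "h s \<otimes> inv s \<in> cen T W" unfolding cen_def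
      proof (intro CollectI conjI ballI)
        show "h s \<otimes> inv s \<in> T" using subgroup.m_closed[OF T_sub hT] si WT by blast
        fix w assume w: "w \<in> W"
        have wc: "w \<in> carrier G" using w WV Vcar by blast
        have hw: "h w = w" "h (cj s w) = cj s w" using h(2) \<beta>W w d_W[OF s w] WV by auto
        have "cj s w = cj (h s) w" using F.M_cj_eq[OF X1(2), of w s] hw w WV VX WX s by auto
        then show "cj (h s \<otimes> inv s) w = w" using sc wc by (simp add: cj_comp) (metis cj_inv1)
      qed
      then have "h s \<otimes> inv s \<in> W" using centricD(3)[OF less.prems(1) qU] by (auto simp: W_def)
      moreover have "h s = (h s \<otimes> inv s) \<otimes> s" using sc by (simp add: m_assoc)
      ultimately show ?thesis by blast
    qed
    have hV: "h ` V = V" using h(2) \<beta>V by (metis (no_types, lifting) image_cong)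
    have hX: "h ` X1 = X1"
    proof (rule card_seteq[OF fin_sub[OF X1(1)]])
      show "h ` X1 \<subseteq> X1"
      proof (rule image_subsetI)
        fix x assume "x \<in> X1"
        then obtain v s where x: "v \<in> V" "s \<in> W1" "x = v \<otimes> s" by (auto simp: X1_def prod_mem)
        obtain z where z: "z \<in> W" "h s = z \<otimes> s" using hW1[OF x(2)] by blast
        have "h x = h v \<otimes> (z \<otimes> s)"
          using F.M_mult[OF X1(2) subsetD[OF VX x(1)] subsetD[OF WX x(2)]] x z by simp
        moreover have "h v \<in> X1" "z \<in> X1" "s \<in> X1" using x z hV VX WX WV by blast+
        ultimately show "h x \<in> X1" using subgroup.m_closed[OF X1(1)] by simp
      qed
      show "card X1 \<le> card (h ` X1)" using F.M_card[OF X1(2) subset_refl] by simp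
    qed
    obtain N where N: "order G = p ^ N" using order_p_power by blast
    have cop: "coprime (order G) m" using N prime_p m(2) by (simp add: prime_imp_coprime)
    have oG: "order G \<noteq> 0" using finite_carrier by (simp add: order_gt_0_iff_finite)
    \<comment> \<open>The exponent is divisible by the order of G, which cancels the translations of
      W1 by elements of W, and is 1 modulo m, which preserves \<beta>.\<close>
    obtain u v where uv: "order G * u = m * v + 1" using bezout_nat[OF oG, of m] cop by auto
    define e where "e = order G * u"
    define h2 where "h2 = h ^^ e"
    have h2: "MF X1 h2" using F.M_pow[OF X1(2) hX] by (simp add: h2_def)
    have h2s: "h2 s = s" if s: "s \<in> W1" for s
    proof -
      obtain z where z: "z \<in> W" "h s = z \<otimes> s" using hW1[OF s] by blast
      have car: "z \<in> carrier G" "s \<in> carrier G" using z s WV Vcar W1car by auto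
      have hz: "h y = y" if "y \<in> W" for y using h(2) \<beta>W that WV by auto
      have pw: "(h ^^ n) s = z [^] n \<otimes> s" for n
      proof (induction n)
        case 0 then show ?case using car by simp
      next
        case (Suc n)
        have zn: "z [^] n \<in> W" by (rule sub_pow[OF W z(1)])
        have "z [^] n \<in> X1" "s \<in> X1" using zn s WV VX WX by blast+
        then have "(h ^^ Suc n) s = h (z [^] n) \<otimes> h s" using Suc F.M_mult[OF X1(2)] by simp
        also have "\<dots> = z [^] Suc n \<otimes> s" using hz[OF zn] z car by (simp add: m_assoc)
        finally show ?case .
      qed
      have "z [^] e = (z [^] order G) [^] u" using car by (simp add: e_def nat_pow_pow)
      then have "z [^] e = \<one>" using pow_order_eq_1[OF car(1)] by simp
      then show ?thesis using pw[of e] car by (simp add: h2_def)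
    qed
    have \<beta>n: "(h ^^ n) (q x) = q ((b ^^ n) x)" if x: "x \<in> V0" for x n
    proof (induction n)
      case (Suc n)
      have bn: "(b ^^ n) x \<in> V0" by (rule F.M_pow_in[OF b0(1,2) x])
      then have "h (q ((b ^^ n) x)) = q (b ((b ^^ n) x))" using h(2) \<beta>q by (auto simp: V_def)
      then show ?case using Suc by simp
    qed simp
    have h2q: "h2 (q x) = q (b x)" if x: "x \<in> V0" for x
    proof -
      have "(b ^^ e) x = b x" using funpow_mod_fix[of m b x v 1] b0(3)[OF x] uv by (simp add: e_def)
      then show ?thesis using \<beta>n[OF x, of e] by (simp add: h2_def)
    qed
    \<comment> \<open>Back along q: the map sends s y to s b(y) for s in U' and y in U C, so it is
      an automorphism of Y fixing U'.\<close>
    define b2 where "b2 x = inv_into Y q (h2 (q x))" for x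
    have qYX: "q ` Y \<subseteq> X1"
    proof (rule image_subsetI)
      fix x assume "x \<in> Y"
      then obtain s c where x: "s \<in> U'" "c \<in> C" "x = s \<otimes> c" by (auto simp: Y_def prod_mem)
      have "q x = q s \<otimes> q c" using F.M_mult[OF qY subsetD[OF U'Y x(1)] subsetD[OF CY x(2)]] x by simp
      moreover have "q s \<in> X1" "q c \<in> X1" using x WX VX CV by (auto simp: W1_def V_def)
      ultimately show "q x \<in> X1" using subgroup.m_closed[OF X1(1)] by simp
    qed
    have h2sv: "h2 (q (s \<otimes> y)) = q (s \<otimes> b y)" if s: "s \<in> U'" and y: "y \<in> V0" for s y
    proof -
      have yb: "b y \<in> V0" using y b0 by blast
      have in1: "q s \<in> X1" "q y \<in> X1" "q s \<in> W1" using s y WX VX by (auto simp: W1_def V_def)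
      have "q (s \<otimes> y) = q s \<otimes> q y" "q (s \<otimes> b y) = q s \<otimes> q (b y)"
        using F.M_mult[OF qY] s y yb U'Y VY by blast+
      then show ?thesis using F.M_mult[OF h2 in1(1,2)] h2s[OF in1(3)] h2q[OF y] by simp
    qed
    have sbY: "s \<otimes> b y \<in> Y" if "s \<in> U'" "y \<in> V0" for s y
    proof -
      have "b y \<in> Y" "s \<in> Y" using that b0 VY U'Y by blast+
      then show ?thesis using subgroup.m_closed[OF Y] by simp
    qed
    have b2v: "b2 (s \<otimes> y) = s \<otimes> b y" if "s \<in> U'" "y \<in> V0" for s y
      using h2sv[OF that] qi[OF sbY[OF that]] by (simp add: b2_def)
    have qh: "MF Y (\<lambda>x. h2 (q x))" by (rule F.M_comp_sub[OF qY h2 qYX])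
    have "(\<lambda>x. h2 (q x)) ` Y \<subseteq> q ` Y"
    proof (rule image_subsetI)
      fix x assume "x \<in> Y"
      then obtain s c where x: "s \<in> U'" "c \<in> C" "x = s \<otimes> c" by (auto simp: Y_def prod_mem)
      then have "h2 (q x) = q (s \<otimes> b c)" using h2sv CV by auto
      then show "h2 (q x) \<in> q ` Y" using sbY x CV by blast
    qed
    then have b2: "MF Y b2" unfolding b2_def by (rule F.M_comp_sub[OF qh F.M_inv_into[OF qY]])
    have YE: "\<exists>s\<in>U'. \<exists>c\<in>C. x = s \<otimes> c" if "x \<in> Y" for x using that by (auto simp: Y_def prod_mem)
    have b2Y: "b2 ` Y = Y"
    proof (rule card_seteq[OF fin_sub[OF Y]])
      show "b2 ` Y \<subseteq> Y"
      proof (rule image_subsetI)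
        fix x assume "x \<in> Y"
        then obtain s c where sc: "s \<in> U'" "c \<in> C" "x = s \<otimes> c" using YE by blast
        then have "c \<in> V0" using CV by blast
        then show "b2 x \<in> Y" using b2v[OF sc(1)] sbY[OF sc(1)] sc(3) by simp
      qed
      show "card Y \<le> card (b2 ` Y)" using F.M_card[OF b2 subset_refl] by simp
    qed
    have b2V: "b2 x = b x" if x: "x \<in> V0" for x
    proof -
      have "b x \<in> V0" using x b0 by blast
      then show ?thesis using b2v[OF subgroup.one_closed[OF U'(1)] x] x V0c by (simp add: subset_iff)
    qed
    have b2U: "b2 s = s" if s: "s \<in> U'" for s
      using b2v[OF s subgroup.one_closed[OF V0]] F.M_one[OF b0(1)] carU'[OF s] by simp
    have b2m: "(b2 ^^ m) x = x" if x: "x \<in> Y" for x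
    proof -
      obtain s c where sc: "s \<in> U'" "c \<in> C" "x = s \<otimes> c" using YE[OF x] by blast
      have cV: "c \<in> V0" using sc CV by blast
      have "(b2 ^^ n) (s \<otimes> c) = s \<otimes> (b ^^ n) c" for n
      proof (induction n)
        case (Suc n)
        then show ?case using b2v[OF sc(1) F.M_pow_in[OF b0(1,2) cV]] by simp
      qed simp
      then show ?thesis using b0(3)[OF cV] sc by simp
    qed
    have CcU': "centric U'" by (rule centric_mono[OF less.prems(1) U'(1,3,2)])
    have "\<exists>b'. MF (T <#> C) b' \<and> b' ` (T <#> C) = T <#> C \<and> (\<forall>x\<in>T. b' x = x) \<and> (\<forall>x\<in>U' <#> C. b' x = b2 x)"
    proof (rule less.hyps[OF _ CcU'])
      have "card U < card U'" by (rule psubset_card_mono[OF fin_sub[OF U'(1)] UU])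
      moreover have "card U' \<le> card T" by (rule card_mono[OF fin_sub[OF T_sub] U'(2)])
      ultimately show "card T - card U' < card T - card U" by simp
    qed (use b2 b2Y b2U m b2m in \<open>auto simp: Y_def\<close>)
    then obtain b' where b': "MF (T <#> C) b'" "b' ` (T <#> C) = T <#> C" "\<forall>x\<in>T. b' x = x" "\<forall>x\<in>U' <#> C. b' x = b2 x" by blast
    have "b' x = b x" if "x \<in> U <#> C" for x
      using b'(4) b2V that VY by (auto simp: V0_def Y_def)
    then show ?thesis using b'(1-3) by blast
  qed
qed

text \<open>\<alpha> commutes with its powers, so \<open>good_auto\<close> makes it good on every
  image of S under them.\<close>

lemma good_pow:
  assumes a: "MF T \<alpha>" and g: "good S \<alpha>"
  shows "good S (\<alpha> ^^ n)"
proof (induction n)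
  case 0
  have "good S (\<lambda>x. x)" by (rule M0_good[OF Z.M_id]) (use good_facts[OF g] in auto)
  then show ?case by (simp add: id_def)
next
  case (Suc n)
  have "good ((\<alpha> ^^ n) ` S) \<alpha>"
    by (rule good_auto[OF g, of "\<alpha> ^^ n"]) (use F.M_pow[OF a F_onto[OF a], of n] in \<open>auto simp: funpow_swap1\<close>)
  from good_comp[OF Suc this] show ?case by (simp add: comp_def)
qed

text \<open>A power of p as exponent makes the order of the extension A prime to p. Undoing f on S'
  by a good extension k and then applying A gives b, an automorphism of S' C trivial on S' that
  agrees with A modulo T. A p'-power of b extends to some B trivial on T, and A followed by the
  inverse of B is the extension sought.\<close>

lemma good_p_pow:
  assumes a: "ME T \<alpha>" and g: "good S \<alpha>"
  shows "\<exists>n. good T (\<alpha> ^^ (p ^ n))"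
proof -
  have aF: "MF T \<alpha>" by (rule EF[OF a])
  have TC: "subgroup (T <#> C) G" unfolding C_def by (rule F.UC_sub[OF T_sub])
  have TTC: "T \<subseteq> T <#> C" and CTC: "C \<subseteq> T <#> C" by (rule prod_left[OF T_sub C_sub], rule prod_right[OF T_sub C_sub])
  have TCc: "x \<in> carrier G" if "x \<in> T <#> C" for x using that TC sub_mem by blast
  obtain A0 where A0: "MF (T <#> C) A0" "\<forall>x\<in>T. A0 x = \<alpha> x" using aut_ext_T[OF aF] by blast
  have A0T: "A0 ` T = T" using A0(2) F_onto[OF aF] by (metis (no_types, lifting) image_cong)
  have A0TC: "A0 ` (T <#> C) = T <#> C"
  proof (rule card_seteq[OF fin_sub[OF TC]])
    show "A0 ` (T <#> C) \<subseteq> T <#> C" using F.M_UC[of T A0] A0(1) T_sub A0T by (simp add: C_def)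
    show "card (T <#> C) \<le> card (A0 ` (T <#> C))" using F.M_card[OF A0(1) subset_refl] by simp
  qed
  obtain n m1 where nm: "m1 > 0" "\<not> p dvd m1" "\<And>x. x \<in> T <#> C \<Longrightarrow> (A0 ^^ (p ^ n * m1)) x = x"
    using F.M_order[OF A0(1) A0TC] by blast
  define f where "f = \<alpha> ^^ (p ^ n)"
  define A where "A = A0 ^^ (p ^ n)"
  have A: "MF (T <#> C) A" "A ` (T <#> C) = T <#> C" using F.M_pow[OF A0(1) A0TC] by (auto simp: A_def)
  have Am: "(A ^^ m1) x = x" if "x \<in> T <#> C" for x using nm(3)[OF that] by (simp add: A_def funpow_mult mult.commute)
  have Af: "A x = f x" if "x \<in> T" for x unfolding A_def f_def
    by (rule funpow_cong_on[OF _ that]) (use A0(2) A0T in auto)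
  have AT: "A x \<in> T" if "x \<in> T" for x using Af[OF that] F.M_pow_in[OF aF F_onto[OF aF] that] by (simp add: f_def)
  have f: "good S f" unfolding f_def by (rule good_pow[OF aF g])
  note ff = good_facts[OF f]
  define S' where "S' = f ` S"
  have S': "subgroup S' G" "S' \<subseteq> T" "centric S'" using ff by (auto simp: S'_def)
  have CS': "C \<subseteq> cen (carrier G) S'" by (rule C_mono[OF S'(2)])
  define i where "i = inv_into S f"
  have fi: "i (f x) = x" if "x \<in> S" for x using that E.M_inj[OF ff(4)] by (simp add: i_def)
  have "good S' i" unfolding S'_def by (rule good_inv[OF f fi])
  then have "ext_mod_T C S' i" by (simp add: good_def)
  then obtain k where k: "MF (S' <#> C) k" "\<And>x. x\<in>S' \<Longrightarrow> k x = i x" "\<And>c. c\<in>C \<Longrightarrow> inv c \<otimes> k c \<in> T" by (auto simp: ext_mod_T_def)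
  have iS: "i ` S' = S" unfolding S'_def using fi by (auto simp: image_image)
  have kim: "k ` (S' <#> C) = S <#> C"
    using ext_mod_T_img[OF k C_sub CS' _ S'(1,2)] iS ff(11) centric_cen[OF ff(3)] by simp
  have SC: "subgroup (S <#> C) G" by (rule prod_sub[OF ff(1) C_sub ff(11)])
  have S'C: "subgroup (S' <#> C) G" by (rule prod_sub[OF S'(1) C_sub CS'])
  have SCT: "S <#> C \<subseteq> T <#> C" "S' <#> C \<subseteq> T <#> C"
    by (rule mono_set_mult[OF ff(2) subset_refl], rule mono_set_mult[OF S'(2) subset_refl])
  have AC: "A c \<in> C" if c: "c \<in> C" for c
  proof -
    have "A ` T = T" using AT F.M_card[OF A(1) TTC] by (intro card_seteq[OF fin_sub[OF T_sub]]) auto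
    moreover have "A c \<in> cen (carrier G) (A ` T)" by (rule F.M_cen[OF A(1) TTC]) (use c CTC C_def in auto)
    ultimately show ?thesis by (simp add: C_def)
  qed
  have ASC: "A ` (S <#> C) = S' <#> C"
  proof (rule card_seteq[OF fin_sub[OF S'C]])
    show "A ` (S <#> C) \<subseteq> S' <#> C"
    proof (rule image_subsetI)
      fix x assume "x \<in> S <#> C"
      then obtain s c where x: "s \<in> S" "c \<in> C" "x = s \<otimes> c" by (auto simp: prod_mem)
      have s: "s \<in> T" using x ff(2) by blast
      have "A x = f s \<otimes> A c" using F.M_mult[OF A(1) subsetD[OF TTC s] subsetD[OF CTC x(2)]] x(3) Af[OF s] by simp
      then show "A x \<in> S' <#> C" using AC[OF x(2)] x(1) by (auto simp: prod_mem S'_def)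
    qed
    show "card (S' <#> C) \<le> card (A ` (S <#> C))"
      using F.M_card[OF A(1) SCT(1)] F.M_card[OF k(1) subset_refl] kim by simp
  qed
  define b where "b x = A (k x)" for x
  have b: "MF (S' <#> C) b" unfolding b_def
    by (rule F.M_comp_sub[OF k(1) A(1)]) (use kim SCT in simp)
  have bim: "b ` (S' <#> C) = S' <#> C" using image_image[of A k "S' <#> C"] kim ASC by (simp add: b_def)
  have bS: "b x = x" if x: "x \<in> S'" for x
  proof -
    obtain s where s: "s \<in> S" "x = f s" using x by (auto simp: S'_def)
    then show ?thesis using k(2)[OF x] fi Af ff(2) by (auto simp: b_def)
  qed
  obtain n2 m2 where nm2: "m2 > 0" "\<not> p dvd m2" "\<And>x. x \<in> S' <#> C \<Longrightarrow> (b ^^ (p ^ n2 * m2)) x = x"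
    using F.M_order[OF b bim] by blast
  \<comment> \<open>The exponent r is to be a multiple of \<open>p ^ n2\<close>, so that b' has
    order prime to p, and 1 modulo m1, so that A to the power r is A.\<close>
  have "coprime (p ^ n2) m1" using prime_p nm(2) by (simp add: prime_imp_coprime)
  moreover have "p ^ n2 \<noteq> 0" using prime_p by (simp add: prime_gt_0_nat)
  ultimately obtain u v where uv: "p ^ n2 * u = m1 * v + 1" using bezout_nat[of "p ^ n2" m1] by auto
  define r where "r = p ^ n2 * u"
  define b' where "b' = b ^^ r"
  have b': "MF (S' <#> C) b'" "b' ` (S' <#> C) = S' <#> C" using F.M_pow[OF b bim] by (auto simp: b'_def)
  have b'S: "b' x = x" if "x \<in> S'" for x
  proof -
    have "(b ^^ j) x = x" for j using bS[OF that] by (induction j) auto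
    then show ?thesis by (simp add: b'_def)
  qed
  have b'm: "(b' ^^ m2) x = x" if x: "x \<in> S' <#> C" for x
  proof -
    have "(b' ^^ m2) x = (b ^^ (p ^ n2 * m2 * u)) x" by (simp add: b'_def r_def funpow_mult mult_ac)
    then show ?thesis using funpow_fix_mult[OF nm2(3)[OF x]] by simp
  qed
  obtain B where B: "MF (T <#> C) B" "B ` (T <#> C) = T <#> C" "\<forall>x\<in>T. B x = x" "\<forall>x\<in>S' <#> C. B x = b' x"
    using extends_over_T[OF S'(3) b' b'S nm2(1,2) b'm] by blast
  have kmod: "\<exists>t\<in>T. k y = y \<otimes> t" if y: "y \<in> S' <#> C" for y
  proof -
    obtain s c where sc: "s \<in> S'" "c \<in> C" "y = s \<otimes> c" using y by (auto simp: prod_mem)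
    have in1: "s \<in> S' <#> C" "c \<in> S' <#> C" using sc prod_left[OF S'(1) C_sub] prod_right[OF S'(1) C_sub] by auto
    define t where "t = inv s \<otimes> k s"
    define t0 where "t0 = inv c \<otimes> k c"
    have "k s \<in> S" using k(2)[OF sc(1)] iS sc(1) by auto
    then have tT: "t \<in> T" "t0 \<in> T" unfolding t_def t0_def
      using k(3)[OF sc(2)] subgroup.m_closed[OF T_sub subgroup.m_inv_closed[OF T_sub]] sc(1) S'(2) ff(2) by blast+
    have car: "s \<in> carrier G" "c \<in> carrier G" "k s \<in> carrier G" "k c \<in> carrier G"
      using F.M_car[OF k(1)] F.M_fcar[OF k(1)] in1 by auto
    have "cj c t \<otimes> t0 \<in> T" using T_cj[OF car(2) tT(1)] tT(2) subgroup.m_closed[OF T_sub] by blast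
    moreover have "k y = y \<otimes> (cj c t \<otimes> t0)"
      using F.M_mult[OF k(1) in1] sc(3) car by (simp add: t_def t0_def cj_def m_assoc)
    ultimately show ?thesis by blast
  qed
  \<comment> \<open>k is trivial modulo T and A preserves T, so b and A agree modulo T, as do their
    powers.\<close>
  have bA: "\<exists>t\<in>T. (b ^^ j) x = (A ^^ j) x \<otimes> t" if x: "x \<in> S' <#> C" for x j
  proof (induction j)
    case 0 then show ?case using subgroup.one_closed[OF T_sub] TCc SCT x by (intro bexI[of _ \<one>]) auto
  next
    case (Suc j)
    then obtain t where t: "t \<in> T" "(b ^^ j) x = (A ^^ j) x \<otimes> t" by blast
    have y: "(b ^^ j) x \<in> S' <#> C" by (rule F.M_pow_in[OF b bim x])
    obtain t1 where t1: "t1 \<in> T" "k ((b ^^ j) x) = (b ^^ j) x \<otimes> t1" using kmod[OF y] by blast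
    have Aj: "(A ^^ j) x \<in> T <#> C" by (rule F.M_pow_in[OF A]) (use x SCT in blast)
    have tt: "t \<otimes> t1 \<in> T" by (rule subgroup.m_closed[OF T_sub t(1) t1(1)])
    have "(b ^^ Suc j) x = A ((A ^^ j) x \<otimes> (t \<otimes> t1))"
      using t t1 TCc[OF Aj] TCc TTC by (simp add: b_def m_assoc subset_iff)
    also have "\<dots> = (A ^^ Suc j) x \<otimes> A (t \<otimes> t1)" using F.M_mult[OF A(1) Aj subsetD[OF TTC tt]] by simp
    finally show ?case using AT[OF tt] by blast
  qed
  define h where "h x = inv_into (T <#> C) B (A x)" for x
  have Bi: "inv_into (T <#> C) B (B x) = x" if "x \<in> T <#> C" for x using that F.M_inj[OF B(1)] by simp
  have h: "MF (T <#> C) h" unfolding h_def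
    by (rule F.M_comp_sub[OF A(1) F.M_inv_into[OF B(1)]]) (use A(2) B(2) in simp)
  have hT: "h x = f x" if x: "x \<in> T" for x
  proof -
    have "f x = B (f x)" using AT[OF x] Af[OF x] B(3) by simp
    then show ?thesis unfolding h_def using Af[OF x] AT[OF x] Bi[of "f x"] TTC by auto
  qed
  \<comment> \<open>B(c) is A(c) times some t in T, and B fixes t; so the inverse of B takes A(c) to
    c times the inverse of t.\<close>
  have hC: "inv c \<otimes> h c \<in> T" if c: "c \<in> C" for c
  proof -
    have cS: "c \<in> S' <#> C" and cT: "c \<in> T <#> C" using c prod_right[OF S'(1) C_sub] CTC by auto
    obtain t where t: "t \<in> T" "(b ^^ r) c = (A ^^ r) c \<otimes> t" using bA[OF cS] by blast
    have "(A ^^ r) c = A c" using funpow_mod_fix[of m1 A c v 1] Am[OF cT] uv by (simp add: r_def)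
    then have Bc: "B c = A c \<otimes> t" using t(2) B(4) cS by (simp add: b'_def)
    have ti: "inv t \<in> T" by (rule subgroup.m_inv_closed[OF T_sub t(1)])
    have car: "A c \<in> carrier G" "t \<in> carrier G" "c \<in> carrier G" using F.M_fcar[OF A(1) cT] t(1) T_le TCc[OF cT] by auto
    have "B (c \<otimes> inv t) = A c" using F.M_mult[OF B(1) cT subsetD[OF TTC ti]] Bc B(3) ti car by (simp add: m_assoc)
    moreover have "c \<otimes> inv t \<in> T <#> C" using subgroup.m_closed[OF TC cT subsetD[OF TTC ti]] .
    ultimately have "h c = c \<otimes> inv t" unfolding h_def using Bi by metis
    then show ?thesis using ti car by simp
  qed
  have "ext_mod_T C T f" unfolding ext_mod_T_def using h hT hC by blast
  moreover have "ME T f" unfolding f_def using E.M_pow[OF a E.M_onto[OF a]] by blast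
  ultimately show ?thesis using centric_T by (auto simp: good_def f_def)
qed

text \<open>T is fully automized in E, so Inn(T) is a normal Sylow p-subgroup of Aut_E(T). A power
  of \<alpha> with exponent prime to p is thus inner, and inner automorphisms are good.\<close>

lemma good_coprime_pow:
  assumes a: "ME T \<alpha>"
  shows "\<exists>m>0. \<not> p dvd m \<and> good T (\<alpha> ^^ m)"
proof -
  have aT: "\<alpha> ` T = T" by (rule E.M_onto[OF a])
  have nT: "nrm T T = T" using self_nrm[OF T_sub T_sub subset_refl] nrm_sub by blast
  let ?a = "restrict \<alpha> T"
  have aA: "?a \<in> E.auts T" using aT E.M_cong[OF a, of ?a] by (simp add: E.auts_def)
  have fT: "E.fa T" using E.nice_top[OF Esat] by (simp add: E.nice_def)
  have "\<exists>m>0. \<not> p dvd m \<and> restrict (?a ^^ m) T \<in> indu T T"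
  proof (rule permset_index_pow[OF prime_p fin_sub[OF T_sub] E.permset_auts[OF T_sub subset_refl]
        permset_indu[OF T_sub T_sub] _ _ _ aA])
    show "T \<subseteq> nrm T T" using nT by simp
    show "indu T T \<subseteq> E.auts T" by (rule E.indu_auts[OF T_sub subset_refl]) (simp add: nT)
    show "card (indu T T) = p ^ multiplicity p (card (E.auts T))" using fT nT by (simp add: E.fa_def)
    fix b i assume b: "b \<in> E.auts T" and i: "i \<in> indu T T"
    have bM: "ME T b" "b ` T = T" using b by (auto simp: E.auts_def)
    obtain t where t: "t \<in> T" "i = restrict (cj t) T" using i by (auto simp: indu_def)
    have "b (i x) = restrict (cj (b t)) T (b x)" if x: "x \<in> T" for x
      using E.M_cj_eq[OF bM(1) x t(1)] t(2) x bM(2) by auto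
    moreover have "restrict (cj (b t)) T \<in> indu T T" using t(1) bM by (auto simp: indu_def)
    ultimately show "\<exists>j\<in>indu T T. \<forall>x\<in>T. b (i x) = j (b x)" by blast
  qed
  then obtain m where m: "m > 0" "\<not> p dvd m" "restrict (?a ^^ m) T \<in> indu T T" by blast
  obtain t where t: "t \<in> T" "restrict (?a ^^ m) T = restrict (cj t) T" using m(3) by (auto simp: indu_def)
  have "cj t x = (\<alpha> ^^ m) x" if x: "x \<in> T" for x
  proof -
    have "(\<alpha> ^^ m) x = (?a ^^ m) x" by (rule funpow_cong_on[OF _ x]) (use aT in auto)
    then show ?thesis using t(2) x by (metis restrict_apply')
  qed
  then have "good T (\<alpha> ^^ m)" by (rule good_cong[OF good_conj[OF t(1)]])
  then show ?thesis using m by blast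
qed

text \<open>The two exponents with good powers are coprime, and the good automorphisms of T form a
  group.\<close>

lemma good_extends:
  assumes a: "ME T \<alpha>" and g: "good S \<alpha>"
  shows "good T \<alpha>"
proof -
  have pw: "good T ((\<alpha> ^^ j) ^^ l)" if "good T (\<alpha> ^^ j)" for j l
    by (rule good_pow[OF good_facts(5)[OF that] that])
  obtain n where n: "good T (\<alpha> ^^ (p ^ n))" using good_p_pow[OF assms] by blast
  obtain m where m: "m > 0" "\<not> p dvd m" "good T (\<alpha> ^^ m)" using good_coprime_pow[OF a] by blast
  have "coprime m p" using prime_imp_coprime[OF prime_p m(2)] by (simp only: coprime_commute)
  then have "coprime m (p ^ n)" by simp
  then obtain x y where xy: "m * x = p ^ n * y + 1" using bezout_nat[of m "p ^ n"] m(1) by auto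
  define q where "q = \<alpha> ^^ (p ^ n * y)"
  have q: "good T q" using pw[OF n, of y] by (simp add: q_def funpow_mult mult.commute)
  have mx: "good T (\<alpha> ^^ (m * x))" using pw[OF m(3), of x] by (simp add: funpow_mult mult.commute)
  have mxT: "(\<alpha> ^^ (m * x)) ` T = T" and qT: "q ` T = T" using E.M_onto good_facts(4)[OF mx] good_facts(4)[OF q] by auto
  have inj: "inj_on q T" by (rule E.M_inj[OF good_facts(4)[OF q]])
  have "good T (inv_into T q)" using good_inv[OF q, of "inv_into T q"] inj qT by simp
  then have "good T (\<lambda>z. inv_into T q ((\<alpha> ^^ (m * x)) z))" using good_comp[OF mx] mxT by simp
  then show ?thesis
  proof (rule good_cong)
    fix z assume z: "z \<in> T"
    have "(\<alpha> ^^ (m * x)) z = q (\<alpha> z)" unfolding xy q_def by (simp add: funpow_swap1)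
    moreover have "\<alpha> z \<in> T" by (rule E.M_ran[OF a z])
    ultimately show "inv_into T q ((\<alpha> ^^ (m * x)) z) = \<alpha> z" using inj by simp
  qed
qed

text \<open>Write f as e followed by \<alpha> in Aut_E(T). On e(S) the map \<alpha> is f after the
  inverse of e, hence good there, and \<open>good_extends\<close> makes it good on T.\<close>

lemma M0_from_centric:
  assumes f: "ME U f" and S: "centric S" "S \<subseteq> U" and fS: "M0 S f"
  shows "M0 U f"
proof -
  have U: "U \<subseteq> T" using E.M_dom[OF f] by simp
  obtain e \<alpha> where e: "M0 U e" "ME T \<alpha>" "\<And>x. x \<in> U \<Longrightarrow> f x = \<alpha> (e x)"
    using E_frattini[OF f U] by (auto simp: A.dec_def)
  have eS: "M0 S e" by (rule Z.M_restrict[OF e(1) centricD(1)[OF S(1)] S(2)])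
  have "M0 (e ` S) (\<lambda>y. f (inv_into S e y))"
    by (rule Z.M_comp[OF Z.M_inv_into[OF eS]]) (use Z.inv_img[OF eS subset_refl] fS in simp)
  then have "M0 (e ` S) \<alpha>"
  proof (rule Z.M_cong)
    fix y assume "y \<in> e ` S"
    then obtain x where x: "x \<in> S" "y = e x" by auto
    then show "f (inv_into S e y) = \<alpha> y" using Z.M_inj[OF eS] e(3)[of x] S(2) by auto
  qed
  then have "good (e ` S) \<alpha>" by (rule M0_good[OF _ centric_iso[OF EF[OF M0_E[OF eS]] S(1)]])
  then have "good T \<alpha>" by (rule good_extends[OF e(2)])
  then have "M0 T \<alpha>" by (rule good_M0)
  then have "M0 U (\<lambda>x. \<alpha> (e x))" by (rule Z.M_comp_sub[OF e(1) _ E.M_imgT[OF M0_E[OF e(1)]]])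
  then show ?thesis by (rule Z.M_cong) (use e(3) in simp)
qed

section \<open>Representatives and saturation of the generated subsystem\<close>

definition repr :: "'a set \<Rightarrow> bool" where
  "repr R \<longleftrightarrow> E.nice R \<and> E.nice (R <#> cen T R)"

lemma Z_fa: assumes "E.nice R" shows "Z.fa R"
proof -
  have R: "subgroup R G" "R \<subseteq> T" "E.fa R" using assms by (auto simp: E.nice_def)
  show ?thesis unfolding Z.fa_def
    by (rule sylow_between[OF prime_p fin_sub[OF R(1)] permset_indu[OF E.nrmT_sub[OF R(1)] R(1) subset_refl]
          Z.permset_auts[OF R(1,2)] E.permset_auts[OF R(1,2)] Z.indu_auts[OF R(1,2) subset_refl]])
      (use R in \<open>auto simp: E.fa_def Z.auts_def E.auts_def M0_E\<close>)
qed

text \<open>\<open>Nf\<close> depends only on conjugation in T, so it is the same group for both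
  systems. The E-extension agrees with f on the centric S and therefore belongs to the
  subsystem.\<close>

lemma Z_rec_centric: assumes R: "E.nice R" and c: "centric R" shows "Z.rec R"
  unfolding Z.rec_def
proof (intro allI impI, elim conjE)
  fix S f assume f: "M0 S f" "f ` S = R"
  obtain h where h: "ME (Z.Nf S f) h" "\<forall>x\<in>S. h x = f x"
    using R f M0_E[OF f(1)] unfolding E.nice_def E.rec_def by blast
  have S: "centric S" by (rule centric_iso'[OF EF[OF M0_E[OF f(1)]]]) (use E.M_dom[OF M0_E[OF f(1)]] c f in auto)
  have "M0 S h" by (rule Z.M_cong[OF f(1)]) (use h in simp)
  then have "M0 (Z.Nf S f) h" by (rule M0_from_centric[OF h(1) S Z.subgroup_Nf(2)[OF f(1)]])
  then show "\<exists>h. M0 (Z.Nf S f) h \<and> (\<forall>x\<in>S. h x = f x)" using h by blast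
qed

lemma auto_cen: assumes b: "ME T \<beta>" and R: "subgroup R G" "R \<subseteq> T" shows "\<beta> ` cen T R = cen T (\<beta> ` R)"
proof
  have bT: "\<beta> ` T = T" by (rule E.M_onto[OF b])
  show "\<beta> ` cen T R \<subseteq> cen T (\<beta> ` R)" using E.M_cen[OF b R(2)] cen_sub by blast
  show "cen T (\<beta> ` R) \<subseteq> \<beta> ` cen T R"
  proof
    fix y assume y: "y \<in> cen T (\<beta> ` R)"
    then have "y \<in> T" using cen_sub by blast
    then obtain x where x: "x \<in> T" "y = \<beta> x" using bT by blast
    have "cj x r = r" if r: "r \<in> R" for r
    proof -
      have rT: "r \<in> T" using r R by blast
      have "\<beta> (cj x r) = \<beta> r" using E.M_cj_eq[OF b rT x(1)] y x(2) r by (auto simp: cen_def)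
      then show ?thesis using E.M_inj_eq[OF b cj_sub[OF T_sub x(1) rT] rT] by simp
    qed
    then show "y \<in> \<beta> ` cen T R" using x by (auto simp: cen_def)
  qed
qed

lemma auto_prod: assumes b: "ME T \<beta>" and R: "subgroup R G" "R \<subseteq> T" shows "\<beta> ` (R <#> cen T R) = \<beta> ` R <#> cen T (\<beta> ` R)"
proof -
  have "\<beta> (r \<otimes> c) = \<beta> r \<otimes> \<beta> c" if "r \<in> R" "c \<in> cen T R" for r c
    using E.M_mult[OF b] that R cen_sub by blast
  then show ?thesis unfolding auto_cen[OF assms, symmetric] set_mult_def by (auto simp: image_iff) blast+
qed

text \<open>\<open>nice_UC_centric\<close> controls the E-conjugates. F-conjugates differ from these
  by automorphisms of T, which preserve centralizers in T.\<close>

lemma E_UC_centric: assumes R: "E.nice R" shows "centric (R <#> cen T R)"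
  unfolding centric_def
proof (intro conjI allI impI)
  have Rs: "subgroup R G" "R \<subseteq> T" using R by (auto simp: E.nice_def)
  show W: "subgroup (R <#> cen T R) G" "R <#> cen T R \<subseteq> T" by (rule E.UC_sub[OF Rs(1)], rule E.UC_T[OF Rs(2)])
  fix f assume f: "MF (R <#> cen T R) f"
  obtain e \<alpha> where e: "M0 (R <#> cen T R) e" "MF T \<alpha>" "\<And>x. x \<in> R <#> cen T R \<Longrightarrow> f x = \<alpha> (e x)"
    using F_frattini[OF f W(2)] by (auto simp: B.dec_def)
  have eE: "ME (R <#> cen T R) e" by (rule M0_E[OF e(1)])
  have c: "cen T (e ` (R <#> cen T R)) \<subseteq> e ` (R <#> cen T R)" by (rule E.nice_UC_centric[OF R eE])
  let ?W = "e ` (R <#> cen T R)"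
  have fW: "f ` (R <#> cen T R) = \<alpha> ` ?W" unfolding image_image using e(3) by (intro image_cong) auto
  have WT: "?W \<subseteq> T" by (rule E.M_imgT[OF eE])
  have "cen T (\<alpha> ` ?W) \<subseteq> \<alpha> ` ?W"
  proof
    fix y assume y: "y \<in> cen T (\<alpha> ` ?W)"
    then have "y \<in> T" using cen_sub by blast
    then obtain x where x: "x \<in> T" "y = \<alpha> x" using F_onto[OF e(2)] by blast
    have "cj x r = r" if r: "r \<in> ?W" for r
    proof -
      have rT: "r \<in> T" using r WT by blast
      have "\<alpha> (cj x r) = \<alpha> r" using F.M_cj_eq[OF e(2) rT x(1)] y x(2) r by (auto simp: cen_def)
      then show ?thesis using F.M_inj_eq[OF e(2) cj_sub[OF T_sub x(1) rT] rT] by simp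
    qed
    then have "x \<in> cen T ?W" using x by (auto simp: cen_def)
    then show "y \<in> \<alpha> ` ?W" using c x by blast
  qed
  then show "cen T (f ` (R <#> cen T R)) \<subseteq> f ` (R <#> cen T R)" using fW by simp
qed

text \<open>\<open>nice2_rep\<close> gives a map h in E only. Splitting off its factor \<alpha> in
  Aut_E(T) leaves an \<open>M0\<close>-morphism e, and the image of U under e is the image of a nice
  subgroup under the automorphism \<beta> of T, hence still nice.\<close>

lemma repr_exists:
  assumes U: "subgroup U G" "U \<subseteq> T"
  shows "\<exists>e. M0 (nrm T U) e \<and> repr (e ` U)"
proof -
  obtain h where h: "ME (nrm T U) h" "E.nice (h ` U)" "E.nice (h ` U <#> cen T (h ` U))"
    using E.nice2_rep[OF Esat U] by blast
  obtain e \<alpha> where e: "M0 (nrm T U) e" "ME T \<alpha>" "\<And>x. x \<in> nrm T U \<Longrightarrow> h x = \<alpha> (e x)"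
    using E_frattini[OF h(1) nrm_sub] by (auto simp: A.dec_def)
  define \<beta> where "\<beta> = inv_into T \<alpha>"
  have \<beta>: "ME T \<beta>" using E.M_inv_into[OF e(2)] E.M_onto[OF e(2)] by (simp add: \<beta>_def)
  have UN: "U \<subseteq> nrm T U" by (rule self_nrm[OF T_sub U])
  let ?R = "h ` U"
  have Rs: "subgroup ?R G" "?R \<subseteq> T" using h(2) by (auto simp: E.nice_def)
  have eU: "e ` U = \<beta> ` ?R"
  proof -
    have "\<beta> (h x) = e x" if x: "x \<in> U" for x
      using e(3)[of x] UN x E.M_inj[OF e(2)] E.M_ran[OF M0_E[OF e(1)], of x] by (auto simp: \<beta>_def)
    then show ?thesis unfolding image_image by (intro image_cong) auto
  qed
  have "E.nice (\<beta> ` ?R)"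
    by (rule E.nice_transfer[OF h(2) E.M_restrict[OF \<beta> E.nrmT_sub[OF Rs(1)] nrm_sub]])
  moreover have "E.nice (\<beta> ` (?R <#> cen T ?R))"
    by (rule E.nice_transfer[OF h(3) E.M_restrict[OF \<beta> E.nrmT_sub[OF E.UC_sub[OF Rs(1)]] nrm_sub]])
  ultimately have "repr (e ` U)" using auto_prod[OF \<beta> Rs] eU by (simp add: repr_def)
  then show ?thesis using e(1) by blast
qed

sublocale X: centric_generated G p T M0 repr centric
proof (rule centric_generated.intro[OF fsys_M0 centric_generated_axioms.intro])
  show "\<And>U. subgroup U G \<Longrightarrow> U \<subseteq> T \<Longrightarrow> \<exists>e. M0 (nrm T U) e \<and> repr (e ` U)" by (rule repr_exists)
  show "\<And>R. repr R \<Longrightarrow> subgroup R G \<and> R \<subseteq> T" by (auto simp: repr_def E.nice_def)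
  show "\<And>R. repr R \<Longrightarrow> Z.fa R" by (auto simp: repr_def Z_fa)
  show "\<And>R. repr R \<Longrightarrow> centric R \<Longrightarrow> Z.rec R" by (auto simp: repr_def Z_rec_centric)
  show "\<And>U f. M0 U f \<Longrightarrow> centric U \<Longrightarrow> centric (f ` U)" by (rule centric_iso[OF EF[OF M0_E]])
  show "Z.nice (R <#> cen T R)" if R: "repr R" for R
  proof -
    have n: "E.nice R" "E.nice (R <#> cen T R)" using R by (auto simp: repr_def)
    show ?thesis unfolding Z.nice_def
      using n(2) Z_fa[OF n(2)] Z_rec_centric[OF n(2) E_UC_centric[OF n(1)]] by (simp add: E.nice_def)
  qed
  show "card (nrm T S) \<le> card (nrm T R) \<and> card (cen T S) \<le> card (cen T R)" if R: "repr R" and f: "M0 S f" "f ` S = R" for R S f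
    using E.nice_max[OF _ M0_E[OF f(1)] f(2)] R by (simp add: repr_def)
next
  fix U f and P :: "'a set \<Rightarrow> ('a \<Rightarrow> 'a) \<Rightarrow> bool"
  assume a: "M0 U f" "\<not> centric U"
    and P1: "\<And>U f V. \<lbrakk>M0 V f; subgroup U G; U \<subset> V\<rbrakk> \<Longrightarrow> P U f"
    and P2: "\<And>U f g. \<lbrakk>M0 U f; P U f; M0 (f ` U) g; P (f ` U) g\<rbrakk> \<Longrightarrow> P U (\<lambda>x. g (f x))"
    and P3: "\<And>U f g. \<lbrakk>P U f; M0 U f; \<And>x. x \<in> U \<Longrightarrow> f x = g x\<rbrakk> \<Longrightarrow> P U g"
  show "P U f"
  proof (rule M0_gen[where P = P, OF a])
    show "P U f" if "M0 V f" "subgroup U G" "U \<subset> V" for U f V by (rule P1[OF that])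
    show "P U (\<lambda>x. g (f x))" if "M0 U f" "P U f" "M0 (f ` U) g" "P (f ` U) g" for U f g by (rule P2[OF that])
    show "P U g" if "P U f" "M0 U f" "\<And>x. x \<in> U \<Longrightarrow> f x = g x" for U f g by (rule P3[OF that])
  qed
qed

theorem Z_saturated: "Z.saturated"
  unfolding Z.saturated_def
proof (intro allI impI, elim conjE)
  fix U assume U: "subgroup U G" "U \<subseteq> T"
  obtain e where e: "M0 (nrm T U) e" "repr (e ` U)" using repr_exists[OF U] by blast
  have "M0 U e" by (rule Z.M_restrict[OF e(1) U(1) self_nrm[OF T_sub U]])
  moreover have "Z.nice (e ` U)" using X.R_dom[OF e(2)] X.R_fa[OF e(2)] X.repr_receptive[OF e(2)] by (simp add: Z.nice_def)
  ultimately show "\<exists>f. M0 U f \<and> Z.nice (f ` U)" by blast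
qed

end

section \<open>Translation to and from the given definitions\<close>

locale fusion_on = finite_p_group G p for G (structure) and p +
  fixes T E
  assumes subT: "subgroup T G" and FS: "fusion_system (G\<lparr>carrier := T\<rparr>) p E"
begin

abbreviation "GT \<equiv> G\<lparr>carrier := T\<rparr>"

lemma sub_iff: "subgroup U GT \<longleftrightarrow> subgroup U G \<and> U \<subseteq> T"
  using incl_subgroup[OF subT] subgroup_incl[OF _ subT] subgroup.subset[of U GT] by auto

lemma inv_T: "g \<in> T \<Longrightarrow> inv\<^bsub>GT\<^esub> g = inv g"
  by (rule m_inv_consistent[OF subT])

lemma conj_T: "g \<in> T \<Longrightarrow> conj_map GT U g = restrict (cj g) U"
  unfolding conj_map_def by (rule restrict_ext) (simp add: cj_def inv_T)

definition M :: "'a set \<Rightarrow> ('a \<Rightarrow> 'a) \<Rightarrow> bool" where "M U f \<longleftrightarrow> restrict f U \<in> E U T"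

lemma E_facts:
  assumes "\<phi> \<in> E Q R"
  shows "subgroup Q G" "Q \<subseteq> T" "subgroup R G" "R \<subseteq> T" "\<phi> \<in> extensional Q" "inj_on \<phi> Q" "\<phi> ` Q \<subseteq> R"
    "x \<in> Q \<Longrightarrow> y \<in> Q \<Longrightarrow> \<phi> (x \<otimes> y) = \<phi> x \<otimes> \<phi> y"
  using fusion_system.objects[OF FS assms] fusion_system.morphism_hom[OF FS assms]
    fusion_system.morphism_extensional[OF FS assms] fusion_system.morphism_inj[OF FS assms]
  by (auto simp: sub_iff hom_def)

text \<open>Changing the target means composing with an inclusion, which is conjugation by the
  identity element.\<close>

lemma incl_E:
  assumes "\<phi> \<in> E Q R" "subgroup S G" "S \<subseteq> T" "\<phi> ` Q \<subseteq> S"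
  shows "\<phi> \<in> E Q S"
proof -
  have i: "\<phi> \<in> E Q (\<phi> ` Q)" by (rule fusion_system.iso_onto_image[OF FS assms(1)])
  note f = E_facts[OF i]
  have one: "\<one> \<in> T" by (rule subgroup.one_closed[OF subT])
  have c: "conj_map GT (\<phi> ` Q) \<one> = restrict (\<lambda>x. x) (\<phi> ` Q)"
    unfolding conj_T[OF one] by (rule restrict_ext) (use f(3) sub_mem in simp)
  have "conj_map GT (\<phi> ` Q) \<one> \<in> E (\<phi> ` Q) S"
    by (rule fusion_system.conj_morphism[OF FS]) (use f assms one in \<open>auto simp: sub_iff c\<close>)
  from fusion_system.comp_morphism[OF FS i this]
  have "compose Q (conj_map GT (\<phi> ` Q) \<one>) \<phi> \<in> E Q S" .
  moreover have "compose Q (conj_map GT (\<phi> ` Q) \<one>) \<phi> = \<phi>"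
    unfolding c by (rule extensionalityI[of _ Q]) (use f in \<open>auto simp: compose_def\<close>)
  ultimately show ?thesis by simp
qed

lemma E_iff: "\<phi> \<in> E Q R \<longleftrightarrow> \<phi> \<in> extensional Q \<and> M Q \<phi> \<and> subgroup R G \<and> R \<subseteq> T \<and> \<phi> ` Q \<subseteq> R"
proof
  assume \<phi>: "\<phi> \<in> E Q R"
  note f = E_facts[OF \<phi>]
  have "\<phi> \<in> E Q T" by (rule incl_E[OF \<phi> subT subset_refl]) (use f in blast)
  then show "\<phi> \<in> extensional Q \<and> M Q \<phi> \<and> subgroup R G \<and> R \<subseteq> T \<and> \<phi> ` Q \<subseteq> R"
    using f by (simp add: M_def extensional_restrict)
next
  assume *: "\<phi> \<in> extensional Q \<and> M Q \<phi> \<and> subgroup R G \<and> R \<subseteq> T \<and> \<phi> ` Q \<subseteq> R"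
  then have "restrict \<phi> Q = \<phi>" by (intro extensional_restrict) simp
  then have "\<phi> \<in> E Q T" using * unfolding M_def by metis
  then show "\<phi> \<in> E Q R" using incl_E * by blast
qed

lemma M_conv: "M U f \<Longrightarrow> restrict f U \<in> E U T" "M U f \<Longrightarrow> f ` U \<subseteq> T" "M U f \<Longrightarrow> restrict f U \<in> E U (f ` U)"
proof -
  assume M: "M U f"
  then show *: "restrict f U \<in> E U T" by (simp add: M_def)
  show "f ` U \<subseteq> T" using E_facts(7)[OF *] by simp
  have "restrict f U ` U = f ` U" by simp
  then show "restrict f U \<in> E U (f ` U)" using fusion_system.iso_onto_image[OF FS *] by (simp only:)
qed

lemma fsys_M: "fsys G p T M"
proof (rule fsys.intro[OF finite_p_group_axioms fsys_axioms.intro])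
  show "subgroup T G" by (rule subT)
  show "subgroup U G \<and> U \<subseteq> T" if "M U f" for U f using E_facts[OF M_conv(1)[OF that]] by simp
  show "f x \<in> T" if "M U f" "x \<in> U" for U f x using M_conv(2)[OF that(1)] that(2) by blast
  show "f (x \<otimes> y) = f x \<otimes> f y" if m: "M U f" and x: "x \<in> U" "y \<in> U" for U f x y
  proof -
    note f = E_facts[OF M_conv(1)[OF m]]
    have "x \<otimes> y \<in> U" using subgroup.m_closed[OF f(1) x] .
    then show ?thesis using f(8)[OF x] x by simp
  qed
  show "inj_on f U" if "M U f" for U f using E_facts(6)[OF M_conv(1)[OF that]] by (simp add: inj_on_restrict_eq)
  show "M U g" if "M U f" "\<And>x. x \<in> U \<Longrightarrow> f x = g x" for U f g
    using that restrict_ext[of U f g] by (simp add: M_def)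
  have conj: "M U (cj t)" if U: "subgroup U G" "U \<subseteq> T" and t: "t \<in> T" for U t
  proof -
    have "conj_map GT U t \<in> E U T"
      by (rule fusion_system.conj_morphism[OF FS]) (use U t subT cj_sub[OF subT t] in \<open>auto simp: sub_iff conj_T\<close>)
    then show ?thesis by (simp add: M_def conj_T[OF t])
  qed
  then show "M U (cj t)" if "subgroup U G" "U \<subseteq> T" "t \<in> T" for U t using that by blast
  have comp: "M U (\<lambda>x. g (f x))" if f: "M U f" and g: "M (f ` U) g" for U f g
  proof -
    have "compose U (restrict g (f ` U)) (restrict f U) \<in> E U T"
      by (rule fusion_system.comp_morphism[OF FS M_conv(3)[OF f] M_conv(1)[OF g]])
    moreover have "compose U (restrict g (f ` U)) (restrict f U) = restrict (\<lambda>x. g (f x)) U"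
      by (auto simp: compose_def restrict_def fun_eq_iff)
    ultimately show ?thesis by (simp add: M_def)
  qed
  then show "M U (\<lambda>x. g (f x))" if "M U f" "M (f ` U) g" for U f g using that by blast
  show "M V f" if f: "M U f" and V: "subgroup V G" "V \<subseteq> U" for U f V
  proof -
    have VT: "V \<subseteq> T" using V(2) E_facts(2)[OF M_conv(1)[OF f]] by blast
    have one: "\<one> \<in> T" by (rule subgroup.one_closed[OF subT])
    have c: "conj_map GT V \<one> = restrict (\<lambda>x. x) V"
      unfolding conj_T[OF one] by (rule restrict_ext) (use V sub_mem in simp)
    have "conj_map GT V \<one> \<in> E V U"
      by (rule fusion_system.conj_morphism[OF FS]) (use V VT one E_facts[OF M_conv(1)[OF f]] in \<open>auto simp: sub_iff c\<close>)
    from fusion_system.comp_morphism[OF FS this M_conv(1)[OF f]]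
    have "compose V (restrict f U) (restrict (\<lambda>x. x) V) \<in> E V T" by (simp only: c)
    moreover have "compose V (restrict f U) (restrict (\<lambda>x. x) V) = restrict f V"
      using V by (auto simp: compose_def restrict_def fun_eq_iff)
    ultimately show ?thesis by (simp add: M_def)
  qed
  show "M (f ` U) g" if f: "M U f" and g: "\<And>x. x \<in> U \<Longrightarrow> g (f x) = x" for U f g
  proof -
    have inj: "inj_on (restrict f U) U" by (rule E_facts(6)[OF M_conv(1)[OF f]])
    have i: "restrict (inv_into U (restrict f U)) (f ` U) \<in> E (f ` U) U"
    proof -
      have "restrict f U ` U = f ` U" by simp
      then show ?thesis using fusion_system.inverse_morphism[OF FS M_conv(1)[OF f]] by (simp only:)
    qed
    have "restrict (inv_into U (restrict f U)) (f ` U) = restrict g (f ` U)"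
    proof (rule restrict_ext)
      fix y assume "y \<in> f ` U"
      then obtain x where x: "x \<in> U" "y = f x" by auto
      have "inv_into U (restrict f U) (restrict f U x) = x" using inj x(1) by (rule inv_into_f_f)
      then show "inv_into U (restrict f U) y = g y" using x g by simp
    qed
    then have "restrict g (f ` U) \<in> E (f ` U) U" using i by simp
    from incl_E[OF this subT subset_refl] E_facts[OF this] show ?thesis by (auto simp: M_def)
  qed
qed

sublocale fsys G p T M by (rule fsys_M)

text \<open>\<open>normalizer\<close> and \<open>nrm\<close> conjugate on opposite sides; they agree
  because a subgroup contains the inverses of its elements.\<close>

lemma normalizer_T: assumes U: "subgroup U G" "U \<subseteq> T" shows "normalizer GT U = nrm T U"
proof -
  have eq: "g <#\<^bsub>GT\<^esub> U #>\<^bsub>GT\<^esub> inv\<^bsub>GT\<^esub> g = cj (inv g) ` U" if g: "g \<in> T" for g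
    using that T_car inv_T by (auto simp: l_coset_def r_coset_def cj_def)
  have "g \<in> normalizer GT U \<longleftrightarrow> g \<in> T \<and> cj (inv g) ` U = U" for g
    using U eq by (auto simp: normalizer_def stabilizer_def)
  moreover have "g \<in> T \<and> cj (inv g) ` U = U \<longleftrightarrow> g \<in> nrm T U" for g
  proof -
    have "inv g \<in> nrm T U \<longleftrightarrow> g \<in> nrm T U" if "g \<in> T"
      using subgroup.m_inv_closed[OF nrmT_sub[OF U(1)]] T_car[OF that] by (metis inv_inv)
    moreover have "inv g \<in> T" if "g \<in> T" using subgroup.m_inv_closed[OF subT that] .
    ultimately show ?thesis by (auto simp: nrm_def)
  qed
  ultimately show ?thesis by blast
qed

lemma Aut_P_T: assumes U: "subgroup U G" "U \<subseteq> T" shows "Aut_P GT U = indu (nrm T U) U"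
  unfolding Aut_P_def normalizer_T[OF U] indu_def by (rule image_cong) (use nrm_sub conj_T in blast)+

lemma auts_E: assumes U: "subgroup U G" "U \<subseteq> T" shows "E U U = auts U"
proof
  show "E U U \<subseteq> auts U"
  proof
    fix f assume "f \<in> E U U"
    then have f: "f \<in> extensional U" "M U f" "f ` U \<subseteq> U" by (auto simp: E_iff)
    then have "f ` U = U" using M_card[OF f(2) subset_refl] by (intro card_seteq[OF fin_sub[OF U(1)]]) auto
    then show "f \<in> auts U" using f by (simp add: auts_def)
  qed
qed (use U in \<open>auto simp: auts_def E_iff\<close>)

lemma fa_conv: assumes U: "subgroup U G" "U \<subseteq> T" shows "fully_automized GT p E U \<longleftrightarrow> fa U"
  using permset_mono_sub[OF permset_auts[OF U] permset_indu[OF nrmT_sub[OF U(1)] U(1) subset_refl] indu_auts[OF U subset_refl]]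
  by (auto simp: fully_automized_def sylow_subgroup_def Aut_F_def auts_E[OF U] Aut_P_T[OF U] fa_def order_def)

text \<open>\<open>N_phi\<close> pulls automorphisms of R back along the inverse of f; applying f to
  both sides turns this into the equation in \<open>Nf\<close>.\<close>

lemma N_phi_conv:
  assumes f: "M S f" "f ` S = R"
  shows "N_phi GT S R (restrict f S) = Nf S f"
proof -
  have S: "subgroup S G" "S \<subseteq> T" using M_dom[OF f(1)] by auto
  have R: "subgroup R G" "R \<subseteq> T" using M_img[OF f(1)] M_imgT[OF f(1)] f(2) by auto
  have inj: "inj_on (restrict f S) S" using M_inj[OF f(1)] by (simp add: inj_on_def)
  have key: "restrict (cj g) S = (\<lambda>x\<in>S. inv_into S (restrict f S) (restrict (cj r) R (restrict f S x))) \<longleftrightarrow>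
      (\<forall>x\<in>S. f (cj g x) = cj r (f x))" if g: "g \<in> nrm T S" and r: "r \<in> nrm T R" for g r
  proof -
    have "cj g x = inv_into S (restrict f S) (cj r (f x)) \<longleftrightarrow> f (cj g x) = cj r (f x)" if x: "x \<in> S" for x
    proof -
      have gx: "cj g x \<in> S" by (rule nrmD[OF g x])
      have "cj r (f x) \<in> restrict f S ` S" using nrmD[OF r] f(2) x by auto
      then have "restrict f S (inv_into S (restrict f S) (cj r (f x))) = cj r (f x)"
        "inv_into S (restrict f S) (cj r (f x)) \<in> S" by (rule f_inv_into_f, rule inv_into_into)
      moreover have "inv_into S (restrict f S) (restrict f S (cj g x)) = cj g x" by (rule inv_into_f_f[OF inj gx])
      ultimately show ?thesis using gx by (metis restrict_apply')
    qed
    moreover have "restrict (cj g) S = (\<lambda>x\<in>S. inv_into S (restrict f S) (restrict (cj r) R (restrict f S x))) \<longleftrightarrow>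
      (\<forall>x\<in>S. cj g x = inv_into S (restrict f S) (cj r (f x)))"
    proof -
      have "restrict a S = restrict b S \<longleftrightarrow> (\<forall>x\<in>S. a x = b x)" for a b :: "'a \<Rightarrow> 'a"
        by (metis restrict_apply' restrict_ext)
      moreover have "f x \<in> R" if "x \<in> S" for x using f(2) that by blast
      ultimately show ?thesis by simp
    qed
    ultimately show ?thesis by auto
  qed
  have "g \<in> N_phi GT S R (restrict f S) \<longleftrightarrow> g \<in> Nf S f" for g
  proof -
    define H where "H \<alpha> = (\<lambda>x\<in>S. inv_into S (restrict f S) (\<alpha> (restrict f S x)))" for \<alpha>
    have N: "N_phi GT S R (restrict f S) =
      {g \<in> nrm T S. conj_map GT S g \<in> indu (nrm T S) S \<inter> {H \<alpha> |\<alpha>. \<alpha> \<in> indu (nrm T R) R}}"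
      by (simp only: N_phi_def normalizer_T[OF S] Aut_P_T[OF S] Aut_P_T[OF R] H_def)
    have c: "conj_map GT S g = restrict (cj g) S" if "g \<in> nrm T S" using that nrm_sub by (intro conj_T) blast
    have "g \<in> N_phi GT S R (restrict f S) \<longleftrightarrow> g \<in> nrm T S \<and> (\<exists>r\<in>nrm T R. restrict (cj g) S = H (restrict (cj r) R))"
    proof (cases "g \<in> nrm T S")
      case True
      have "restrict (cj g) S \<in> indu (nrm T S) S" unfolding indu_def using True by (rule imageI)
      then have "g \<in> N_phi GT S R (restrict f S) \<longleftrightarrow> restrict (cj g) S \<in> {H \<alpha> |\<alpha>. \<alpha> \<in> indu (nrm T R) R}"
        using True by (simp only: N c mem_Collect_eq Int_iff simp_thms)
      then show ?thesis using True unfolding indu_def by blast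
    qed (simp add: N)
    then have "g \<in> N_phi GT S R (restrict f S) \<longleftrightarrow> g \<in> nrm T S \<and> (\<exists>r\<in>nrm T R. \<forall>x\<in>S. f (cj g x) = cj r (f x))"
      using key unfolding H_def by blast
    then show ?thesis using f(2) by (auto simp: Nf_def)
  qed
  then show ?thesis by blast
qed

lemma isos_conv: "fusion_isos E S R = {f \<in> extensional S. M S f \<and> f ` S = R}"
proof (intro equalityI subsetI)
  fix f assume "f \<in> fusion_isos E S R"
  then show "f \<in> {f \<in> extensional S. M S f \<and> f ` S = R}" by (auto simp: fusion_isos_def E_iff bij_betw_def)
next
  fix f assume "f \<in> {f \<in> extensional S. M S f \<and> f ` S = R}"
  then show "f \<in> fusion_isos E S R"
    using M_img[of S f] M_imgT[of S f] M_inj[of S f] by (auto simp: fusion_isos_def E_iff bij_betw_def)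
qed

lemma rec_conv: "receptive GT E R \<longleftrightarrow> rec R"
proof
  assume r: "receptive GT E R"
  show "rec R" unfolding rec_def
  proof (intro allI impI, elim conjE)
    fix S f assume f: "M S f" "f ` S = R"
    have "restrict f S \<in> fusion_isos E S R" using f M_cong[OF f(1), of "restrict f S"] by (simp add: isos_conv)
    then obtain \<psi> where \<psi>: "\<psi> \<in> E (N_phi GT S R (restrict f S)) (carrier GT)" "\<forall>x\<in>S. \<psi> x = restrict f S x"
      using r unfolding receptive_def by blast
    then have "M (Nf S f) \<psi>" by (simp add: N_phi_conv[OF f] E_iff)
    then show "\<exists>h. M (Nf S f) h \<and> (\<forall>x\<in>S. h x = f x)" using \<psi>(2) by auto
  qed
next
  assume r: "rec R"
  show "receptive GT E R" unfolding receptive_def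
  proof (intro allI ballI)
    fix S f assume "f \<in> fusion_isos E S R"
    then have f: "M S f" "f ` S = R" "f \<in> extensional S" by (auto simp: isos_conv)
    obtain h where h: "M (Nf S f) h" "\<forall>x\<in>S. h x = f x" using r f unfolding rec_def by blast
    have e: "restrict f S = f" using f(3) by (rule extensional_restrict)
    have "restrict h (Nf S f) \<in> E (N_phi GT S R f) (carrier GT)"
      using h(1) N_phi_conv[OF f(1,2)] e by (simp add: M_def)
    then show "\<exists>\<psi>\<in>E (N_phi GT S R f) (carrier GT). \<forall>x\<in>S. \<psi> x = f x"
      using h(2) subgroup_Nf(2)[OF f(1)] by (intro bexI[of _ "restrict h (Nf S f)"]) auto
  qed
qed

lemma sat_conv: "saturated_fusion_system GT p E \<longleftrightarrow> saturated"
proof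
  assume s: "saturated_fusion_system GT p E"
  show saturated unfolding saturated_def
  proof (intro allI impI, elim conjE)
    fix U assume U: "subgroup U G" "U \<subseteq> T"
    then have "subgroup U GT" by (simp add: sub_iff)
    then obtain R where R: "fusion_isos E U R \<noteq> {}" "fully_automized GT p E R" "receptive GT E R"
      using s unfolding saturated_fusion_system_def by blast
    then obtain f where f: "M U f" "f ` U = R" by (auto simp: isos_conv)
    have Rs: "subgroup R G" "R \<subseteq> T" using M_img[OF f(1)] M_imgT[OF f(1)] f(2) by auto
    have "nice R" using R Rs fa_conv[OF Rs] rec_conv by (simp add: nice_def)
    then show "\<exists>f. M U f \<and> nice (f ` U)" using f by blast
  qed
next
  assume s: saturated
  show "saturated_fusion_system GT p E" unfolding saturated_fusion_system_def
  proof (intro conjI FS allI impI)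
    fix Q assume "subgroup Q GT"
    then obtain f where f: "M Q f" "nice (f ` Q)" using s unfolding saturated_def sub_iff by blast
    have "restrict f Q \<in> fusion_isos E Q (f ` Q)" using M_cong[OF f(1), of "restrict f Q"] by (simp add: isos_conv)
    then show "\<exists>R. fusion_isos E Q R \<noteq> {} \<and> fully_automized GT p E R \<and> receptive GT E R"
      using f(2) fa_conv[of "f ` Q"] rec_conv unfolding nice_def by blast
  qed
qed

end

section \<open>Morphism sets recovered from total functions\<close>

context fsys
begin

definition Fus :: "'a set \<Rightarrow> 'a set \<Rightarrow> ('a \<Rightarrow> 'a) set" where
  "Fus Q R = {\<phi> \<in> extensional Q. M Q \<phi> \<and> subgroup R G \<and> R \<subseteq> T \<and> \<phi> ` Q \<subseteq> R}"

lemma p_group_T: "finite_p_group (G\<lparr>carrier := T\<rparr>) p"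
proof (rule finite_p_group.intro)
  show "group (G\<lparr>carrier := T\<rparr>)" by (rule subgroup.subgroup_is_group[OF T_sub group_axioms])
  show "finite_p_group_axioms (G\<lparr>carrier := T\<rparr>) p"
    by unfold_locales (use prime_p fin_sub[OF T_sub] order_subgroup[OF T_sub] in \<open>auto simp: order_def\<close>)
qed

lemma fusion_Fus: "fusion_system (G\<lparr>carrier := T\<rparr>) p Fus"
proof (rule fusion_system.intro[OF p_group_T fusion_system_axioms.intro])
  let ?GT = "G\<lparr>carrier := T\<rparr>"
  have si: "subgroup U ?GT \<longleftrightarrow> subgroup U G \<and> U \<subseteq> T" for U
    using incl_subgroup[OF T_sub] subgroup_incl[OF _ T_sub] subgroup.subset[of U ?GT] by auto
  have cT: "conj_map ?GT U g = restrict (cj g) U" if "g \<in> T" for U g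
    unfolding conj_map_def by (rule restrict_ext) (simp add: m_inv_consistent[OF T_sub that] cj_def)
  {
    fix \<phi> Q R assume \<phi>: "\<phi> \<in> Fus Q R"
    then have f: "\<phi> \<in> extensional Q" "M Q \<phi>" "subgroup R G" "R \<subseteq> T" "\<phi> ` Q \<subseteq> R" by (auto simp: Fus_def)
    show "subgroup Q ?GT \<and> subgroup R ?GT" using f M_dom[OF f(2)] by (simp add: si)
    show "\<phi> \<in> hom (?GT\<lparr>carrier := Q\<rparr>) (?GT\<lparr>carrier := R\<rparr>)" using f M_mult[OF f(2)] by (auto simp: hom_def)
    show "\<phi> \<in> extensional Q" by (rule f)
    show "inj_on \<phi> Q" by (rule M_inj[OF f(2)])
    show "\<phi> \<in> Fus Q (\<phi> ` Q)" using f M_img[OF f(2)] by (auto simp: Fus_def)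
    have "M (\<phi> ` Q) (restrict (inv_into Q \<phi>) (\<phi> ` Q))" by (rule M_cong[OF M_inv_into[OF f(2)]]) simp
    then show "restrict (inv_into Q \<phi>) (\<phi> ` Q) \<in> Fus (\<phi> ` Q) Q"
      using f M_dom[OF f(2)] inv_img[OF f(2) subset_refl] by (simp add: Fus_def)
    fix \<psi> S assume \<psi>: "\<psi> \<in> Fus R S"
    then have g: "\<psi> \<in> extensional R" "M R \<psi>" "subgroup S G" "S \<subseteq> T" "\<psi> ` R \<subseteq> S" by (auto simp: Fus_def)
    have "M Q (compose Q \<psi> \<phi>)" by (rule M_cong[OF M_comp_sub[OF f(2) g(2) f(5)]]) (simp add: compose_eq)
    moreover have "compose Q \<psi> \<phi> ` Q \<subseteq> S"
    proof (rule image_subsetI)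
      fix x assume x: "x \<in> Q"
      then have "\<phi> x \<in> R" using f(5) by blast
      then show "compose Q \<psi> \<phi> x \<in> S" using x g(5) by (auto simp: compose_eq)
    qed
    ultimately show "compose Q \<psi> \<phi> \<in> Fus Q S" using g by (simp add: Fus_def compose_def)
  next
    fix Q R g assume *: "subgroup Q ?GT" "subgroup R ?GT" "g \<in> carrier ?GT" "conj_map ?GT Q g ` Q \<subseteq> R"
    then have g: "g \<in> T" by simp
    have "M Q (restrict (cj g) Q)" by (rule M_cong[OF M_conj]) (use * in \<open>auto simp: si\<close>)
    then show "conj_map ?GT Q g \<in> Fus Q R" using * by (simp add: Fus_def cT[OF g] si)
  }
qed

lemma fusion_on_Fus: "fusion_on G p T Fus"
  by (rule fusion_on.intro[OF finite_p_group_axioms fusion_on_axioms.intro[OF T_sub fusion_Fus]])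

text \<open>The round trip is the identity, so saturation of a constructed system can be read off
  through \<open>sat_conv\<close>.\<close>

lemma M_Fus: "fusion_on.M T Fus = M"
proof (intro ext)
  fix U f
  show "fusion_on.M T Fus U f = M U f"
    unfolding fusion_on.M_def[OF fusion_on_Fus] Fus_def
    using M_cong[of U f "restrict f U"] M_cong[of U "restrict f U" f] M_imgT[of U f] T_sub by auto
qed

end

theorem corollaryC:
  fixes G :: "('a, 'b) monoid_scheme" and p :: nat and F :: "'a fusion"
  assumes "Factorial_Ring.prime p" and "saturated_fusion_system G p F"
  shows "(\<nexists>T E. normal_subsystem G p F T E \<and> E \<noteq> F \<and> T \<noteq> {\<one>\<^bsub>G\<^esub>}) \<longleftrightarrow>
         (\<nexists>T E. weakly_normal_subsystem G p F T E \<and> E \<noteq> F \<and> T \<noteq> {\<one>\<^bsub>G\<^esub>})"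
proof
  assume "\<nexists>T E. weakly_normal_subsystem G p F T E \<and> E \<noteq> F \<and> T \<noteq> {\<one>\<^bsub>G\<^esub>}"
  then show "\<nexists>T E. normal_subsystem G p F T E \<and> E \<noteq> F \<and> T \<noteq> {\<one>\<^bsub>G\<^esub>}"
    unfolding normal_subsystem_def by blast
next
  assume no: "\<nexists>T E. normal_subsystem G p F T E \<and> E \<noteq> F \<and> T \<noteq> {\<one>\<^bsub>G\<^esub>}"
  have FF: "fusion_system G p F" using assms(2) by (simp add: saturated_fusion_system_def)
  interpret finite_p_group G p using FF by (rule fusion_system.axioms(1))
  have GG: "G\<lparr>carrier := carrier G\<rparr> = G" by simp
  interpret F: fusion_on G p "carrier G" F
    by (rule fusion_on.intro[OF finite_p_group_axioms fusion_on_axioms.intro]) (use FF subgroup_self in simp_all)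
  show "\<nexists>T E. weakly_normal_subsystem G p F T E \<and> E \<noteq> F \<and> T \<noteq> {\<one>\<^bsub>G\<^esub>}"
  proof (rule notI, elim exE conjE)
    fix T E assume wn: "weakly_normal_subsystem G p F T E" and EF: "E \<noteq> F" and T1: "T \<noteq> {\<one>\<^bsub>G\<^esub>}"
    have Es: "saturated_fusion_system (G\<lparr>carrier := T\<rparr>) p E" and sub: "\<And>Q R. E Q R \<subseteq> F Q R"
      and subT: "subgroup T G" and sc: "strongly_closed G F T" and EE: "fusion_system (G\<lparr>carrier := T\<rparr>) p E"
      and inv: "\<And>Q R \<phi> \<psi>. \<lbrakk>subgroup Q G; subgroup R G; Q \<subseteq> R; R \<subseteq> T; \<phi> \<in> E Q R; \<psi> \<in> F R T\<rbrakk> \<Longrightarrow>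
        (\<lambda>y \<in> \<psi> ` Q. \<psi> (\<phi> (inv_into R \<psi> y))) \<in> E (\<psi> ` Q) (\<psi> ` R)"
      using wn unfolding weakly_normal_subsystem_def invariant_subsystem_def subsystem_def by blast+
    interpret E: fusion_on G p T E
      by (rule fusion_on.intro[OF finite_p_group_axioms fusion_on_axioms.intro[OF subT EE]])
    interpret W: weakly_normal_pair G p F.M E.M T
    proof (rule weakly_normal_pair.intro[OF finite_p_group_axioms weakly_normal_pair_axioms.intro])
      show "fsys G p (carrier G) F.M" by (rule F.fsys_M)
      show "fsys G p T E.M" by (rule E.fsys_M)
      show "F.M U f" if "E.M U f" for U f
      proof -
        have "restrict f U \<in> F U T" using that sub unfolding E.M_def by blast
        then show ?thesis unfolding F.E_iff using F.M_cong[of U "restrict f U" f] by simp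
      qed
      show closed: "f ` U \<subseteq> T" if "F.M U f" "U \<subseteq> T" for U f
      proof -
        have "subgroup U G" "restrict f U \<in> F U (carrier G)" using that F.M_dom[OF that(1)] by (auto simp: F.M_def)
        then have "restrict f U ` U \<subseteq> T" using sc that(2) unfolding strongly_closed_def by blast
        then show ?thesis by simp
      qed
      show "E.M (k ` Q) g" if f: "E.M Q f" and k: "F.M R k" and s: "Q \<subseteq> R" "f ` Q \<subseteq> R" "R \<subseteq> T"
        and g: "\<And>x. x \<in> Q \<Longrightarrow> g (k x) = k (f x)" for Q f R k g
      proof -
        have Q: "subgroup Q G" and R: "subgroup R G" using E.M_dom[OF f] F.M_dom[OF k] by auto
        have f': "restrict f Q \<in> E Q R" unfolding E.E_iff using E.M_cong[OF f, of "restrict f Q"] s R by simp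
        have k': "restrict k R \<in> F R T"
          unfolding F.E_iff using F.M_cong[OF k, of "restrict k R"] closed[OF k s(3)] subT subgroup.subset[OF subT] by simp
        have inj: "inj_on (restrict k R) R" using F.M_inj[OF k] by (simp add: inj_on_def)
        have kQ: "restrict k R ` Q = k ` Q" using s(1) by (intro image_cong) auto
        from inv[OF Q R s(1,3) f' k']
        have "E.M (k ` Q) (\<lambda>y\<in>k ` Q. restrict k R (restrict f Q (inv_into R (restrict k R) y)))"
          unfolding kQ E.E_iff by simp
        then show ?thesis
        proof (rule E.M_cong)
          fix y assume y: "y \<in> k ` Q"
          then obtain x where x: "x \<in> Q" "y = k x" by auto
          have xR: "x \<in> R" "f x \<in> R" using x s by auto
          have "inv_into R (restrict k R) (restrict k R x) = x" by (rule inv_into_f_f[OF inj xR(1)])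
          then show "(\<lambda>y\<in>k ` Q. restrict k R (restrict f Q (inv_into R (restrict k R) y))) y = g y"
            using x xR g y by simp
        qed
      qed
      show "F.saturated" using F.sat_conv assms(2) GG by simp
      show "E.saturated" using E.sat_conv Es by simp
    qed
    define E0 where "E0 = W.Z.Fus"
    have E0_iff: "\<phi> \<in> E0 Q R \<longleftrightarrow> \<phi> \<in> extensional Q \<and> W.M0 Q \<phi> \<and> subgroup R G \<and> R \<subseteq> T \<and> \<phi> ` Q \<subseteq> R" for \<phi> Q R
      by (simp add: E0_def W.Z.Fus_def)
    have sat0: "saturated_fusion_system (G\<lparr>carrier := T\<rparr>) p E0"
      using fusion_on.sat_conv[OF W.Z.fusion_on_Fus] W.Z_saturated by (simp add: W.Z.M_Fus E0_def)
    have E0E: "E0 Q R \<subseteq> E Q R" for Q R by (auto simp: E0_iff E.E_iff W.M0_E)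
    \<comment> \<open>E lies between E0 and F, so E0 = F would force E = F.\<close>
    have E0F: "E0 \<noteq> F"
    proof
      assume "E0 = F"
      then have "E Q R = F Q R" for Q R using E0E sub by blast
      then show False using EF by blast
    qed
    have "weakly_normal_subsystem G p F T E0"
      unfolding weakly_normal_subsystem_def invariant_subsystem_def subsystem_def
    proof (intro conjI sat0 subT sc allI impI)
      show "fusion_system (G\<lparr>carrier := T\<rparr>) p E0" unfolding E0_def by (rule W.Z.fusion_Fus)
      show "E0 Q R \<subseteq> F Q R" for Q R using E0E sub by blast
      fix Q R \<phi> \<psi>
      assume *: "subgroup Q G \<and> subgroup R G \<and> Q \<subseteq> R \<and> R \<subseteq> T \<and> \<phi> \<in> E0 Q R \<and> \<psi> \<in> F R T"
      have \<phi>: "W.M0 Q \<phi>" "\<phi> ` Q \<subseteq> R" and \<psi>: "F.M R \<psi>" "\<psi> ` R \<subseteq> T" using * by (auto simp: E0_iff F.E_iff)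
      have inj: "inj_on \<psi> R" by (rule F.M_inj[OF \<psi>(1)])
      let ?g = "\<lambda>y \<in> \<psi> ` Q. \<psi> (\<phi> (inv_into R \<psi> y))"
      have g: "?g (\<psi> x) = \<psi> (\<phi> x)" if "x \<in> Q" for x using that inj * by (auto simp: subset_iff)
      have "W.M0 (\<psi> ` Q) ?g" by (rule W.M0_invar[OF \<phi>(1) \<psi>(1) _ \<phi>(2) _ g]) (use * in auto)
      moreover have "?g ` \<psi> ` Q \<subseteq> \<psi> ` R"
      proof clarify
        fix x assume x: "x \<in> Q"
        then show "?g (\<psi> x) \<in> \<psi> ` R" unfolding g[OF x] using \<phi>(2) by blast
      qed
      ultimately show "?g \<in> E0 (\<psi> ` Q) (\<psi> ` R)" using F.M_img[OF \<psi>(1)] \<psi>(2) by (simp add: E0_iff)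
    qed
    moreover have "\<exists>\<chi> \<in> F (T <#>\<^bsub>G\<^esub> centralizer G T) (T <#>\<^bsub>G\<^esub> centralizer G T).
        (\<forall>x\<in>T. \<chi> x = \<phi> x) \<and>
        generate G {inv\<^bsub>G\<^esub> x \<otimes>\<^bsub>G\<^esub> \<chi> x |x. x \<in> centralizer G T} \<subseteq> center (G\<lparr>carrier := T\<rparr>)"
      if \<phi>: "\<phi> \<in> E0 T T" for \<phi>
    proof -
      have Tc: "T \<subseteq> carrier G" by (rule subgroup.subset[OF subT])
      have C: "centralizer G T = W.C"
        using Tc by (auto simp: centralizer_def W.C_def cen_def cj_commute subset_iff)
      have Z: "center (G\<lparr>carrier := T\<rparr>) = cen T T"
        using Tc by (auto simp: center_def centralizer_def cen_def cj_commute subset_iff)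
      \<comment> \<open>T is centric, so a generated automorphism of T is itself good, and its
        extension to T C is at hand.\<close>
      have "W.good T \<phi>" using \<phi> by (intro W.M0_good W.centric_T) (simp add: E0_iff)
      then obtain h where h: "F.M (T <#>\<^bsub>G\<^esub> W.C) h" "\<And>x. x \<in> T \<Longrightarrow> h x = \<phi> x" "\<And>c. c \<in> W.C \<Longrightarrow> inv\<^bsub>G\<^esub> c \<otimes>\<^bsub>G\<^esub> h c \<in> T"
        by (auto simp: W.good_def W.ext_mod_T_def)
      let ?TC = "T <#>\<^bsub>G\<^esub> W.C"
      have TC: "subgroup ?TC G" using F.M_dom[OF h(1)] by simp
      have TTC: "T \<subseteq> ?TC" and CTC: "W.C \<subseteq> ?TC" by (rule prod_left[OF subT W.C_sub], rule prod_right[OF subT W.C_sub])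
      have hT: "h ` T = T" by (rule W.F_onto[OF F.M_restrict[OF h(1) subT TTC]])
      have hC: "h c \<in> W.C" if c: "c \<in> W.C" for c
      proof -
        have "h c \<in> cen (carrier G) (h ` T)" by (rule F.M_cen[OF h(1) TTC]) (use c CTC W.C_def in auto)
        then show ?thesis using hT by (simp add: W.C_def)
      qed
      have him: "h ` ?TC \<subseteq> ?TC" using F.M_UC[of T h] h(1) subT hT by (simp add: W.C_def)
      have "restrict h ?TC \<in> F ?TC ?TC"
        unfolding F.E_iff using F.M_cong[OF h(1), of "restrict h ?TC"] him TC subgroup.subset[OF TC] by simp
      moreover have "\<forall>x\<in>T. restrict h ?TC x = \<phi> x" using h(2) TTC by auto
      moreover have "generate G {inv\<^bsub>G\<^esub> x \<otimes>\<^bsub>G\<^esub> restrict h ?TC x |x. x \<in> W.C} \<subseteq> cen T T"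
      proof (rule generate_subgroup_incl[OF _ subgroup_cen[OF subT Tc]])
        show "{inv\<^bsub>G\<^esub> x \<otimes>\<^bsub>G\<^esub> restrict h ?TC x |x. x \<in> W.C} \<subseteq> cen T T"
        proof clarify
          \<comment> \<open>C meets T in the center of T, so triviality modulo T, together with h
            preserving C, gives the commutator condition.\<close>
          fix c assume c: "c \<in> W.C"
          have "inv\<^bsub>G\<^esub> c \<otimes>\<^bsub>G\<^esub> h c \<in> W.C"
            by (rule subgroup.m_closed[OF W.C_sub subgroup.m_inv_closed[OF W.C_sub c] hC[OF c]])
          then have "inv\<^bsub>G\<^esub> c \<otimes>\<^bsub>G\<^esub> h c \<in> cen T T" using h(3)[OF c] by (simp add: W.C_def cen_def)
          then show "inv\<^bsub>G\<^esub> c \<otimes>\<^bsub>G\<^esub> restrict h ?TC c \<in> cen T T" using c CTC by auto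
        qed
      qed
      ultimately show ?thesis unfolding C Z by blast
    qed
    ultimately have "normal_subsystem G p F T E0" by (simp add: normal_subsystem_def)
    then show False using no E0F T1 by blast
  qed
qed

end
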